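(* Let $E$ be a complete, separable, geodesic metric space, and let $T\in\mathcal{M}_1(E)$ be a $1$-dimensional metric current with $T\ne0$ and $\partial T=0$. Then there exist a sequence of positive integers $(n_l)_{l=1}^\infty$ tending to $\infty$ and a countable collection of oriented piecewise-geodesic closed curves $\hat\gamma_{i,l}$ in $E$, $l\in\mathbb{N}$, $i\in\{1,\dots,n_l\}$, such that $\mathbb{M}([[\hat\gamma_{i,l}]])\le\ell(\hat\gamma_{i,l})\le 2l$ for all $i,l$, $$T(\omega)=\lim_{l\to\infty}\frac{\mathbb{M}(T)}{n_l\cdot l}\sum_{i=1}^{n_l}[[\hat\gamma_{i,l}]](\omega)\quad\text{for all }\omega\in\mathcal{D}^1(E),$$ and $$\lim_{l\to\infty}\frac1{n_l\cdot l}\sum_{i=1}^{n_l}\mathbb{M}([[\hat\gamma_{i,l}]])=\lim_{l\to\infty}\frac1{n_l\cdot l}\sum_{i=1}^{n_l}\ell(\hat\gamma_{i,l})=1.$$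
   Context: Geodesic space: for every pair $x,y$ in $(E,d)$ there is a length-minimizing geodesic with endpoints $x,y$. Curves: Lipschitz curves are considered modulo increasing reparametrization and are represented by arc-length parametrizations $\gamma:[0,\ell(\gamma)]\to E$, where $\ell(\gamma)$ is the length and $\ell(\gamma|_{[0,t]})=t$ for all $t$ (constant curves of length $0$ are allowed). A curve is closed if $\gamma(\ell(\gamma))=\gamma(0)$. A geodesic is a curve with $d(\gamma(s),\gamma(t))=|s-t|$ for all $s,t\in[0,\ell(\gamma)]$. A piecewise-geodesic curve is a concatenation of finitely many geodesics (the endpoint of each being the starting point of the next). Metric currents (Ambrosio–Kirchheim): $\operatorname{Lip}(E,\mathbb{R})$ and $\operatorname{Lip_b}(E,\mathbb{R})$ are the real-valued Lipschitz, respectively bounded Lipschitz, functions; $\operatorname{Lip}(\pi)$ is the Lipschitz constant of $\pi$. $\mathcal{D}^1(E)=\{(f,\pi): f\in\operatorname{Lip_b}(E,\mathbb{R}),\ \pi\in\operatorname{Lip}(E,\mathbb{R})\}$. $\mathcal{M}_1(E)$ is the set of bilinear maps $T:\mathcal{D}^1(E)\to\mathbb{R}$ such that: (continuity) $T(f,\pi_j)\to T(f,\pi)$ whenever $\pi_j\to\pi$ pointwise with $\sup_j\operatorname{Lip}(\pi_j)<\infty$; (locality) $T(f,\pi)=0$ whenever $\pi$ is constant on a neighbourhood of $\{f\ne0\}$; (finite mass) there is a finite Borel measure $\mu$ on $E$ with $|T(f,\pi)|\le\operatorname{Lip}(\pi)\int_E|f|\,d\mu$ for all $(f,\pi)$.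 The minimal such $\mu$ is the mass measure $\mu_T$, and $\mathbb{M}(T)=\mu_T(E)$. The boundary is $\partial T(f)=T(1,f)$ for $f\in\operatorname{Lip_b}(E,\mathbb{R})$. Current of a curve: $[[\gamma]](f,\pi)=\int_0^{\ell(\gamma)}(f\circ\gamma)(t)\,d(\pi\circ\gamma)(t)$ (Riemann–Stieltjes integral). *)

theory Defs
  imports "HOL-Analysis.Analysis"
begin

text \<open>
  The ambient space \<open>E\<close> is a type \<open>'a\<close>. Functions and curves are total HOL functions; values
  outside the mathematical domain (forms outside \<open>D1\<close>, parameters outside \<open>[0, clen c]\<close>)
  never matter.
\<close>

text \<open>\<open>Curve L \<gamma>\<close> stands for the parametrized curve given by \<open>\<gamma>\<close> on \<open>{0..L}\<close>.\<close>

datatype 'a curve = Curve (clen: real) (cpoint: "real \<Rightarrow> 'a")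

definition cstart :: "'a curve \<Rightarrow> 'a" where
  "cstart c = cpoint c 0"

definition cend :: "'a curve \<Rightarrow> 'a" where
  "cend c = cpoint c (clen c)"

text \<open>
  Metric length of \<open>\<gamma>\<close> restricted to \<open>{a..b}\<close>, for \<open>a \<le> b\<close>. The members of a division are
  nonempty compact intervals \<open>{Inf K..Sup K}\<close>; degenerate ones contribute \<open>0\<close>.
\<close>

definition length_on :: "(real \<Rightarrow> 'a::metric_space) \<Rightarrow> real \<Rightarrow> real \<Rightarrow> ennreal" where
  "length_on \<gamma> a b =
     (SUP D\<in>{D. D division_of {a..b}}. ennreal (\<Sum>K\<in>D. dist (\<gamma> (Inf K)) (\<gamma> (Sup K))))"

text \<open>
  The defining condition makes \<open>clen c\<close> the length of \<open>c\<close> and \<open>c\<close> automatically 1-Lipschitz.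
\<close>

definition arclength_curve :: "'a::metric_space curve \<Rightarrow> bool" where
  "arclength_curve c \<longleftrightarrow>
     0 \<le> clen c \<and> (\<forall>t\<in>{0..clen c}. length_on (cpoint c) 0 t = ennreal t)"

definition closed_curve :: "'a curve \<Rightarrow> bool" where
  "closed_curve c \<longleftrightarrow> cend c = cstart c"

definition geodesic :: "'a::metric_space curve \<Rightarrow> bool" where
  "geodesic c \<longleftrightarrow>
     0 \<le> clen c \<and>
     (\<forall>s\<in>{0..clen c}. \<forall>t\<in>{0..clen c}. dist (cpoint c s) (cpoint c t) = \<bar>s - t\<bar>)"

definition concat_curve :: "'a curve \<Rightarrow> 'a curve \<Rightarrow> 'a curve" where
  "concat_curve c d =
     Curve (clen c + clen d)
       (\<lambda>t. if t \<le> clen c then cpoint c t else cpoint d (t - clen c))"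

inductive piecewise_geodesic :: "'a::metric_space curve \<Rightarrow> bool" where
  single: "geodesic c \<Longrightarrow> piecewise_geodesic c"
| append: "piecewise_geodesic c \<Longrightarrow> geodesic d \<Longrightarrow> cend c = cstart d
           \<Longrightarrow> piecewise_geodesic (concat_curve c d)"

definition geodesic_space :: "'a::metric_space itself \<Rightarrow> bool" where
  "geodesic_space _ \<longleftrightarrow>
     (\<forall>x y :: 'a. \<exists>c. geodesic c \<and> cstart c = x \<and> cend c = y)"

definition Lip_funs :: "('a::metric_space \<Rightarrow> real) set" where
  "Lip_funs = {f. \<exists>C. C-lipschitz_on UNIV f}"

definition Lipb_funs :: "('a::metric_space \<Rightarrow> real) set" where
  "Lipb_funs = {f \<in> Lip_funs. bounded (range f)}"

definition lip_const :: "('a::metric_space \<Rightarrow> real) \<Rightarrow> real" where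
  "lip_const f = Inf {C. C-lipschitz_on UNIV f}"

type_synonym 'a form = "('a \<Rightarrow> real) \<times> ('a \<Rightarrow> real)"

definition D1 :: "'a::metric_space form set" where
  "D1 = Lipb_funs \<times> Lip_funs"

definition bilinear_on_D1 :: "('a::metric_space form \<Rightarrow> real) \<Rightarrow> bool" where
  "bilinear_on_D1 T \<longleftrightarrow>
     (\<forall>f\<in>Lipb_funs. \<forall>g\<in>Lipb_funs. \<forall>\<pi>\<in>Lip_funs. \<forall>a b.
        T (\<lambda>x. a * f x + b * g x, \<pi>) = a * T (f, \<pi>) + b * T (g, \<pi>)) \<and>
     (\<forall>f\<in>Lipb_funs. \<forall>\<pi>\<in>Lip_funs. \<forall>\<rho>\<in>Lip_funs. \<forall>a b.
        T (f, \<lambda>x. a * \<pi> x + b * \<rho> x) = a * T (f, \<pi>) + b * T (f, \<rho>))"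

definition current_continuous :: "('a::metric_space form \<Rightarrow> real) \<Rightarrow> bool" where
  "current_continuous T \<longleftrightarrow>
     (\<forall>f\<in>Lipb_funs. \<forall>\<pi>\<in>Lip_funs. \<forall>\<rho> :: nat \<Rightarrow> 'a \<Rightarrow> real.
        (\<forall>j. \<rho> j \<in> Lip_funs) \<and> bdd_above (range (\<lambda>j. lip_const (\<rho> j))) \<and>
        (\<forall>x. (\<lambda>j. \<rho> j x) \<longlonglongrightarrow> \<pi> x)
        \<longrightarrow> (\<lambda>j. T (f, \<rho> j)) \<longlonglongrightarrow> T (f, \<pi>))"

definition current_local :: "('a::metric_space form \<Rightarrow> real) \<Rightarrow> bool" where
  "current_local T \<longleftrightarrow>
     (\<forall>f\<in>Lipb_funs. \<forall>\<pi>\<in>Lip_funs.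
        (\<exists>U. open U \<and> {x. f x \<noteq> 0} \<subseteq> U \<and> \<pi> constant_on U) \<longrightarrow> T (f, \<pi>) = 0)"

definition mass_bound :: "('a::metric_space form \<Rightarrow> real) \<Rightarrow> 'a measure \<Rightarrow> bool" where
  "mass_bound T \<mu> \<longleftrightarrow>
     finite_measure \<mu> \<and> sets \<mu> = sets borel \<and>
     (\<forall>(f, \<pi>)\<in>D1. \<bar>T (f, \<pi>)\<bar> \<le> lip_const \<pi> * (LINT x|\<mu>. \<bar>f x\<bar>))"

definition metric_currents1 :: "('a::metric_space form \<Rightarrow> real) set" where
  "metric_currents1 =
     {T. bilinear_on_D1 T \<and> current_continuous T \<and> current_local T \<and> (\<exists>\<mu>. mass_bound T \<mu>)}"

text \<open>The minimal measure is the least one with respect to the setwise order of measures.\<close>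

definition mass_measure :: "('a::metric_space form \<Rightarrow> real) \<Rightarrow> 'a measure" where
  "mass_measure T =
     (THE \<mu>. mass_bound T \<mu> \<and>
        (\<forall>\<nu>. mass_bound T \<nu> \<longrightarrow> (\<forall>A\<in>sets borel. emeasure \<mu> A \<le> emeasure \<nu> A)))"

definition mass :: "('a::metric_space form \<Rightarrow> real) \<Rightarrow> real" where
  "mass T = measure (mass_measure T) UNIV"

definition boundary :: "('a form \<Rightarrow> real) \<Rightarrow> ('a \<Rightarrow> real) \<Rightarrow> real" where
  "boundary T f = T (\<lambda>_. 1, f)"

text \<open>
  Convergence of Riemann-Stieltjes sums as the mesh tends to \<open>0\<close>; meant for \<open>a \<le> b\<close>.
\<close>

definition has_RS_integral ::
  "(real \<Rightarrow> real) \<Rightarrow> (real \<Rightarrow> real) \<Rightarrow> real \<Rightarrow> real \<Rightarrow> real \<Rightarrow> bool" where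
  "has_RS_integral f g a b I \<longleftrightarrow>
     (\<forall>\<epsilon>>0. \<exists>\<delta>>0. \<forall>p. p tagged_division_of {a..b} \<and> (\<forall>(x, K)\<in>p. Sup K - Inf K < \<delta>) \<longrightarrow>
        \<bar>(\<Sum>(x, K)\<in>p. f x * (g (Sup K) - g (Inf K))) - I\<bar> < \<epsilon>)"

definition RS_integral :: "(real \<Rightarrow> real) \<Rightarrow> (real \<Rightarrow> real) \<Rightarrow> real \<Rightarrow> real \<Rightarrow> real" where
  "RS_integral f g a b = (THE I. has_RS_integral f g a b I)"

definition curve_current :: "'a curve \<Rightarrow> 'a form \<Rightarrow> real" where
  "curve_current c = (\<lambda>(f, \<pi>). RS_integral (f \<circ> cpoint c) (\<pi> \<circ> cpoint c) 0 (clen c))"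

end

theory Submission
  imports Defs
begin

text \<open>
  The proof plays closed curves against \<open>T\<close> by duality. Let
  \<open>\<mu>\<close> be the mass measure and \<open>M\<close> the mass of \<open>T\<close>. For a finite sum \<open>\<omega>\<close> of forms \<open>f d\<pi>\<close> and a bounded
  Lipschitz function \<open>h\<close> there is a closed piecewise geodesic curve along which the mean of
  \<open>\<omega> + h ds\<close> per unit length is almost at least \<open>(T \<omega> + \<integral> h d\<mu>) / M\<close> (\<open>closed_curve_exists\<close>). Otherwise,
  with a number \<open>\<Lambda>\<close> smaller than this quotient, \<open>\<Lambda> ds - h ds - \<omega>\<close> has nonnegative integrals along all
  closed curves. As in a weighted graph without negative cycles, the infimum of its integrals along
  curves from a base point is then a potential \<open>\<phi>\<close>; it is Lipschitz and satisfies
  \<open>\<omega> + d\<phi> \<le> \<Lambda> - h\<close> infinitesimally. Locality and finite mass turn this inequality into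
  \<open>T (\<omega> + d\<phi>) \<le> \<integral> (\<Lambda> - h) d\<mu>\<close> (\<open>current_le_integral\<close>), and \<open>T (d\<phi>) = 0\<close> because \<open>T\<close> has no boundary.
  Hence \<open>T \<omega> + \<integral> h d\<mu> \<le> \<Lambda> * M\<close>, contrary to the choice of \<open>\<Lambda>\<close>.

  So for every linear combination of finitely many test quantities some closed curve does at least as
  well as \<open>T / M\<close>, up to an error. Choosing curves one after another against the accumulated error
  (\<open>averages_approach\<close>) gives sequences whose averages, with equal weights, approach \<open>T / M\<close> on these
  tests. Running around each closed curve as often as length \<open>l\<close> permits does not change the means per
  unit length and gives all curves almost the length \<open>l\<close> (\<open>represents_eventually\<close>).

  Countably many tests suffice (\<open>S_tendsto\<close>). Every bounded Lipschitz function is the limit from below of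
  functions of a countable family. Testing integrals of \<open>h ds\<close> as well makes the averaged arc length
  measures converge to \<open>\<mu>\<close> on bounded Lipschitz functions; this controls the error made by replacing \<open>f\<close>
  by a test and, after integration by parts along closed curves, the error made by replacing \<open>\<pi>\<close>.

  The mass measure is the supremum of the densities of the functionals \<open>f \<mapsto> T (f, \<pi>)\<close> with 1-Lipschitz
  \<open>\<pi>\<close>; therefore finite sums \<open>\<Sum> T (f, \<pi>)\<close> with \<open>\<Sum> \<bar>f\<bar> \<le> 1\<close> come arbitrarily close to \<open>M\<close> (\<open>mass_formula\<close>).
  Such sums also bound the masses of the curves from below, and their convergence shows that the mean
  of the masses divided by \<open>l\<close> is at least \<open>1\<close> in the limit. It is at most \<open>1\<close> because the mass of a
  curve is at most its length.
\<close>

section \<open>Lipschitz functions\<close>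

lemma Lip_funsI:
  fixes f :: "'a::metric_space \<Rightarrow> real"
  assumes "\<And>x y. \<bar>f x - f y\<bar> \<le> C * dist x y"
  shows "f \<in> Lip_funs"
proof -
  have "\<bar>C\<bar>-lipschitz_on UNIV f"
  proof (rule lipschitz_onI)
    fix x y :: 'a
    have "C * dist x y \<le> \<bar>C\<bar> * dist x y" by (intro mult_right_mono) auto
    then show "dist (f x) (f y) \<le> \<bar>C\<bar> * dist x y"
      using assms[of x y] unfolding dist_real_def by linarith
  qed auto
  then show ?thesis unfolding Lip_funs_def by blast
qed

lemma lipschitz_on_lip_const:
  assumes "f \<in> Lip_funs"
  shows "(lip_const f)-lipschitz_on UNIV f"
proof -
  let ?S = "{C. C-lipschitz_on UNIV f}"
  have ne: "?S \<noteq> {}" using assms unfolding Lip_funs_def by blast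
  have nn: "\<And>C. C \<in> ?S \<Longrightarrow> 0 \<le> C" by (auto dest: lipschitz_on_nonneg)
  show ?thesis
  proof (rule lipschitz_onI)
    show "0 \<le> lip_const f"
      unfolding lip_const_def by (rule cInf_greatest[OF ne nn])
    fix x y
    show "dist (f x) (f y) \<le> lip_const f * dist x y"
    proof (cases "x = y")
      case False
      have "dist (f x) (f y) / dist x y \<le> lip_const f"
        unfolding lip_const_def
      proof (rule cInf_greatest[OF ne])
        fix C assume "C \<in> ?S"
        then show "dist (f x) (f y) / dist x y \<le> C"
          using False by (auto simp: divide_le_eq dest: lipschitz_onD)
      qed
      then show ?thesis using False by (simp add: divide_le_eq)
    qed auto
  qed
qed

lemma lip_const_le: "C-lipschitz_on UNIV f \<Longrightarrow> lip_const f \<le> C"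
  unfolding lip_const_def
  by (rule cInf_lower) (auto intro!: bdd_belowI[of _ 0] dest: lipschitz_on_nonneg)

lemma lip_const_leI:
  assumes "0 \<le> C" "\<And>x y. \<bar>f x - f y\<bar> \<le> C * dist x y"
  shows "lip_const f \<le> C"
  by (rule lip_const_le, rule lipschitz_onI) (use assms in \<open>auto simp: dist_real_def\<close>)

lemma lip_const_nonneg: "f \<in> Lip_funs \<Longrightarrow> 0 \<le> lip_const f"
  using lipschitz_on_lip_const lipschitz_on_nonneg by blast

lemma lip_constD: "f \<in> Lip_funs \<Longrightarrow> \<bar>f x - f y\<bar> \<le> lip_const f * dist x y"
  using lipschitz_onD[OF lipschitz_on_lip_const, of f x y] by (simp add: dist_real_def)

lemma Lip_funs_continuous: "f \<in> Lip_funs \<Longrightarrow> continuous_on S f"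
  using lipschitz_on_continuous_on[OF lipschitz_on_lip_const] continuous_on_subset by blast

lemma Lip_funs_measurable [measurable_dest]: "f \<in> Lip_funs \<Longrightarrow> f \<in> borel_measurable borel"
  by (intro borel_measurable_continuous_onI Lip_funs_continuous)

lemma Lip_const [simp]: "(\<lambda>_. c) \<in> Lip_funs"
  by (rule Lip_funsI[of _ 0]) simp

lemma Lip_dist: "(\<lambda>x. dist x a) \<in> Lip_funs"
  by (rule Lip_funsI[of _ 1]) (metis abs_dist_diff_le dist_commute mult_1)

lemma Lip_add: assumes "f \<in> Lip_funs" "g \<in> Lip_funs" shows "(\<lambda>x. f x + g x) \<in> Lip_funs"
proof (rule Lip_funsI)
  fix x y
  show "\<bar>f x + g x - (f y + g y)\<bar> \<le> (lip_const f + lip_const g) * dist x y"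
    using lip_constD[OF assms(1), of x y] lip_constD[OF assms(2), of x y]
    unfolding distrib_right by linarith
qed

lemma Lip_cmult: assumes "f \<in> Lip_funs" shows "(\<lambda>x. c * f x) \<in> Lip_funs"
proof (rule Lip_funsI)
  fix x y
  have "\<bar>c * f x - c * f y\<bar> = \<bar>c\<bar> * \<bar>f x - f y\<bar>"
    by (metis abs_mult right_diff_distrib)
  also have "\<dots> \<le> \<bar>c\<bar> * (lip_const f * dist x y)"
    by (intro mult_left_mono lip_constD assms) auto
  finally show "\<bar>c * f x - c * f y\<bar> \<le> (\<bar>c\<bar> * lip_const f) * dist x y" by (simp add: mult.assoc)
qed

lemma Lip_minus: "f \<in> Lip_funs \<Longrightarrow> (\<lambda>x. - f x) \<in> Lip_funs"
  using Lip_cmult[of f "-1"] by simp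

lemma Lip_diff: "f \<in> Lip_funs \<Longrightarrow> g \<in> Lip_funs \<Longrightarrow> (\<lambda>x. f x - g x) \<in> Lip_funs"
  using Lip_add[of f "\<lambda>x. - g x"] Lip_minus[of g] by simp

lemma Lip_sum: "(\<And>i. i \<in> I \<Longrightarrow> f i \<in> Lip_funs) \<Longrightarrow> (\<lambda>x. \<Sum>i\<in>I. f i x) \<in> Lip_funs"
  by (induction I rule: infinite_finite_induct) (auto intro: Lip_add)

lemma Lip_max:
  fixes f g :: "'a::metric_space \<Rightarrow> real"
  assumes "f \<in> Lip_funs" "g \<in> Lip_funs" shows "(\<lambda>x. max (f x) (g x)) \<in> Lip_funs"
proof (rule Lip_funsI)
  fix x y :: 'a
  have "0 \<le> lip_const f * dist x y" "0 \<le> lip_const g * dist x y"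
    using assms by (simp_all add: lip_const_nonneg)
  then show "\<bar>max (f x) (g x) - max (f y) (g y)\<bar> \<le> (lip_const f + lip_const g) * dist x y"
    using lip_constD[OF assms(1), of x y] lip_constD[OF assms(2), of x y]
    unfolding distrib_right by linarith
qed

lemma Lip_min: assumes "f \<in> Lip_funs" "g \<in> Lip_funs" shows "(\<lambda>x. min (f x) (g x)) \<in> Lip_funs"
proof -
  have "(\<lambda>x. min (f x) (g x)) = (\<lambda>x. - max (- f x) (- g x))"
    by (auto simp: min_def max_def)
  then show ?thesis using assms by (simp add: Lip_minus Lip_max)
qed

lemma Lip_abs: assumes "f \<in> Lip_funs" shows "(\<lambda>x. \<bar>f x\<bar>) \<in> Lip_funs"
proof -
  have "(\<lambda>x. \<bar>f x\<bar>) = (\<lambda>x. max (f x) (- f x))" by (auto simp: max_def)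
  then show ?thesis using assms by (simp add: Lip_minus Lip_max)
qed

lemma LipbI:
  assumes "f \<in> Lip_funs" "\<And>x. \<bar>f x\<bar> \<le> B"
  shows "f \<in> Lipb_funs"
  using assms unfolding Lipb_funs_def bounded_iff by auto

lemma Lipb_bound:
  assumes "f \<in> Lipb_funs"
  obtains B where "0 \<le> B" "\<And>x. \<bar>f x\<bar> \<le> B"
proof -
  obtain B where B: "\<And>x. \<bar>f x\<bar> \<le> B"
    using assms unfolding Lipb_funs_def bounded_iff by auto
  have "0 \<le> B" using B[of undefined] by linarith
  then show ?thesis using B that by blast
qed

lemma Lipb_Lip [simp]: "f \<in> Lipb_funs \<Longrightarrow> f \<in> Lip_funs"
  by (simp add: Lipb_funs_def)

lemma Lipb_measurable [measurable_dest]: "f \<in> Lipb_funs \<Longrightarrow> f \<in> borel_measurable borel"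
  by (intro Lip_funs_measurable) simp

lemma Lipb_const [simp]: "(\<lambda>_. c) \<in> Lipb_funs"
  by (rule LipbI[of _ "\<bar>c\<bar>"]) auto

lemma Lipb_add: assumes "f \<in> Lipb_funs" "g \<in> Lipb_funs" shows "(\<lambda>x. f x + g x) \<in> Lipb_funs"
proof -
  obtain A B where "\<And>x. \<bar>f x\<bar> \<le> A" "\<And>x. \<bar>g x\<bar> \<le> B" using assms Lipb_bound by metis
  then have "\<bar>f x + g x\<bar> \<le> A + B" for x
    by (meson abs_triangle_ineq add_mono order_trans)
  then show ?thesis
    using assms by (intro LipbI[of _ "A + B"] Lip_add) auto
qed

lemma Lipb_mult: assumes "f \<in> Lipb_funs" "g \<in> Lipb_funs" shows "(\<lambda>x. f x * g x) \<in> Lipb_funs"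
proof -
  obtain A where A: "0 \<le> A" "\<And>x. \<bar>f x\<bar> \<le> A" using assms Lipb_bound by metis
  obtain B where B: "0 \<le> B" "\<And>x. \<bar>g x\<bar> \<le> B" using assms Lipb_bound by metis
  show ?thesis
  proof (rule LipbI[of _ "A * B"], rule Lip_funsI)
    fix x y
    have "\<bar>f x * g x - f y * g y\<bar> = \<bar>f x * (g x - g y) + (f x - f y) * g y\<bar>"
      by (simp add: algebra_simps)
    also have "\<dots> \<le> \<bar>f x\<bar> * \<bar>g x - g y\<bar> + \<bar>f x - f y\<bar> * \<bar>g y\<bar>"
      by (metis abs_mult abs_triangle_ineq)
    also have "\<dots> \<le> A * (lip_const g * dist x y) + (lip_const f * dist x y) * B"
      by (intro add_mono mult_mono A B lip_constD Lipb_Lip assms mult_nonneg_nonneg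
          lip_const_nonneg) auto
    finally show "\<bar>f x * g x - f y * g y\<bar> \<le> (A * lip_const g + lip_const f * B) * dist x y"
      by (simp add: algebra_simps)
    show "\<bar>f x * g x\<bar> \<le> A * B"
      unfolding abs_mult by (intro mult_mono A B) auto
  qed
qed

lemma Lipb_cmult: "f \<in> Lipb_funs \<Longrightarrow> (\<lambda>x. c * f x) \<in> Lipb_funs"
  using Lipb_mult[of "\<lambda>_. c" f] by simp

lemma Lipb_minus: "f \<in> Lipb_funs \<Longrightarrow> (\<lambda>x. - f x) \<in> Lipb_funs"
  using Lipb_cmult[of f "-1"] by simp

lemma Lipb_diff: "f \<in> Lipb_funs \<Longrightarrow> g \<in> Lipb_funs \<Longrightarrow> (\<lambda>x. f x - g x) \<in> Lipb_funs"
  using Lipb_add[of f "\<lambda>x. - g x"] Lipb_minus[of g] by simp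

lemma Lipb_sum: "(\<And>i. i \<in> I \<Longrightarrow> f i \<in> Lipb_funs) \<Longrightarrow> (\<lambda>x. \<Sum>i\<in>I. f i x) \<in> Lipb_funs"
  by (induction I rule: infinite_finite_induct) (auto intro: Lipb_add)

lemma Lipb_abs: assumes "f \<in> Lipb_funs" shows "(\<lambda>x. \<bar>f x\<bar>) \<in> Lipb_funs"
proof -
  obtain B where "\<And>x. \<bar>f x\<bar> \<le> B" using assms Lipb_bound by metis
  then show ?thesis using assms by (intro LipbI[of _ B] Lip_abs) auto
qed

lemma Lipb_max: "f \<in> Lipb_funs \<Longrightarrow> g \<in> Lipb_funs \<Longrightarrow> (\<lambda>x. max (f x) (g x)) \<in> Lipb_funs"
proof -
  assume a: "f \<in> Lipb_funs" "g \<in> Lipb_funs"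
  obtain A where A: "0 \<le> A" "\<And>x. \<bar>f x\<bar> \<le> A" using a Lipb_bound by metis
  obtain B where B: "0 \<le> B" "\<And>x. \<bar>g x\<bar> \<le> B" using a Lipb_bound by metis
  have "\<bar>max (f x) (g x)\<bar> \<le> A + B" for x using A(1) A(2)[of x] B(1) B(2)[of x] by linarith
  then show ?thesis using a by (intro LipbI[of _ "A + B"] Lip_max) auto
qed

text \<open>A cutoff that equals \<open>1\<close> on the ball of radius \<open>r / 2\<close> and vanishes off the ball of radius \<open>r\<close>.\<close>

definition bump :: "'a::metric_space \<Rightarrow> real \<Rightarrow> 'a \<Rightarrow> real" where
  "bump a r = (\<lambda>x. max 0 (min 1 (2 - 2 * dist x a / r)))"

lemma bump_Lipb: "bump a r \<in> Lipb_funs"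
proof -
  have "(\<lambda>x. 2 + (- 2 / r) * dist x a) \<in> Lip_funs"
    by (intro Lip_add Lip_cmult Lip_dist) auto
  then have "(\<lambda>x. max 0 (min 1 (2 + (- 2 / r) * dist x a))) \<in> Lip_funs"
    by (intro Lip_max Lip_min) auto
  then have "bump a r \<in> Lip_funs" by (simp add: bump_def)
  then show ?thesis by (rule LipbI[of _ 1]) (auto simp: bump_def)
qed

lemma bump_range: "0 \<le> bump a r x" "bump a r x \<le> 1"
  by (auto simp: bump_def)

lemma bump_eq_1: "0 < r \<Longrightarrow> dist x a \<le> r / 2 \<Longrightarrow> bump a r x = 1"
  by (simp add: bump_def pos_divide_le_eq)

lemma bump_support: assumes "0 < r" "bump a r x \<noteq> 0" shows "dist x a < r"
proof (rule ccontr)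
  assume "\<not> dist x a < r"
  then have "2 \<le> 2 * dist x a / r" using assms(1) by (simp add: pos_le_divide_eq)
  then show False using assms(2) by (simp add: bump_def)
qed

text \<open>
  McShane's extension is the infimum of the cones \<open>x \<mapsto> u y + K * dist x y\<close> with vertices over \<open>B\<close>.
\<close>

lemma McShane_extension:
  fixes u :: "'a::metric_space \<Rightarrow> real"
  assumes "0 \<le> K" "B \<noteq> {}" and lip: "\<And>x y. x \<in> B \<Longrightarrow> y \<in> B \<Longrightarrow> u y - u x \<le> K * dist x y"
  obtains v where "\<And>x. x \<in> B \<Longrightarrow> v x = u x" "\<And>x y. \<bar>v x - v y\<bar> \<le> K * dist x y"
proof -
  obtain b where b: "b \<in> B" using assms by blast
  define v where "v x = (INF y\<in>B. u y + K * dist x y)" for x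
  have bdd: "bdd_below ((\<lambda>y. u y + K * dist x y) ` B)" for x
  proof (rule bdd_belowI2)
    fix y assume "y \<in> B"
    have "K * dist b y \<le> K * (dist x b + dist x y)"
      by (intro mult_left_mono assms) (metis dist_commute dist_triangle)
    then show "u b - K * dist x b \<le> u y + K * dist x y"
      using lip[OF \<open>y \<in> B\<close> b] by (simp add: algebra_simps dist_commute)
  qed
  have vle: "v x \<le> u y + K * dist x y" if "y \<in> B" for x y
    unfolding v_def by (rule cINF_lower[OF bdd that])
  have le: "v x - v z \<le> K * dist x z" for x z
  proof -
    have "v x - K * dist x z \<le> v z"
      unfolding v_def[of z]
    proof (rule cINF_greatest)
      fix y assume "y \<in> B"
      have "K * dist x y \<le> K * (dist x z + dist z y)"
        by (intro mult_left_mono assms dist_triangle)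
      then show "v x - K * dist x z \<le> u y + K * dist z y"
        using vle[OF \<open>y \<in> B\<close>, of x] by (simp add: algebra_simps)
    qed (use assms in auto)
    then show ?thesis by simp
  qed
  have eq: "v x = u x" if "x \<in> B" for x
  proof (rule antisym)
    show "v x \<le> u x" using vle[OF that, of x] by simp
    show "u x \<le> v x" unfolding v_def
      by (rule cINF_greatest) (use assms(2) lip[OF _ that] in \<open>force simp: dist_commute\<close>)+
  qed
  have "\<bar>v x - v y\<bar> \<le> K * dist x y" for x y
    using le[of x y] le[of y x] by (simp add: dist_commute abs_le_iff)
  with eq show ?thesis using that by blast
qed

subsection \<open>A countable family of test functions\<close>

definition dense_seq :: "nat \<Rightarrow> 'a::second_countable_topology" where
  "dense_seq = (SOME e. \<forall>U. open U \<longrightarrow> U \<noteq> {} \<longrightarrow> (\<exists>n. e n \<in> U))"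

lemma dense_seq: "open U \<Longrightarrow> U \<noteq> {} \<Longrightarrow> \<exists>n. dense_seq n \<in> U"
proof -
  obtain D :: "'a set" where D: "countable D" "\<And>U. open U \<Longrightarrow> U \<noteq> {} \<Longrightarrow> \<exists>d\<in>D. d \<in> U"
    using countable_dense_setE by blast
  have "D \<noteq> {}" using D(2)[of UNIV] by auto
  then have "\<exists>e :: nat \<Rightarrow> 'a. \<forall>U. open U \<longrightarrow> U \<noteq> {} \<longrightarrow> (\<exists>n. e n \<in> U)"
    using D by (metis from_nat_into_surj)
  then have "\<forall>U. open U \<longrightarrow> U \<noteq> {} \<longrightarrow> (\<exists>n. dense_seq n \<in> (U :: 'a set))"
    unfolding dense_seq_def by (rule someI_ex)
  then show "open U \<Longrightarrow> U \<noteq> {} \<Longrightarrow> \<exists>n. dense_seq n \<in> U" by blast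
qed

lemma dense_seq_dist:
  fixes x :: "'a::{metric_space, second_countable_topology}"
  assumes "0 < e" shows "\<exists>n. dist x (dense_seq n) < e"
  using dense_seq[of "ball x e"] assms by auto

text \<open>
  The maximum of the constant \<open>- n\<close> and of cones with slope \<open>L\<close> and rational heights \<open>q\<close>, one over each
  of the first points of the dense sequence. The list stores the heights in reverse order, so that
  the vertex for the head is found from the length of the tail.
\<close>

primrec lower_cone :: "nat \<Rightarrow> nat \<Rightarrow> rat list \<Rightarrow> 'a::{metric_space, second_countable_topology} \<Rightarrow> real"
  where
  "lower_cone L n [] x = - real n"
| "lower_cone L n (q # qs) x =
     max (lower_cone L n qs x) (real_of_rat q - real L * dist x (dense_seq (length qs)))"

lemma lower_cone_lip: "\<bar>lower_cone L n qs x - lower_cone L n qs y\<bar> \<le> real L * dist x y"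
proof (induction qs)
  case (Cons q qs)
  have "\<bar>dist x a - dist y a\<bar> \<le> dist x y" for a
    by (metis abs_dist_diff_le dist_commute)
  then have "real L * \<bar>dist x a - dist y a\<bar> \<le> real L * dist x y" for a
    by (intro mult_left_mono) auto
  then have "\<bar>real L * dist x a - real L * dist y a\<bar> \<le> real L * dist x y" for a
    by (metis abs_mult abs_of_nat right_diff_distrib)
  then have *: "\<bar>(c - real L * dist x a) - (c - real L * dist y a)\<bar> \<le> real L * dist x y" for c a
    by (metis abs_minus_commute diff_diff_eq2 add_diff_cancel_left' diff_add_cancel diff_diff_add)
  have max: "\<bar>max s t - max u v\<bar> \<le> K" if "\<bar>s - u\<bar> \<le> K" "\<bar>t - v\<bar> \<le> K" for s t u v K :: real
    using that by (auto simp: max_def abs_le_iff)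
  show ?case unfolding lower_cone.simps by (rule max[OF Cons *])
qed simp

lemma lower_cone_ge: "- real n \<le> lower_cone L n qs x"
  by (induction qs) auto

lemma lower_cone_Lipb: "lower_cone L n qs \<in> Lipb_funs"
proof -
  have "\<exists>B. \<forall>x. lower_cone L n qs (x::'a) \<le> B"
  proof (induction qs)
    case (Cons q qs)
    then obtain B where B: "\<And>x::'a. lower_cone L n qs x \<le> B" by blast
    have "real_of_rat q - real L * dist x (dense_seq (length qs)) \<le> real_of_rat q" for x :: 'a
      by simp
    then show ?case using B by (intro exI[of _ "max B (real_of_rat q)"]) (simp add: max.coboundedI1 max.coboundedI2)
  qed auto
  then obtain B where B: "\<And>x. lower_cone L n qs (x::'a) \<le> B" by blast
  have "\<bar>lower_cone L n qs x\<bar> \<le> \<bar>B\<bar> + real n" for x :: 'a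
    using B[of x] lower_cone_ge[of n L qs x] by linarith
  then show ?thesis
    by (intro LipbI Lip_funsI[of _ "real L"] lower_cone_lip) auto
qed

definition test_fun :: "nat \<Rightarrow> 'a::{metric_space, second_countable_topology} \<Rightarrow> real" where
  "test_fun k = (case from_nat k of (L, n, qs) \<Rightarrow> lower_cone L n qs)"

lemma test_fun_Lipb: "test_fun k \<in> Lipb_funs"
  by (auto simp: test_fun_def lower_cone_Lipb split: prod.splits)

lemma test_fun_surj: "\<exists>k. test_fun k = lower_cone L n qs"
  by (rule exI[of _ "to_nat (L, n, qs)"]) (simp add: test_fun_def)

text \<open>
  A Lipschitz function is the supremum of the cones below it with vertices over a dense set, so it
  is the pointwise limit, from below, of functions of the countable family.
\<close>

lemma test_fun_approx:
  fixes f :: "'a::{metric_space, second_countable_topology} \<Rightarrow> real"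
  assumes "f \<in> Lipb_funs"
  obtains k L B where "\<And>n x. test_fun (k n) x \<le> f x" "\<And>x. (\<lambda>n. test_fun (k n) x) \<longlonglongrightarrow> f x"
    "0 \<le> L" "\<And>n x y. \<bar>test_fun (k n) x - test_fun (k n) (y::'a)\<bar> \<le> L * dist x y"
    "0 \<le> B" "\<And>n x. \<bar>test_fun (k n) (x::'a)\<bar> \<le> B"
proof -
  obtain B where B: "0 \<le> B" "\<And>x. \<bar>f x\<bar> \<le> B" using assms Lipb_bound by metis
  obtain b :: nat where b: "B \<le> real b" using real_arch_simple by blast
  obtain L :: nat where L: "lip_const f \<le> real L" using real_arch_simple by blast
  have lip: "\<bar>f x - f y\<bar> \<le> real L * dist x y" for x y
  proof -
    have "lip_const f * dist x y \<le> real L * dist x y" using L by (intro mult_right_mono) auto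
    then show ?thesis using lip_constD[OF Lipb_Lip[OF assms], of x y] by linarith
  qed
  have "\<forall>n i. \<exists>q. f (dense_seq i) - 1 / real (Suc n) < real_of_rat q \<and> real_of_rat q < f (dense_seq i)"
    by (intro allI of_rat_dense) simp
  then obtain q where q: "\<And>i n. f (dense_seq i) - 1 / real (Suc n) < real_of_rat (q n i)"
      "\<And>i n. real_of_rat (q n i) < f (dense_seq i)" by metis
  define qs where "qs n m = rev (map (q n) [0..<m])" for n m
  have qs_Suc: "qs n (Suc m) = q n m # qs n m" and len: "length (qs n m) = m" for n m
    by (simp_all add: qs_def)
  have le: "lower_cone L b (qs n m) x \<le> f x" for n m x
  proof (induction m)
    case 0
    then show ?case using B(2)[of x] b by (simp add: qs_def)
  next
    case (Suc m)
    have "real_of_rat (q n m) - real L * dist x (dense_seq m) \<le> f x"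
      using q(2)[of n m] lip[of x "dense_seq m"] by linarith
    then show ?case using Suc by (simp add: qs_Suc len)
  qed
  have ge: "i < m \<Longrightarrow> real_of_rat (q n i) - real L * dist x (dense_seq i) \<le> lower_cone L b (qs n m) x"
    for i n m x
  proof (induction m)
    case (Suc m)
    then show ?case by (cases "i = m") (auto simp: qs_Suc len)
  qed simp
  define k where "k n = (SOME k. (test_fun k :: 'a \<Rightarrow> real) = lower_cone L b (qs n n))" for n
  have k: "(test_fun (k n) :: 'a \<Rightarrow> real) = lower_cone L b (qs n n)" for n
    unfolding k_def using test_fun_surj by (rule someI_ex)
  have lim: "(\<lambda>n. lower_cone L b (qs n n) x) \<longlonglongrightarrow> f x" for x
  proof (rule LIMSEQ_I)
    fix e :: real assume "0 < e"
    obtain i where i: "dist x (dense_seq i) < e / (4 * (real L + 1))"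
      using dense_seq_dist[of "e / (4 * (real L + 1))" x] \<open>0 < e\<close> by auto
    obtain N where N: "1 / real (Suc N) < e / 2" using \<open>0 < e\<close> nat_approx_posE[of "e/2"] by auto
    have Ld: "real L * dist x (dense_seq i) \<le> e / 4"
    proof -
      have "real L * dist x (dense_seq i) \<le> (real L + 1) * (e / (4 * (real L + 1)))"
        using i by (intro mult_mono) auto
      also have "\<dots> = e / 4"
      proof -
        have "c * (e / (4 * c)) = e / 4" if "0 < c" for c :: real using that by simp
        moreover have "0 < real L + 1" by linarith
        ultimately show ?thesis by blast
      qed
      finally show ?thesis .
    qed
    show "\<exists>no. \<forall>n\<ge>no. norm (lower_cone L b (qs n n) x - f x) < e"
    proof (intro exI allI impI)
      fix n assume n: "max (Suc i) N \<le> n"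
      have "1 / real (Suc n) \<le> 1 / real (Suc N)" using n by (simp add: frac_le)
      then show "norm (lower_cone L b (qs n n) x - f x) < e"
        using ge[of i n n x] n N Ld le[of n n x] q(1)[of i n] lip[of x "dense_seq i"]
        by simp
    qed
  qed
  show ?thesis
  proof (rule that[of k "real L" "B + real b"])
    show "\<bar>test_fun (k n) x\<bar> \<le> B + real b" for n and x :: 'a
      using le[of n n x] B(2)[of x] lower_cone_ge[of b L "qs n n" x] B(1) unfolding k by linarith
  qed (use k le lim lower_cone_lip B in auto)
qed

section \<open>Riemann-Stieltjes integrals of Lipschitz functions\<close>

text \<open>
  For Lipschitz \<open>f\<close> and \<open>g\<close> the integral of \<open>f dg\<close> over \<open>{s..t}\<close> differs from
  \<open>f s * (g t - g s)\<close> by a quadratic error, and this local estimate determines it: a function all of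
  whose increments are quadratically small is constant. Properties of the integral are therefore
  proved by exhibiting primitives.
\<close>

definition rs_prim :: "(real \<Rightarrow> real) \<Rightarrow> (real \<Rightarrow> real) \<Rightarrow> real \<Rightarrow> real \<Rightarrow> (real \<Rightarrow> real) \<Rightarrow> bool" where
  "rs_prim f g a b F \<longleftrightarrow>
     (\<exists>C. \<forall>s t. a \<le> s \<longrightarrow> s \<le> t \<longrightarrow> t \<le> b \<longrightarrow>
        \<bar>F t - F s - f s * (g t - g s)\<bar> \<le> C * (t - s)\<^sup>2)"

lemma rs_primI:
  assumes "\<And>s t. a \<le> s \<Longrightarrow> s \<le> t \<Longrightarrow> t \<le> b \<Longrightarrow>
    \<bar>F t - F s - f s * (g t - g s)\<bar> \<le> C * (t - s)\<^sup>2"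
  shows "rs_prim f g a b F"
  using assms unfolding rs_prim_def by blast

lemma rs_primE:
  assumes "rs_prim f g a b F"
  obtains C where "0 \<le> C" "\<And>s t. a \<le> s \<Longrightarrow> s \<le> t \<Longrightarrow> t \<le> b \<Longrightarrow>
    \<bar>F t - F s - f s * (g t - g s)\<bar> \<le> C * (t - s)\<^sup>2"
proof -
  obtain C where C: "\<And>s t. a \<le> s \<Longrightarrow> s \<le> t \<Longrightarrow> t \<le> b \<Longrightarrow>
    \<bar>F t - F s - f s * (g t - g s)\<bar> \<le> C * (t - s)\<^sup>2"
    using assms unfolding rs_prim_def by blast
  have "\<bar>F t - F s - f s * (g t - g s)\<bar> \<le> \<bar>C\<bar> * (t - s)\<^sup>2"
    if "a \<le> s" "s \<le> t" "t \<le> b" for s t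
  proof -
    have "C * (t - s)\<^sup>2 \<le> \<bar>C\<bar> * (t - s)\<^sup>2" by (intro mult_right_mono) auto
    then show ?thesis using C[OF that] by linarith
  qed
  then show ?thesis using that[of "\<bar>C\<bar>"] by simp
qed

text \<open>
  Cutting the interval into \<open>n\<close> equal pieces bounds the total increment by \<open>C * (b - a)\<^sup>2 / n\<close>.
\<close>

lemma quadratic_increments_le:
  fixes \<Phi> :: "real \<Rightarrow> real"
  assumes "a \<le> b"
    and inc: "\<And>s t. a \<le> s \<Longrightarrow> s \<le> t \<Longrightarrow> t \<le> b \<Longrightarrow> \<Phi> t - \<Phi> s \<le> C * (t - s)\<^sup>2"
  shows "\<Phi> b \<le> \<Phi> a"
proof -
  have le: "\<Phi> b - \<Phi> a \<le> (C * (b - a)\<^sup>2) * (1 / real (Suc n))" for n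
  proof -
    let ?N = "Suc n"
    define x where "x i = a + real i * ((b - a) / ?N)" for i
    have "real ?N * ((b - a) / real ?N) = b - a" by simp
    then have x0: "x 0 = a" "x ?N = b" unfolding x_def by simp_all
    have step: "x (Suc i) - x i = (b - a) / ?N" for i
      unfolding x_def of_nat_Suc[of i] distrib_right by simp
    have "\<Phi> (x (Suc i)) - \<Phi> (x i) \<le> C * ((b - a) / ?N)\<^sup>2" if "i < ?N" for i
    proof -
      have "x (Suc i) \<le> b"
      proof -
        have "real (Suc i) * ((b - a) / ?N) \<le> real ?N * ((b - a) / ?N)"
          using that assms(1) by (intro mult_right_mono) auto
        then show ?thesis using x0(2) unfolding x_def by linarith
      qed
      moreover have "a \<le> x i" using assms(1) by (simp add: x_def)
      moreover have "x i \<le> x (Suc i)"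
      proof -
        have "0 \<le> (b - a) / ?N" using assms(1) by simp
        then show ?thesis using step[of i] by linarith
      qed
      ultimately show ?thesis using inc[of "x i" "x (Suc i)"] step[of i] by simp
    qed
    then have "(\<Sum>i<?N. \<Phi> (x (Suc i)) - \<Phi> (x i)) \<le> (\<Sum>i<?N. C * ((b - a) / ?N)\<^sup>2)"
      by (intro sum_mono) auto
    also have "\<dots> = (C * (b - a)\<^sup>2) * (1 / real ?N)"
    proof -
      have "m * (C * (d / m)\<^sup>2) = (C * d\<^sup>2) * (1 / m)" if "0 < m" for d m :: real
        using that by (simp add: power2_eq_square)
      from this[of "real ?N" "b - a"] show ?thesis by (simp del: of_nat_Suc)
    qed
    also have "(\<Sum>i<?N. \<Phi> (x (Suc i)) - \<Phi> (x i)) = \<Phi> (x ?N) - \<Phi> (x 0)"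
      by (rule sum_lessThan_telescope)
    finally show ?thesis unfolding x0 .
  qed
  have "(\<lambda>n. (C * (b - a)\<^sup>2) * (1 / real (Suc n))) \<longlonglongrightarrow> (C * (b - a)\<^sup>2) * 0"
    by (intro tendsto_mult tendsto_const lim_1_over_n[THEN LIMSEQ_Suc])
  then have "\<Phi> b - \<Phi> a \<le> (C * (b - a)\<^sup>2) * 0"
    by (rule LIMSEQ_le_const) (use le in auto)
  then show ?thesis by simp
qed

lemma rs_prim_cong:
  assumes "rs_prim f g a b F"
    and "\<And>t. a \<le> t \<Longrightarrow> t \<le> b \<Longrightarrow> f t = f' t" "\<And>t. a \<le> t \<Longrightarrow> t \<le> b \<Longrightarrow> g t = g' t"
  shows "rs_prim f' g' a b F"
proof -
  obtain C where C: "\<And>s t. a \<le> s \<Longrightarrow> s \<le> t \<Longrightarrow> t \<le> b \<Longrightarrow>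
    \<bar>F t - F s - f s * (g t - g s)\<bar> \<le> C * (t - s)\<^sup>2" using assms(1) by (elim rs_primE) auto
  show ?thesis
  proof (rule rs_primI)
    fix s t assume "a \<le> s" "s \<le> t" "t \<le> b"
    then show "\<bar>F t - F s - f' s * (g' t - g' s)\<bar> \<le> C * (t - s)\<^sup>2"
      using C[of s t] assms(2)[of s] assms(3)[of s] assms(3)[of t] by simp
  qed
qed

lemma rs_prim_shift:
  assumes "rs_prim f g a b F"
  shows "rs_prim (\<lambda>t. f (t - c)) (\<lambda>t. g (t - c)) (a + c) (b + c) (\<lambda>t. F (t - c))"
proof -
  obtain C where C: "\<And>s t. a \<le> s \<Longrightarrow> s \<le> t \<Longrightarrow> t \<le> b \<Longrightarrow>
    \<bar>F t - F s - f s * (g t - g s)\<bar> \<le> C * (t - s)\<^sup>2" using assms by (elim rs_primE) auto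
  show ?thesis
    by (rule rs_primI[of _ _ _ _ _ C]) (use C[of "_ - c" "_ - c"] in \<open>simp add: le_diff_eq diff_le_eq\<close>)
qed

lemma rs_prim_combine:
  assumes "rs_prim f g a b F" "rs_prim f' g' a b F'"
    and eq: "\<And>s t. h s * (k t - k s) = c * (f s * (g t - g s)) + d * (f' s * (g' t - g' s))"
  shows "rs_prim h k a b (\<lambda>t. c * F t + d * F' t)"
proof -
  obtain C where C: "\<And>s t. a \<le> s \<Longrightarrow> s \<le> t \<Longrightarrow> t \<le> b \<Longrightarrow>
    \<bar>F t - F s - f s * (g t - g s)\<bar> \<le> C * (t - s)\<^sup>2" using assms(1) by (elim rs_primE) auto
  obtain D where D: "\<And>s t. a \<le> s \<Longrightarrow> s \<le> t \<Longrightarrow> t \<le> b \<Longrightarrow>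
    \<bar>F' t - F' s - f' s * (g' t - g' s)\<bar> \<le> D * (t - s)\<^sup>2" using assms(2) by (elim rs_primE) auto
  show ?thesis
  proof (rule rs_primI[of _ _ _ _ _ "\<bar>c\<bar> * C + \<bar>d\<bar> * D"])
    fix s t assume st: "a \<le> s" "s \<le> t" "t \<le> b"
    have "\<bar>c * F t + d * F' t - (c * F s + d * F' s) - h s * (k t - k s)\<bar>
      = \<bar>c * (F t - F s - f s * (g t - g s)) + d * (F' t - F' s - f' s * (g' t - g' s))\<bar>"
      unfolding eq by (simp add: algebra_simps)
    also have "\<dots> \<le> \<bar>c\<bar> * \<bar>F t - F s - f s * (g t - g s)\<bar> + \<bar>d\<bar> * \<bar>F' t - F' s - f' s * (g' t - g' s)\<bar>"
      by (metis abs_mult abs_triangle_ineq)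
    also have "\<dots> \<le> \<bar>c\<bar> * (C * (t - s)\<^sup>2) + \<bar>d\<bar> * (D * (t - s)\<^sup>2)"
      by (intro add_mono mult_left_mono C D st) auto
    finally show "\<bar>c * F t + d * F' t - (c * F s + d * F' s) - h s * (k t - k s)\<bar>
      \<le> (\<bar>c\<bar> * C + \<bar>d\<bar> * D) * (t - s)\<^sup>2" by (simp add: algebra_simps)
  qed
qed

lemma rs_prim_linear_left:
  assumes "rs_prim f g a b F" "rs_prim f' g a b F'"
  shows "rs_prim (\<lambda>t. c * f t + d * f' t) g a b (\<lambda>t. c * F t + d * F' t)"
  by (rule rs_prim_combine[OF assms]) (simp add: algebra_simps)

lemma rs_prim_linear_right:
  assumes "rs_prim f g a b F" "rs_prim f g' a b F'"
  shows "rs_prim f (\<lambda>t. c * g t + d * g' t) a b (\<lambda>t. c * F t + d * F' t)"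
  by (rule rs_prim_combine[OF assms]) (simp add: algebra_simps)

lemma lipschitz_real:
  fixes f :: "real \<Rightarrow> real"
  shows "K-lipschitz_on {a..b} f \<Longrightarrow> a \<le> s \<Longrightarrow> s \<le> t \<Longrightarrow> t \<le> b \<Longrightarrow> \<bar>f t - f s\<bar> \<le> K * (t - s)"
  using lipschitz_onD[of K "{a..b}" f t s] by (simp add: dist_real_def)

lemma lipschitz_product_increment:
  fixes f :: "real \<Rightarrow> real"
  assumes "K-lipschitz_on {a..b} f" "L-lipschitz_on {a..b} g"
    and "a \<le> s" "s \<le> x" "x \<le> t" "t \<le> b"
  shows "\<bar>(f x - f s) * (g t - g s)\<bar> \<le> K * L * (t - s)\<^sup>2"
proof -
  have "\<bar>f x - f s\<bar> \<le> K * (x - s)" using lipschitz_real[OF assms(1)] assms by force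
  also have "\<dots> \<le> K * (t - s)"
    using assms lipschitz_on_nonneg[OF assms(1)] by (intro mult_left_mono) auto
  finally have 1: "\<bar>f x - f s\<bar> \<le> K * (t - s)" .
  have 2: "\<bar>g t - g s\<bar> \<le> L * (t - s)" using lipschitz_real[OF assms(2)] assms by force
  have "\<bar>f x - f s\<bar> * \<bar>g t - g s\<bar> \<le> (K * (t - s)) * (L * (t - s))"
    by (intro mult_mono 1 2) (use assms lipschitz_on_nonneg[OF assms(1)] in auto)
  then show ?thesis by (simp only: abs_mult power2_eq_square mult_ac)
qed

text \<open>The product rule holds up to the product of the increments, which is quadratic.\<close>

lemma rs_prim_by_parts:
  assumes "rs_prim f g a b F" "K-lipschitz_on {a..b} f" "L-lipschitz_on {a..b} g"
  shows "rs_prim g f a b (\<lambda>t. f t * g t - F t)"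
proof -
  obtain C where C: "\<And>s t. a \<le> s \<Longrightarrow> s \<le> t \<Longrightarrow> t \<le> b \<Longrightarrow>
    \<bar>F t - F s - f s * (g t - g s)\<bar> \<le> C * (t - s)\<^sup>2" using assms(1) by (elim rs_primE) auto
  show ?thesis
  proof (rule rs_primI[of _ _ _ _ _ "K * L + C"])
    fix s t assume st: "a \<le> s" "s \<le> t" "t \<le> b"
    have "f t * g t - F t - (f s * g s - F s) - g s * (f t - f s)
      = (f t - f s) * (g t - g s) - (F t - F s - f s * (g t - g s))" by (simp add: algebra_simps)
    then show "\<bar>f t * g t - F t - (f s * g s - F s) - g s * (f t - f s)\<bar> \<le> (K * L + C) * (t - s)\<^sup>2"
      using C[OF st] lipschitz_product_increment[OF assms(2,3), of s t t] st
      unfolding distrib_right by linarith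
  qed
qed

text \<open>
  An increment across the junction \<open>m\<close> is a sum of two; evaluating \<open>f\<close> at the left end instead of at \<open>m\<close>
  costs the product of an increment of \<open>f\<close> and one of \<open>g\<close>.
\<close>

lemma rs_prim_join:
  assumes F: "rs_prim f g a m F" and G: "rs_prim f g m b G" and "a \<le> m" "m \<le> b"
    and f: "K-lipschitz_on {a..b} f" and g: "L-lipschitz_on {a..b} g"
  obtains H where "rs_prim f g a b H" "H b - H a = (F m - F a) + (G b - G m)"
proof -
  obtain C where C: "0 \<le> C" "\<And>s t. a \<le> s \<Longrightarrow> s \<le> t \<Longrightarrow> t \<le> m \<Longrightarrow>
    \<bar>F t - F s - f s * (g t - g s)\<bar> \<le> C * (t - s)\<^sup>2" using F by (elim rs_primE) auto
  obtain D where D: "0 \<le> D" "\<And>s t. m \<le> s \<Longrightarrow> s \<le> t \<Longrightarrow> t \<le> b \<Longrightarrow>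
    \<bar>G t - G s - f s * (g t - g s)\<bar> \<le> D * (t - s)\<^sup>2" using G by (elim rs_primE) auto
  have KL: "0 \<le> K * L" using f g lipschitz_on_nonneg by (metis mult_nonneg_nonneg)
  define H where "H t = (if t \<le> m then F t else F m + (G t - G m))" for t
  let ?E = "K * L + C + D"
  have "rs_prim f g a b H"
  proof (rule rs_primI[of _ _ _ _ _ ?E])
    fix s t assume st: "a \<le> s" "s \<le> t" "t \<le> b"
    have CE: "C * (t - s)\<^sup>2 \<le> ?E * (t - s)\<^sup>2" "D * (t - s)\<^sup>2 \<le> ?E * (t - s)\<^sup>2"
      using C D KL by (intro mult_right_mono; simp)+
    consider "t \<le> m" | "m < s" | "s \<le> m" "m < t" by linarith
    then show "\<bar>H t - H s - f s * (g t - g s)\<bar> \<le> ?E * (t - s)\<^sup>2"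
    proof cases
      case 1
      then show ?thesis using C(2)[of s t] CE st by (simp add: H_def)
    next
      case 2
      then show ?thesis using D(2)[of s t] CE st by (simp add: H_def)
    next
      case 3
      have "H t - H s - f s * (g t - g s) = (F m - F s - f s * (g m - g s))
          + (G t - G m - f m * (g t - g m)) + (f m - f s) * (g t - g m)"
        using 3 by (simp add: H_def algebra_simps)
      moreover have "\<bar>F m - F s - f s * (g m - g s)\<bar> \<le> C * (t - s)\<^sup>2"
      proof -
        have "C * (m - s)\<^sup>2 \<le> C * (t - s)\<^sup>2" using 3 C by (intro mult_left_mono power_mono) auto
        then show ?thesis using C(2)[of s m] 3 st by linarith
      qed
      moreover have "\<bar>G t - G m - f m * (g t - g m)\<bar> \<le> D * (t - s)\<^sup>2"
      proof -
        have "D * (t - m)\<^sup>2 \<le> D * (t - s)\<^sup>2" using 3 D by (intro mult_left_mono power_mono) auto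
        then show ?thesis using D(2)[of m t] 3 st by linarith
      qed
      moreover have "\<bar>(f m - f s) * (g t - g m)\<bar> \<le> K * L * (t - s)\<^sup>2"
      proof -
        have "\<bar>f m - f s\<bar> * \<bar>g t - g m\<bar> \<le> (K * (m - s)) * (L * (t - m))"
          using lipschitz_real[OF f, of s m] lipschitz_real[OF g, of m t] 3 st assms
          by (intro mult_mono) (auto intro!: mult_nonneg_nonneg lipschitz_on_nonneg[OF f])
        also have "\<dots> \<le> (K * (t - s)) * (L * (t - s))"
          using 3 by (intro mult_mono) (auto intro!: mult_nonneg_nonneg lipschitz_on_nonneg[OF f]
              lipschitz_on_nonneg[OF g])
        finally show ?thesis by (simp only: abs_mult power2_eq_square mult_ac)
      qed
      ultimately show ?thesis unfolding distrib_right by linarith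
    qed
  qed
  moreover have "H b - H a = (F m - F a) + (G b - G m)"
    using assms(3,4) by (auto simp: H_def)
  ultimately show ?thesis using that by blast
qed

lemma rs_prim_integral:
  fixes u :: "real \<Rightarrow> real"
  assumes "K-lipschitz_on {a..b} u"
  shows "rs_prim u (\<lambda>t. t) a b (\<lambda>t. integral {a..t} u)"
proof (rule rs_primI)
  fix s t assume st: "a \<le> s" "s \<le> t" "t \<le> b"
  have cont: "continuous_on {a..b} u" by (rule lipschitz_on_continuous_on[OF assms])
  have int: "u integrable_on {x..y}" if "a \<le> x" "y \<le> b" for x y
    by (intro integrable_continuous_interval continuous_on_subset[OF cont]) (use that in auto)
  have "integral {a..t} u = integral {a..s} u + integral {s..t} u"
    using st int[of a t] by (intro Henstock_Kurzweil_Integration.integral_combine[symmetric]) auto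
  moreover have "\<bar>integral {s..t} u - u s * (t - s)\<bar> \<le> K * (t - s)\<^sup>2"
  proof -
    have eq: "integral {s..t} u - u s * (t - s) = integral {s..t} (\<lambda>x. u x - u s)"
      using st int[of s t] by (subst Henstock_Kurzweil_Integration.integral_diff) (auto simp: mult.commute)
    have "norm (integral {s..t} (\<lambda>x. u x - u s)) \<le> (K * (t - s)) * (t - s)"
    proof (rule integral_bound)
      show "continuous_on {s..t} (\<lambda>x. u x - u s)"
        by (intro continuous_intros continuous_on_subset[OF cont]) (use st in auto)
      fix x assume "x \<in> {s..t}"
      then have "\<bar>u x - u s\<bar> \<le> K * (x - s)" using lipschitz_real[OF assms, of s x] st by auto
      also have "\<dots> \<le> K * (t - s)"
        using \<open>x \<in> {s..t}\<close> lipschitz_on_nonneg[OF assms] by (intro mult_left_mono) auto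
      finally show "norm (u x - u s) \<le> K * (t - s)" by simp
    qed (use st in auto)
    then show ?thesis unfolding eq by (simp add: power2_eq_square algebra_simps)
  qed
  ultimately show "\<bar>integral {a..t} u - integral {a..s} u - u s * (t - s)\<bar> \<le> K * (t - s)\<^sup>2"
    by simp
qed

text \<open>
  Existence: adding a multiple of the identity to \<open>g\<close> makes it nondecreasing, so that \<open>f dg\<close> becomes
  the difference of an integral against a Stieltjes measure and an ordinary integral.
\<close>

lemma rs_prim_exists:
  fixes f g :: "real \<Rightarrow> real"
  assumes f: "K-lipschitz_on {a..b} f" and g: "L-lipschitz_on {a..b} g" and "a \<le> b"
  obtains F where "rs_prim f g a b F"
proof -
  define p where "p t = max a (min b t)" for t
  have pab: "p t \<in> {a..b}" for t using assms(3) by (auto simp: p_def)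
  have pid: "p t = t" if "a \<le> t" "t \<le> b" for t using that by (auto simp: p_def)
  have plip: "\<bar>p s - p t\<bar> \<le> \<bar>s - t\<bar>" for s t by (auto simp: p_def)
  have K: "0 \<le> K" and L: "0 \<le> L" using f g lipschitz_on_nonneg by blast+
  have f1: "\<bar>f (p s) - f (p t)\<bar> \<le> K * \<bar>s - t\<bar>" for s t
  proof -
    have "\<bar>f (p s) - f (p t)\<bar> \<le> K * \<bar>p s - p t\<bar>"
      using lipschitz_onD[OF f pab pab, of s t] by (simp add: dist_real_def)
    also have "\<dots> \<le> K * \<bar>s - t\<bar>" by (intro mult_left_mono plip K)
    finally show ?thesis .
  qed
  have g1: "\<bar>g (p s) - g (p t)\<bar> \<le> L * \<bar>s - t\<bar>" for s t
  proof -
    have "\<bar>g (p s) - g (p t)\<bar> \<le> L * \<bar>p s - p t\<bar>"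
      using lipschitz_onD[OF g pab pab, of s t] by (simp add: dist_real_def)
    also have "\<dots> \<le> L * \<bar>s - t\<bar>" by (intro mult_left_mono plip L)
    finally show ?thesis .
  qed
  define G where "G t = g (p t) + L * t" for t
  have mono: "G x \<le> G y" if "x \<le> y" for x y
    using g1[of x y] that unfolding G_def by (simp add: abs_le_iff algebra_simps)
  have contf: "continuous_on UNIV (\<lambda>t. f (p t))"
    by (rule lipschitz_on_continuous_on[of K], rule lipschitz_onI) (use f1 K in \<open>auto simp: dist_real_def\<close>)
  have "continuous_on UNIV (\<lambda>t. g (p t))"
    by (rule lipschitz_on_continuous_on[of L], rule lipschitz_onI) (use g1 L in \<open>auto simp: dist_real_def\<close>)
  then have "continuous_on UNIV G" unfolding G_def by (intro continuous_intros)
  then have rcont: "continuous (at_right x) G" for x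
    by (meson UNIV_I continuous_on_eq_continuous_within continuous_within_subset subset_UNIV)
  define \<nu> where "\<nu> = interval_measure G"
  have \<nu>: "emeasure \<nu> {s<..t} = ennreal (G t - G s)" if "s \<le> t" for s t
    unfolding \<nu>_def by (rule emeasure_interval_measure_Ioc[OF that mono rcont])
  have sets: "sets \<nu> = sets borel" by (simp add: \<nu>_def)
  have meas: "(\<lambda>t. f (p t)) \<in> borel_measurable \<nu>"
    by (subst measurable_cong_sets[OF sets refl]) (rule borel_measurable_continuous_onI[OF contf])
  have bnd: "\<bar>f (p t)\<bar> \<le> \<bar>f a\<bar> + K * (b - a)" for t
  proof -
    have "\<bar>f (p t) - f a\<bar> \<le> K * (p t - a)" using lipschitz_real[OF f, of a "p t"] pab[of t] by auto
    also have "\<dots> \<le> K * (b - a)" using pab[of t] K by (intro mult_left_mono) auto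
    finally show ?thesis by linarith
  qed
  have int: "set_integrable \<nu> {s<..t} (\<lambda>t. f (p t))" for s t
    unfolding set_integrable_def
  proof (rule integrableI_bounded_set_indicator[where B = "\<bar>f a\<bar> + K * (b - a)"])
    show "emeasure \<nu> {s<..t} < \<infinity>"
      by (cases "s \<le> t") (auto simp: \<nu>)
  qed (use meas bnd sets in auto)
  have intc: "set_integrable \<nu> {s<..t} (\<lambda>_. c :: real)" if "s \<le> t" for s t c
    unfolding set_integrable_def using \<nu>[OF that] sets by (simp add: less_top[symmetric])
  define F1 where "F1 t = (LINT x:{a<..t}|\<nu>. f (p x))" for t
  have F1: "rs_prim (\<lambda>t. f (p t)) G a b F1"
  proof (rule rs_primI)
    fix s t assume st: "a \<le> s" "s \<le> t" "t \<le> b"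
    have "{a<..t} = {a<..s} \<union> {s<..t}" using st by auto
    then have "F1 t = F1 s + (LINT x:{s<..t}|\<nu>. f (p x))"
      unfolding F1_def by (simp add: set_integral_Un int)
    moreover have "(LINT x:{s<..t}|\<nu>. f (p x)) - f (p s) * (G t - G s) = (LINT x:{s<..t}|\<nu>. f (p x) - f (p s))"
    proof -
      have "measure \<nu> {s<..t} = G t - G s"
        using \<nu>[OF st(2)] mono[OF st(2)] by (simp add: measure_def)
      then have "(LINT x:{s<..t}|\<nu>. f (p s)) = f (p s) * (G t - G s)"
        using \<nu>[OF st(2)] sets unfolding set_lebesgue_integral_def by simp
      then show ?thesis
        by (subst set_integral_diff(2)[OF int intc[OF st(2)]]) simp
    qed
    moreover have "\<bar>LINT x:{s<..t}|\<nu>. f (p x) - f (p s)\<bar> \<le> K * (2 * L) * (t - s)\<^sup>2"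
    proof -
      have "\<bar>LINT x:{s<..t}|\<nu>. f (p x) - f (p s)\<bar> \<le> (LINT x:{s<..t}|\<nu>. \<bar>f (p x) - f (p s)\<bar>)"
      proof -
        have "set_integrable \<nu> {s<..t} (\<lambda>x. f (p x) - f (p s))"
          by (intro set_integral_diff int intc st)
        from set_integral_norm_bound[OF this] show ?thesis by simp
      qed
      also have "\<dots> \<le> (LINT x:{s<..t}|\<nu>. K * (t - s))"
      proof (rule set_integral_mono)
        show "set_integrable \<nu> {s<..t} (\<lambda>x. \<bar>f (p x) - f (p s)\<bar>)"
          by (intro set_integrable_abs set_integral_diff int intc st)
        fix x assume x: "x \<in> {s<..t}"
        have "K * \<bar>x - s\<bar> \<le> K * (t - s)" using x K by (intro mult_left_mono) auto
        then show "\<bar>f (p x) - f (p s)\<bar> \<le> K * (t - s)" using f1[of x s] by linarith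
      qed (intro intc st)
      also have "\<dots> = K * (t - s) * (G t - G s)"
        using \<nu>[OF st(2)] mono[OF st(2)] sets unfolding set_lebesgue_integral_def by (simp add: measure_def)
      also have "\<dots> \<le> K * (t - s) * (2 * L * (t - s))"
      proof (rule mult_left_mono)
        show "G t - G s \<le> 2 * L * (t - s)"
          using g1[of t s] st by (simp add: G_def algebra_simps abs_le_iff)
      qed (use K st in auto)
      finally show ?thesis by (simp add: power2_eq_square algebra_simps)
    qed
    ultimately show "\<bar>F1 t - F1 s - f (p s) * (G t - G s)\<bar> \<le> K * (2 * L) * (t - s)\<^sup>2" by simp
  qed
  then have F1': "rs_prim f (\<lambda>t. g t + L * t) a b F1"
    by (rule rs_prim_cong) (auto simp: G_def pid)
  have "rs_prim f (\<lambda>t. 1 * (g t + L * t) + (- L) * t) a b (\<lambda>t. 1 * F1 t + (- L) * integral {a..t} f)"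
    by (rule rs_prim_linear_right[OF F1' rs_prim_integral[OF f]])
  moreover have "(\<lambda>t. 1 * (g t + L * t) + (- L) * t) = g" by (simp add: fun_eq_iff)
  ultimately show ?thesis using that by metis
qed

lemma rs_prim_bound:
  assumes F: "rs_prim f g a b F" and f: "K-lipschitz_on {a..b} f" and "a \<le> b" "0 \<le> L"
    and g: "\<And>s t. a \<le> s \<Longrightarrow> s \<le> t \<Longrightarrow> t \<le> b \<Longrightarrow> \<bar>g t - g s\<bar> \<le> L * (t - s)"
  shows "\<bar>F b - F a\<bar> \<le> L * integral {a..b} (\<lambda>t. \<bar>f t\<bar>)"
proof -
  obtain C where C: "\<And>s t. a \<le> s \<Longrightarrow> s \<le> t \<Longrightarrow> t \<le> b \<Longrightarrow>
    \<bar>F t - F s - f s * (g t - g s)\<bar> \<le> C * (t - s)\<^sup>2" using F by (elim rs_primE) auto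
  define H where "H t = integral {a..t} (\<lambda>t. \<bar>f t\<bar>)" for t
  have "K-lipschitz_on {a..b} (\<lambda>t. \<bar>f t\<bar>)"
  proof (rule lipschitz_onI)
    fix x y assume "x \<in> {a..b}" "y \<in> {a..b}"
    then show "dist \<bar>f x\<bar> \<bar>f y\<bar> \<le> K * dist x y"
      using lipschitz_onD[OF f, of x y] by (simp add: dist_real_def)
  qed (rule lipschitz_on_nonneg[OF f])
  from rs_prim_integral[OF this]
  have "rs_prim (\<lambda>t. \<bar>f t\<bar>) (\<lambda>t. t) a b H" unfolding H_def .
  then obtain D where D: "\<And>s t. a \<le> s \<Longrightarrow> s \<le> t \<Longrightarrow> t \<le> b \<Longrightarrow>
    \<bar>H t - H s - \<bar>f s\<bar> * (t - s)\<bar> \<le> D * (t - s)\<^sup>2" by (elim rs_primE) auto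
  have inc: "\<bar>F t - F s\<bar> - L * (H t - H s) \<le> (C + L * D) * (t - s)\<^sup>2"
    if "a \<le> s" "s \<le> t" "t \<le> b" for s t
  proof -
    have "\<bar>f s * (g t - g s)\<bar> \<le> \<bar>f s\<bar> * (L * (t - s))"
      unfolding abs_mult using g[OF that] by (intro mult_left_mono) auto
    moreover have "L * (\<bar>f s\<bar> * (t - s)) \<le> L * (H t - H s + D * (t - s)\<^sup>2)"
      using D[OF that] by (intro mult_left_mono assms(4)) linarith
    ultimately show ?thesis
      using C[OF that] by (simp add: algebra_simps)
  qed
  have "F b - L * H b \<le> F a - L * H a"
    by (rule quadratic_increments_le[OF assms(3), of "\<lambda>t. F t - L * H t" "C + L * D"])
      (use inc in \<open>force simp: algebra_simps\<close>)
  moreover have "- F b - L * H b \<le> - F a - L * H a"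
    by (rule quadratic_increments_le[OF assms(3), of "\<lambda>t. - F t - L * H t" "C + L * D"])
      (use inc in \<open>force simp: algebra_simps\<close>)
  ultimately show ?thesis by (simp add: H_def)
qed

text \<open>
  On the intervals of a division of mesh \<open>\<delta>\<close> the quadratic errors add up to at most a multiple of
  \<open>\<delta> * (b - a)\<close>, wherever the tags lie.
\<close>

lemma rs_prim_has_RS_integral:
  assumes F: "rs_prim f g a b F" and f: "K-lipschitz_on {a..b} f" and g: "L-lipschitz_on {a..b} g"
    and "a \<le> b"
  shows "has_RS_integral f g a b (F b - F a)"
  unfolding has_RS_integral_def
proof (intro allI impI)
  obtain C where C: "0 \<le> C" "\<And>s t. a \<le> s \<Longrightarrow> s \<le> t \<Longrightarrow> t \<le> b \<Longrightarrow>
    \<bar>F t - F s - f s * (g t - g s)\<bar> \<le> C * (t - s)\<^sup>2" using F by (elim rs_primE) auto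
  define D where "D = K * L + C"
  have D: "0 \<le> D" using C f g lipschitz_on_nonneg unfolding D_def by (metis add_nonneg_nonneg mult_nonneg_nonneg)
  fix \<epsilon> :: real assume "0 < \<epsilon>"
  define \<delta> where "\<delta> = \<epsilon> / (D * (b - a) + 1)"
  have pos: "0 < D * (b - a) + 1" using D \<open>a \<le> b\<close> by (metis add_nonneg_pos diff_ge_0_iff_ge mult_nonneg_nonneg zero_less_one)
  have "0 < \<delta>" using \<open>0 < \<epsilon>\<close> pos by (simp add: \<delta>_def)
  show "\<exists>\<delta>>0. \<forall>p. p tagged_division_of {a..b} \<and> (\<forall>(x, K)\<in>p. Sup K - Inf K < \<delta>) \<longrightarrow>
        \<bar>(\<Sum>(x, K)\<in>p. f x * (g (Sup K) - g (Inf K))) - (F b - F a)\<bar> < \<epsilon>"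
  proof (intro exI[of _ \<delta>] conjI allI impI \<open>0 < \<delta>\<close>)
    fix p assume "p tagged_division_of {a..b} \<and> (\<forall>(x, K)\<in>p. Sup K - Inf K < \<delta>)"
    then have p: "p tagged_division_of {a..b}" and fine: "\<And>x K. (x, K) \<in> p \<Longrightarrow> Sup K - Inf K < \<delta>" by auto
    have summand: "\<bar>f x * (g (Sup K) - g (Inf K)) - (F (Sup K) - F (Inf K))\<bar> \<le> D * \<delta> * (Sup K - Inf K)"
      if xK: "(x, K) \<in> p" for x K
    proof -
      obtain u v where K: "K = {u..v}" using tagged_division_ofD(4)[OF p xK] by (auto simp: box_real)
      have x: "x \<in> K" "K \<subseteq> {a..b}" using tagged_division_ofD(2,3)[OF p xK] by auto
      then have uv: "a \<le> u" "u \<le> x" "x \<le> v" "v \<le> b" using K by auto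
      then have [simp]: "Inf K = u" "Sup K = v" using K by auto
      have "f x * (g v - g u) - (F v - F u) = (f x - f u) * (g v - g u) - (F v - F u - f u * (g v - g u))"
        by (simp add: algebra_simps)
      then have "\<bar>f x * (g v - g u) - (F v - F u)\<bar> \<le> D * (v - u)\<^sup>2"
        using lipschitz_product_increment[OF f g uv] C(2)[of u v] uv unfolding D_def distrib_right by linarith
      also have "\<dots> \<le> D * (\<delta> * (v - u))"
        using fine[OF xK] uv D by (intro mult_left_mono) (auto simp: power2_eq_square intro!: mult_right_mono)
      finally show ?thesis by (simp add: mult.assoc)
    qed
    have fin: "finite p" using p by auto
    have telF: "(\<Sum>(x, K)\<in>p. F (Sup K) - F (Inf K)) = F b - F a"
      by (rule additive_tagged_division_1[OF \<open>a \<le> b\<close> p])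
    have telid: "(\<Sum>(x, K)\<in>p. Sup K - Inf K) = b - a"
      using additive_tagged_division_1[OF \<open>a \<le> b\<close> p, of "\<lambda>x. x"] by simp
    have "\<bar>(\<Sum>(x, K)\<in>p. f x * (g (Sup K) - g (Inf K))) - (F b - F a)\<bar>
      = \<bar>\<Sum>(x, K)\<in>p. f x * (g (Sup K) - g (Inf K)) - (F (Sup K) - F (Inf K))\<bar>"
      unfolding telF[symmetric] by (simp add: sum_subtractf case_prod_unfold)
    also have "\<dots> \<le> (\<Sum>(x, K)\<in>p. \<bar>f x * (g (Sup K) - g (Inf K)) - (F (Sup K) - F (Inf K))\<bar>)"
      unfolding case_prod_unfold by (rule sum_abs)
    also have "\<dots> \<le> (\<Sum>(x, K)\<in>p. D * \<delta> * (Sup K - Inf K))"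
      by (rule sum_mono) (use summand in auto)
    also have "\<dots> = D * \<delta> * (b - a)"
      unfolding telid[symmetric] by (simp add: sum_distrib_left case_prod_unfold)
    also have "\<dots> = \<epsilon> * ((D * (b - a)) / (D * (b - a) + 1))" by (simp add: \<delta>_def)
    also have "\<dots> < \<epsilon> * 1"
      using pos \<open>0 < \<epsilon>\<close> by (intro mult_strict_left_mono) (auto simp: divide_less_eq)
    finally show "\<bar>(\<Sum>(x, K)\<in>p. f x * (g (Sup K) - g (Inf K))) - (F b - F a)\<bar> < \<epsilon>" by simp
  qed
qed

lemma has_RS_integral_unique:
  assumes "has_RS_integral f g a b I" "has_RS_integral f g a b J"
  shows "I = J"
proof (rule ccontr)
  assume "I \<noteq> J"
  define e where "e = \<bar>I - J\<bar> / 2"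
  have "0 < e" using \<open>I \<noteq> J\<close> by (simp add: e_def)
  from assms(1)[unfolded has_RS_integral_def, rule_format, OF \<open>0 < e\<close>]
  obtain d1 where d1: "0 < d1" "\<forall>p. p tagged_division_of {a..b} \<and> (\<forall>(x, K)\<in>p. Sup K - Inf K < d1) \<longrightarrow>
        \<bar>(\<Sum>(x, K)\<in>p. f x * (g (Sup K) - g (Inf K))) - I\<bar> < e"
    by (elim exE conjE)
  from assms(2)[unfolded has_RS_integral_def, rule_format, OF \<open>0 < e\<close>]
  obtain d2 where d2: "0 < d2" "\<forall>p. p tagged_division_of {a..b} \<and> (\<forall>(x, K)\<in>p. Sup K - Inf K < d2) \<longrightarrow>
        \<bar>(\<Sum>(x, K)\<in>p. f x * (g (Sup K) - g (Inf K))) - J\<bar> < e"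
    by (elim exE conjE)
  define d where "d = min d1 d2 / 3"
  have "0 < d" using d1 d2 by (simp add: d_def)
  obtain p where p: "p tagged_division_of {a..b}" "(\<lambda>x. ball x d) fine p"
    using fine_division_exists_real[OF gauge_ball[OF \<open>0 < d\<close>]] by blast
  have mesh: "Sup K - Inf K < min d1 d2" if xK: "(x, K) \<in> p" for x K
  proof -
    obtain u v where K: "K = {u..v}" using tagged_division_ofD(4)[OF p(1) xK] by (auto simp: box_real)
    have "x \<in> K" using tagged_division_ofD(2)[OF p(1) xK] .
    then have "u \<in> K" "v \<in> K" "u \<le> v" using K by auto
    moreover have "K \<subseteq> ball x d" using p(2) xK by (auto simp: fine_def)
    ultimately have "dist x u < d" "dist x v < d" by auto
    then have "v - u < 2 * d" by (simp add: dist_real_def abs_less_iff)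
    moreover have "3 * d = min d1 d2" by (simp add: d_def)
    ultimately have "v - u < min d1 d2" using \<open>0 < d\<close> by linarith
    then show ?thesis using K \<open>u \<le> v\<close> by simp
  qed
  have "\<bar>(\<Sum>(x, K)\<in>p. f x * (g (Sup K) - g (Inf K))) - I\<bar> < e"
    using mesh p(1) by (intro d1(2)[rule_format]) force
  moreover have "\<bar>(\<Sum>(x, K)\<in>p. f x * (g (Sup K) - g (Inf K))) - J\<bar> < e"
    using mesh p(1) by (intro d2(2)[rule_format]) force
  moreover have "False" if "\<bar>S - I\<bar> < e" "\<bar>S - J\<bar> < e" for S
  proof -
    have "\<bar>I - J\<bar> \<le> \<bar>S - I\<bar> + \<bar>S - J\<bar>" for I J S :: real by linarith
    from this[of I J S] show False using that unfolding e_def by (simp add: field_simps)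
  qed
  ultimately show False by blast
qed

lemma RS_integral_eq:
  assumes "rs_prim f g a b F" "K-lipschitz_on {a..b} f" "L-lipschitz_on {a..b} g" "a \<le> b"
  shows "RS_integral f g a b = F b - F a"
  unfolding RS_integral_def
  using rs_prim_has_RS_integral[OF assms] has_RS_integral_unique by blast

section \<open>Currents of curves\<close>

text \<open>
  Integrals along a curve are estimated for 1-Lipschitz parametrizations. Unlike parametrization by
  arc length, this property can be checked for a concatenation by the triangle inequality alone.
\<close>

definition lipschitz_curve :: "'a::metric_space curve \<Rightarrow> bool" where
  "lipschitz_curve c \<longleftrightarrow> 0 \<le> clen c \<and>
     (\<forall>s\<in>{0..clen c}. \<forall>t\<in>{0..clen c}. dist (cpoint c s) (cpoint c t) \<le> \<bar>s - t\<bar>)"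

definition arc_integral :: "'a curve \<Rightarrow> ('a \<Rightarrow> real) \<Rightarrow> real" where
  "arc_integral c h = integral {0..clen c} (\<lambda>t. h (cpoint c t))"

lemma lipschitz_curve_nonneg: "lipschitz_curve c \<Longrightarrow> 0 \<le> clen c"
  by (simp add: lipschitz_curve_def)

lemma lipschitz_curveD:
  assumes "lipschitz_curve c" "0 \<le> s" "s \<le> t" "t \<le> clen c"
  shows "dist (cpoint c s) (cpoint c t) \<le> t - s"
proof -
  have "s \<in> {0..clen c}" "t \<in> {0..clen c}" using assms by auto
  then have "dist (cpoint c s) (cpoint c t) \<le> \<bar>s - t\<bar>"
    using assms(1) unfolding lipschitz_curve_def by blast
  then show ?thesis using assms(3) by simp
qed

lemma Lip_along_curve:
  assumes "lipschitz_curve c" "f \<in> Lip_funs"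
  shows "(lip_const f)-lipschitz_on {0..clen c} (\<lambda>t. f (cpoint c t))"
proof (rule lipschitz_onI)
  fix s t assume "s \<in> {0..clen c}" "t \<in> {0..clen c}"
  then have "dist (cpoint c s) (cpoint c t) \<le> \<bar>s - t\<bar>" using assms(1) by (simp add: lipschitz_curve_def)
  then have "lip_const f * dist (cpoint c s) (cpoint c t) \<le> lip_const f * \<bar>s - t\<bar>"
    by (intro mult_left_mono lip_const_nonneg assms)
  then show "dist (f (cpoint c s)) (f (cpoint c t)) \<le> lip_const f * dist s t"
    using lip_constD[OF assms(2), of "cpoint c s" "cpoint c t"] by (simp add: dist_real_def)
qed (rule lip_const_nonneg[OF assms(2)])

lemma curve_current_eq:
  assumes "lipschitz_curve c" "f \<in> Lip_funs" "\<pi> \<in> Lip_funs"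
    and "rs_prim (\<lambda>t. f (cpoint c t)) (\<lambda>t. \<pi> (cpoint c t)) 0 (clen c) F"
  shows "curve_current c (f, \<pi>) = F (clen c) - F 0"
  using RS_integral_eq[OF assms(4) Lip_along_curve[OF assms(1,2)] Lip_along_curve[OF assms(1,3)]
      lipschitz_curve_nonneg[OF assms(1)]]
  by (simp add: curve_current_def comp_def)

lemma curve_current_prim:
  assumes "lipschitz_curve c" "f \<in> Lip_funs" "\<pi> \<in> Lip_funs"
  obtains F where "rs_prim (\<lambda>t. f (cpoint c t)) (\<lambda>t. \<pi> (cpoint c t)) 0 (clen c) F"
    "curve_current c (f, \<pi>) = F (clen c) - F 0"
  using rs_prim_exists[OF Lip_along_curve[OF assms(1,2)] Lip_along_curve[OF assms(1,3)]
      lipschitz_curve_nonneg[OF assms(1)]] curve_current_eq[OF assms] by metis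

lemma curve_current_linear_left:
  assumes "lipschitz_curve c" "f \<in> Lip_funs" "g \<in> Lip_funs" "\<pi> \<in> Lip_funs"
  shows "curve_current c (\<lambda>x. a * f x + b * g x, \<pi>)
    = a * curve_current c (f, \<pi>) + b * curve_current c (g, \<pi>)"
proof -
  obtain F where F: "rs_prim (\<lambda>t. f (cpoint c t)) (\<lambda>t. \<pi> (cpoint c t)) 0 (clen c) F"
    "curve_current c (f, \<pi>) = F (clen c) - F 0" using assms curve_current_prim by metis
  obtain G where G: "rs_prim (\<lambda>t. g (cpoint c t)) (\<lambda>t. \<pi> (cpoint c t)) 0 (clen c) G"
    "curve_current c (g, \<pi>) = G (clen c) - G 0" using assms curve_current_prim by metis
  have "curve_current c (\<lambda>x. a * f x + b * g x, \<pi>)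
      = (a * F (clen c) + b * G (clen c)) - (a * F 0 + b * G 0)"
    by (rule curve_current_eq[OF assms(1) _ assms(4) rs_prim_linear_left[OF F(1) G(1)]])
      (intro Lip_add Lip_cmult assms)
  then show ?thesis unfolding F(2) G(2) by (simp add: right_diff_distrib)
qed

lemma curve_current_linear_right:
  assumes "lipschitz_curve c" "f \<in> Lip_funs" "\<pi> \<in> Lip_funs" "\<rho> \<in> Lip_funs"
  shows "curve_current c (f, \<lambda>x. a * \<pi> x + b * \<rho> x)
    = a * curve_current c (f, \<pi>) + b * curve_current c (f, \<rho>)"
proof -
  obtain F where F: "rs_prim (\<lambda>t. f (cpoint c t)) (\<lambda>t. \<pi> (cpoint c t)) 0 (clen c) F"
    "curve_current c (f, \<pi>) = F (clen c) - F 0" using assms curve_current_prim by metis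
  obtain G where G: "rs_prim (\<lambda>t. f (cpoint c t)) (\<lambda>t. \<rho> (cpoint c t)) 0 (clen c) G"
    "curve_current c (f, \<rho>) = G (clen c) - G 0" using assms curve_current_prim by metis
  have "curve_current c (f, \<lambda>x. a * \<pi> x + b * \<rho> x)
      = (a * F (clen c) + b * G (clen c)) - (a * F 0 + b * G 0)"
    by (rule curve_current_eq[OF assms(1,2) _ rs_prim_linear_right[OF F(1) G(1)]])
      (intro Lip_add Lip_cmult assms)
  then show ?thesis unfolding F(2) G(2) by (simp add: right_diff_distrib)
qed

lemma curve_current_bilinear:
  "lipschitz_curve c \<Longrightarrow> bilinear_on_D1 (curve_current c)"
  by (simp add: bilinear_on_D1_def curve_current_linear_left curve_current_linear_right)

lemma curve_current_const:
  assumes "lipschitz_curve c" "\<pi> \<in> Lip_funs"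
  shows "curve_current c (\<lambda>_. k, \<pi>) = k * (\<pi> (cend c) - \<pi> (cstart c))"
proof -
  have "rs_prim (\<lambda>_. k) (\<lambda>t. \<pi> (cpoint c t)) 0 (clen c) (\<lambda>t. k * \<pi> (cpoint c t))"
    by (rule rs_primI[of _ _ _ _ _ 0]) (simp add: algebra_simps)
  from curve_current_eq[OF assms(1) _ assms(2) this] show ?thesis
    by (simp add: cend_def cstart_def algebra_simps)
qed

lemma curve_current_by_parts:
  assumes "lipschitz_curve c" "closed_curve c" "f \<in> Lip_funs" "\<pi> \<in> Lip_funs"
  shows "curve_current c (\<pi>, f) = - curve_current c (f, \<pi>)"
proof -
  obtain F where F: "rs_prim (\<lambda>t. f (cpoint c t)) (\<lambda>t. \<pi> (cpoint c t)) 0 (clen c) F"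
    "curve_current c (f, \<pi>) = F (clen c) - F 0" using assms curve_current_prim by metis
  from rs_prim_by_parts[OF F(1) Lip_along_curve[OF assms(1,3)] Lip_along_curve[OF assms(1,4)]]
  have "curve_current c (\<pi>, f) = (f (cpoint c (clen c)) * \<pi> (cpoint c (clen c)) - F (clen c))
     - (f (cpoint c 0) * \<pi> (cpoint c 0) - F 0)"
    by (rule curve_current_eq[OF assms(1,4,3)])
  then show ?thesis using F(2) assms(2) by (simp add: closed_curve_def cend_def cstart_def)
qed

text \<open>This makes the image of Lebesgue measure under the curve a mass bound for its current.\<close>

lemma curve_current_bound:
  assumes "lipschitz_curve c" "f \<in> Lip_funs" "\<pi> \<in> Lip_funs"
  shows "\<bar>curve_current c (f, \<pi>)\<bar> \<le> lip_const \<pi> * arc_integral c (\<lambda>x. \<bar>f x\<bar>)"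
proof -
  obtain F where F: "rs_prim (\<lambda>t. f (cpoint c t)) (\<lambda>t. \<pi> (cpoint c t)) 0 (clen c) F"
    "curve_current c (f, \<pi>) = F (clen c) - F 0" using assms curve_current_prim by metis
  show ?thesis unfolding F(2) arc_integral_def
    by (rule rs_prim_bound[OF F(1) Lip_along_curve[OF assms(1,2)] lipschitz_curve_nonneg[OF assms(1)]
          lip_const_nonneg[OF assms(3)]])
      (rule lipschitz_real[OF Lip_along_curve[OF assms(1,3)]])
qed

lemma arc_integrable:
  assumes "lipschitz_curve c" "h \<in> Lip_funs"
  shows "(\<lambda>t. h (cpoint c t)) integrable_on {0..clen c}"
  by (intro integrable_continuous_interval lipschitz_on_continuous_on[OF Lip_along_curve] assms)

lemma arc_integral_add:
  "lipschitz_curve c \<Longrightarrow> f \<in> Lip_funs \<Longrightarrow> g \<in> Lip_funs \<Longrightarrow>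
    arc_integral c (\<lambda>x. f x + g x) = arc_integral c f + arc_integral c g"
  unfolding arc_integral_def by (intro Henstock_Kurzweil_Integration.integral_add arc_integrable)

lemma arc_integral_cmult: "arc_integral c (\<lambda>x. k * f x) = k * arc_integral c f"
  unfolding arc_integral_def by (rule Henstock_Kurzweil_Integration.integral_mult_right)

lemma arc_integral_const: "lipschitz_curve c \<Longrightarrow> arc_integral c (\<lambda>_. k) = k * clen c"
  unfolding arc_integral_def by (simp add: lipschitz_curve_nonneg)

lemma arc_integral_mono:
  assumes "lipschitz_curve c" "f \<in> Lip_funs" "g \<in> Lip_funs"
    "\<And>t. 0 \<le> t \<Longrightarrow> t \<le> clen c \<Longrightarrow> f (cpoint c t) \<le> g (cpoint c t)"
  shows "arc_integral c f \<le> arc_integral c g"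
  unfolding arc_integral_def
  by (intro Henstock_Kurzweil_Integration.integral_le arc_integrable assms) (use assms(4) in auto)

lemma arc_integral_sum:
  "lipschitz_curve c \<Longrightarrow> (\<And>i. i \<in> I \<Longrightarrow> f i \<in> Lip_funs) \<Longrightarrow>
    arc_integral c (\<lambda>x. \<Sum>i\<in>I. f i x) = (\<Sum>i\<in>I. arc_integral c (f i))"
proof (induction I rule: infinite_finite_induct)
  case (insert i I)
  then show ?case by (simp add: arc_integral_add Lip_sum)
qed (simp_all add: arc_integral_const)

text \<open>
  Short increments that start where \<open>f\<close> is nonzero stay where \<open>\<pi>\<close> and \<open>\<rho>\<close> agree, and long ones are
  quadratically bounded anyway; hence \<open>0\<close> is a primitive for the difference.
\<close>

lemma curve_current_local:
  assumes c: "lipschitz_curve c" and f: "f \<in> Lipb_funs" and \<pi>: "\<pi> \<in> Lip_funs" "\<rho> \<in> Lip_funs"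
    and "0 < r" and eq: "\<And>x y. f x \<noteq> 0 \<Longrightarrow> dist x y \<le> r \<Longrightarrow> \<pi> y = \<rho> y"
  shows "curve_current c (f, \<pi>) = curve_current c (f, \<rho>)"
proof -
  define \<psi> where "\<psi> = (\<lambda>x. 1 * \<pi> x + (- 1) * \<rho> x)"
  have \<psi>: "\<psi> \<in> Lip_funs" unfolding \<psi>_def by (intro Lip_add Lip_cmult \<pi>)
  obtain B where B: "0 \<le> B" "\<And>x. \<bar>f x\<bar> \<le> B" using Lipb_bound[OF f] by blast
  have "rs_prim (\<lambda>t. f (cpoint c t)) (\<lambda>t. \<psi> (cpoint c t)) 0 (clen c) (\<lambda>_. 0)"
  proof (rule rs_primI)
    fix s t assume st: "0 \<le> s" "s \<le> t" "t \<le> clen c"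
    let ?D = "\<psi> (cpoint c t) - \<psi> (cpoint c s)"
    have L: "0 \<le> lip_const \<psi>" by (rule lip_const_nonneg[OF \<psi>])
    have "\<bar>f (cpoint c s) * ?D\<bar> \<le> B * lip_const \<psi> / r * (t - s)\<^sup>2"
    proof (cases "f (cpoint c s) = 0 \<or> t - s \<le> r")
      case True
      have "f (cpoint c s) * ?D = 0"
      proof (cases "f (cpoint c s) = 0")
        case False
        then have "dist (cpoint c s) (cpoint c t) \<le> r"
          using True lipschitz_curveD[OF c st] by linarith
        then have "\<psi> (cpoint c t) = 0" "\<psi> (cpoint c s) = 0"
          using eq[OF False, of "cpoint c t"] eq[OF False, of "cpoint c s"] \<open>0 < r\<close>
          by (auto simp: \<psi>_def)
        then show ?thesis by simp
      qed simp
      moreover have "0 \<le> B * lip_const \<psi> / r * (t - s)\<^sup>2" using B(1) L \<open>0 < r\<close> by simp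
      ultimately show ?thesis by (simp only: abs_zero)
    next
      case False
      have "\<bar>f (cpoint c s) * ?D\<bar> \<le> B * (lip_const \<psi> * (t - s))"
        unfolding abs_mult using lipschitz_real[OF Lip_along_curve[OF c \<psi>] st] B
        by (intro mult_mono) auto
      also have "\<dots> = B * lip_const \<psi> * (t - s) * 1" by simp
      also have "\<dots> \<le> B * lip_const \<psi> * (t - s) * ((t - s) / r)"
        using False B(1) L st \<open>0 < r\<close> by (intro mult_left_mono mult_nonneg_nonneg) auto
      also have "\<dots> = B * lip_const \<psi> / r * (t - s)\<^sup>2" by (simp add: power2_eq_square)
      finally show ?thesis .
    qed
    then show "\<bar>0 - 0 - f (cpoint c s) * ?D\<bar> \<le> B * lip_const \<psi> / r * (t - s)\<^sup>2" by simp
  qed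
  from curve_current_eq[OF c Lipb_Lip[OF f] \<psi> this]
  have "curve_current c (f, \<psi>) = 0" by simp
  moreover have "curve_current c (f, \<psi>) = 1 * curve_current c (f, \<pi>) + (- 1) * curve_current c (f, \<rho>)"
    unfolding \<psi>_def by (rule curve_current_linear_right[OF c Lipb_Lip[OF f] \<pi>])
  ultimately show ?thesis by simp
qed

subsection \<open>Concatenation\<close>

lemma clen_concat [simp]: "clen (concat_curve c d) = clen c + clen d"
  by (simp add: concat_curve_def)

lemma cpoint_concat_left: "t \<le> clen c \<Longrightarrow> cpoint (concat_curve c d) t = cpoint c t"
  by (simp add: concat_curve_def)

lemma cpoint_concat_right:
  "cend c = cstart d \<Longrightarrow> clen c \<le> t \<Longrightarrow> cpoint (concat_curve c d) t = cpoint d (t - clen c)"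
  by (auto simp: concat_curve_def cend_def cstart_def)

lemma cstart_concat: "0 \<le> clen c \<Longrightarrow> cstart (concat_curve c d) = cstart c"
  by (simp add: cstart_def cpoint_concat_left)

lemma cend_concat: "cend c = cstart d \<Longrightarrow> 0 \<le> clen d \<Longrightarrow> cend (concat_curve c d) = cend d"
  by (simp add: cend_def[of "concat_curve c d"] cpoint_concat_right) (simp add: cend_def)

lemma lipschitz_curve_concat:
  assumes c: "lipschitz_curve c" and d: "lipschitz_curve d" and e: "cend c = cstart d"
  shows "lipschitz_curve (concat_curve c d)"
proof -
  let ?e = "concat_curve c d"
  have nn: "0 \<le> clen c" "0 \<le> clen d" using c d by (auto simp: lipschitz_curve_def)
  have le: "dist (cpoint ?e s) (cpoint ?e t) \<le> t - s" if st: "0 \<le> s" "s \<le> t" "t \<le> clen ?e" for s t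
  proof -
    have left: "dist (cpoint ?e s) (cpoint ?e t) \<le> t - s" if "0 \<le> s" "s \<le> t" "t \<le> clen c" for s t
      using lipschitz_curveD[OF c that] that by (simp add: cpoint_concat_left)
    have right: "dist (cpoint ?e s) (cpoint ?e t) \<le> t - s" if "clen c \<le> s" "s \<le> t" "t \<le> clen ?e" for s t
      using lipschitz_curveD[OF d, of "s - clen c" "t - clen c"] that
      by (simp add: cpoint_concat_right[OF e])
    consider "t \<le> clen c" | "clen c \<le> s" | "s \<le> clen c" "clen c \<le> t" by linarith
    then show ?thesis
    proof cases
      case 3
      have "dist (cpoint ?e s) (cpoint ?e t)
          \<le> dist (cpoint ?e s) (cpoint ?e (clen c)) + dist (cpoint ?e (clen c)) (cpoint ?e t)"
        by (rule dist_triangle)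
      then show ?thesis using left[of s "clen c"] right[of "clen c" t] 3 st by linarith
    qed (use left right st in auto)
  qed
  show ?thesis unfolding lipschitz_curve_def
  proof (intro conjI ballI)
    fix s t assume st: "s \<in> {0..clen ?e}" "t \<in> {0..clen ?e}"
    show "dist (cpoint ?e s) (cpoint ?e t) \<le> \<bar>s - t\<bar>"
    proof (cases "s \<le> t")
      case True
      then show ?thesis using le[of s t] st by simp
    next
      case False
      then show ?thesis using le[of t s] st by (simp add: dist_commute)
    qed
  qed (use nn in simp)
qed

lemma curve_current_concat:
  assumes c: "lipschitz_curve c" and d: "lipschitz_curve d" and e: "cend c = cstart d"
    and f: "f \<in> Lip_funs" and \<pi>: "\<pi> \<in> Lip_funs"
  shows "curve_current (concat_curve c d) (f, \<pi>) = curve_current c (f, \<pi>) + curve_current d (f, \<pi>)"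
proof -
  let ?e = "concat_curve c d"
  obtain F where F: "rs_prim (\<lambda>t. f (cpoint c t)) (\<lambda>t. \<pi> (cpoint c t)) 0 (clen c) F"
    "curve_current c (f, \<pi>) = F (clen c) - F 0" by (rule curve_current_prim[OF c f \<pi>])
  obtain G where G: "rs_prim (\<lambda>t. f (cpoint d t)) (\<lambda>t. \<pi> (cpoint d t)) 0 (clen d) G"
    "curve_current d (f, \<pi>) = G (clen d) - G 0" by (rule curve_current_prim[OF d f \<pi>])
  have nn: "0 \<le> clen c" "0 \<le> clen d" using c d by (auto simp: lipschitz_curve_def)
  have le: "lipschitz_curve ?e" by (rule lipschitz_curve_concat[OF c d e])
  have 1: "rs_prim (\<lambda>t. f (cpoint ?e t)) (\<lambda>t. \<pi> (cpoint ?e t)) 0 (clen c) F"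
    by (rule rs_prim_cong[OF F(1)]) (simp_all add: cpoint_concat_left)
  have "rs_prim (\<lambda>t. f (cpoint ?e t)) (\<lambda>t. \<pi> (cpoint ?e t)) (0 + clen c) (clen d + clen c)
      (\<lambda>t. G (t - clen c))"
    by (rule rs_prim_cong[OF rs_prim_shift[OF G(1)]]) (simp_all add: cpoint_concat_right[OF e])
  then have 2: "rs_prim (\<lambda>t. f (cpoint ?e t)) (\<lambda>t. \<pi> (cpoint ?e t)) (clen c) (clen ?e)
      (\<lambda>t. G (t - clen c))" by (simp add: add.commute)
  obtain H where H: "rs_prim (\<lambda>t. f (cpoint ?e t)) (\<lambda>t. \<pi> (cpoint ?e t)) 0 (clen ?e) H"
    "H (clen ?e) - H 0 = (F (clen c) - F 0) + (G (clen ?e - clen c) - G (clen c - clen c))"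
    using rs_prim_join[OF 1 2 _ _ Lip_along_curve[OF le f] Lip_along_curve[OF le \<pi>]] nn by auto
  show ?thesis using curve_current_eq[OF le f \<pi> H(1)] H(2) F(2) G(2) by simp
qed

lemma arc_integral_concat:
  assumes c: "lipschitz_curve c" and d: "lipschitz_curve d" and e: "cend c = cstart d"
    and h: "h \<in> Lip_funs"
  shows "arc_integral (concat_curve c d) h = arc_integral c h + arc_integral d h"
proof -
  let ?e = "concat_curve c d"
  have nn: "0 \<le> clen c" "0 \<le> clen d" using c d by (auto simp: lipschitz_curve_def)
  have le: "lipschitz_curve ?e" by (rule lipschitz_curve_concat[OF c d e])
  have "arc_integral ?e h = integral {0..clen c} (\<lambda>t. h (cpoint ?e t)) + integral {clen c..clen c + clen d} (\<lambda>t. h (cpoint ?e t))"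
    unfolding arc_integral_def clen_concat
    using arc_integrable[OF le h] nn
    by (intro Henstock_Kurzweil_Integration.integral_combine[symmetric]) auto
  also have "integral {0..clen c} (\<lambda>t. h (cpoint ?e t)) = arc_integral c h"
    unfolding arc_integral_def
    by (rule Henstock_Kurzweil_Integration.integral_cong) (simp add: cpoint_concat_left)
  also have "integral {clen c..clen c + clen d} (\<lambda>t. h (cpoint ?e t)) = arc_integral d h"
  proof -
    have "((\<lambda>t. h (cpoint d t)) has_integral arc_integral d h) {0..clen d}"
      unfolding arc_integral_def by (rule integrable_integral[OF arc_integrable[OF d h]])
    from has_integral_shift_real_ivl[OF this, of "- clen c"]
    have "((\<lambda>t. h (cpoint d (t - clen c))) has_integral arc_integral d h) {clen c..clen c + clen d}"
      by (simp add: add.commute)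
    then have "((\<lambda>t. h (cpoint ?e t)) has_integral arc_integral d h) {clen c..clen c + clen d}"
      by (rule has_integral_eq[rotated]) (simp add: cpoint_concat_right[OF e])
    then show ?thesis by (rule integral_unique)
  qed
  finally show ?thesis .
qed

lemma concat_curve_assoc:
  assumes "0 \<le> clen c"
  shows "concat_curve (concat_curve b c) d = concat_curve b (concat_curve c d)"
  using assms by (auto simp: concat_curve_def fun_eq_iff algebra_simps)

subsection \<open>Piecewise geodesic curves\<close>

lemma geodesic_lipschitz: "geodesic c \<Longrightarrow> lipschitz_curve c"
  by (simp add: geodesic_def lipschitz_curve_def)

lemma piecewise_geodesic_lipschitz: "piecewise_geodesic c \<Longrightarrow> lipschitz_curve c"
  by (induction rule: piecewise_geodesic.induct)
    (auto intro: geodesic_lipschitz lipschitz_curve_concat)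

text \<open>The pieces of the second curve are appended one at a time.\<close>

lemma piecewise_geodesic_concat:
  assumes "piecewise_geodesic c" "piecewise_geodesic d" "cend c = cstart d"
  shows "piecewise_geodesic (concat_curve c d)"
  using assms(2,3)
proof (induction rule: piecewise_geodesic.induct)
  case (single d)
  then show ?case using assms(1) by (intro piecewise_geodesic.append)
next
  case (append d g)
  have nn: "0 \<le> clen d" "0 \<le> clen g"
    using append.hyps by (auto simp: lipschitz_curve_nonneg piecewise_geodesic_lipschitz geodesic_lipschitz)
  have start: "cend c = cstart d" using append.prems nn by (simp add: cstart_concat)
  have "cend (concat_curve c d) = cstart g" using append.hyps start nn by (simp add: cend_concat)
  then have "piecewise_geodesic (concat_curve (concat_curve c d) g)"
    by (rule piecewise_geodesic.append[OF append.IH[OF start] append.hyps(2)])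
  then show ?case by (simp add: concat_curve_assoc nn)
qed

text \<open>
  Dividing at the corners realizes the length, since each piece is a geodesic; the opposite
  inequality holds because the curve is 1-Lipschitz.
\<close>

lemma piecewise_geodesic_division:
  assumes "piecewise_geodesic c" "0 \<le> t" "t \<le> clen c"
  shows "\<exists>D. D division_of {0..t} \<and> (\<Sum>K\<in>D. dist (cpoint c (Inf K)) (cpoint c (Sup K))) = t"
  using assms
proof (induction arbitrary: t rule: piecewise_geodesic.induct)
  case (single c)
  have "{{0..t}} division_of {0..t}" using single division_of_self[of 0 t] by simp
  moreover have "dist (cpoint c 0) (cpoint c t) = t" using single by (auto simp: geodesic_def)
  ultimately show ?case using single by (intro exI[of _ "{{0..t}}"]) simp
next
  case (append c d)
  let ?e = "concat_curve c d"
  have nn: "0 \<le> clen c" using append by (auto simp: lipschitz_curve_nonneg piecewise_geodesic_lipschitz)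
  have left: "\<exists>D. D division_of {0..t} \<and> (\<Sum>K\<in>D. dist (cpoint ?e (Inf K)) (cpoint ?e (Sup K))) = t"
    if t: "0 \<le> t" "t \<le> clen c" for t
  proof -
    obtain D where D: "D division_of {0..t}" "(\<Sum>K\<in>D. dist (cpoint c (Inf K)) (cpoint c (Sup K))) = t"
      using append.IH[OF t] by blast
    have "dist (cpoint ?e (Inf K)) (cpoint ?e (Sup K)) = dist (cpoint c (Inf K)) (cpoint c (Sup K))"
      if K: "K \<in> D" for K
    proof -
      obtain u v where uv: "K = {u..v}" using division_ofD(4)[OF D(1) K] by (auto simp: box_real)
      have "K \<noteq> {}" "K \<subseteq> {0..t}" using division_ofD(2,3)[OF D(1) K] by auto
      then have "u \<le> v" "v \<le> t" using uv by auto
      then show ?thesis using t uv by (simp add: cpoint_concat_left)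
    qed
    then have "(\<Sum>K\<in>D. dist (cpoint ?e (Inf K)) (cpoint ?e (Sup K))) = t"
      using D(2) by simp
    then show ?thesis using D(1) by blast
  qed
  show ?case
  proof (cases "t \<le> clen c")
    case True
    then show ?thesis using left append.prems by blast
  next
    case False
    obtain D where D: "D division_of {0..clen c}"
        "(\<Sum>K\<in>D. dist (cpoint ?e (Inf K)) (cpoint ?e (Sup K))) = clen c"
      using left[of "clen c"] nn by auto
    have "{{clen c..t}} division_of {clen c..t}"
      using False division_of_self[of "clen c" t] by simp
    then have "D \<union> {{clen c..t}} division_of ({0..clen c} \<union> {clen c..t})"
      by (intro division_disjoint_union D) auto
    moreover have "{0..clen c} \<union> {clen c..t} = {0..t}" using nn False by auto
    moreover have "{clen c..t} \<notin> D" using division_ofD(2)[OF D(1)] False by force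
    moreover have "dist (cpoint ?e (clen c)) (cpoint ?e t) = t - clen c"
    proof -
      have "dist (cpoint d 0) (cpoint d (t - clen c)) = \<bar>0 - (t - clen c)\<bar>"
      proof -
        have "0 \<in> {0..clen d}" "t - clen c \<in> {0..clen d}" using append.prems False by auto
        then show ?thesis using append.hyps(2) unfolding geodesic_def by blast
      qed
      then show ?thesis using False append.hyps by (simp add: cpoint_concat_right)
    qed
    ultimately show ?thesis
      using D False division_ofD(1)[OF D(1)] by (intro exI[of _ "D \<union> {{clen c..t}}"]) (simp add: insert_commute)
  qed
qed

lemma piecewise_geodesic_arclength:
  assumes "piecewise_geodesic c"
  shows "arclength_curve c"
  unfolding arclength_curve_def
proof (intro conjI ballI)
  have c: "lipschitz_curve c" by (rule piecewise_geodesic_lipschitz[OF assms])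
  then show "0 \<le> clen c" by (rule lipschitz_curve_nonneg)
  fix t assume t: "t \<in> {0..clen c}"
  show "length_on (cpoint c) 0 t = ennreal t"
  proof (rule antisym)
    show "length_on (cpoint c) 0 t \<le> ennreal t"
      unfolding length_on_def
    proof (rule SUP_least)
      fix D assume "D \<in> {D. D division_of {0..t}}"
      then have D: "D division_of {0..t}" by simp
      have "dist (cpoint c (Inf K)) (cpoint c (Sup K)) \<le> measure lborel K" if K: "K \<in> D" for K
      proof -
        obtain u v where uv: "K = {u..v}" using division_ofD(4)[OF D K] by (auto simp: box_real)
        have "K \<noteq> {}" "K \<subseteq> {0..t}" using division_ofD(2,3)[OF D K] by auto
        then have "u \<le> v" "0 \<le> u" "v \<le> clen c" using uv t by auto
        then show ?thesis using uv lipschitz_curveD[OF c, of u v] by simp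
      qed
      then have "(\<Sum>K\<in>D. dist (cpoint c (Inf K)) (cpoint c (Sup K))) \<le> (\<Sum>K\<in>D. measure lborel K)"
        by (rule sum_mono)
      also have "\<dots> = t" using additive_content_division[of D 0 t] D t by (simp add: box_real)
      finally show "ennreal (\<Sum>K\<in>D. dist (cpoint c (Inf K)) (cpoint c (Sup K))) \<le> ennreal t"
        by (rule ennreal_leI)
    qed
    obtain D where "D division_of {0..t}" "(\<Sum>K\<in>D. dist (cpoint c (Inf K)) (cpoint c (Sup K))) = t"
      using piecewise_geodesic_division[OF assms, of t] t by auto
    then show "ennreal t \<le> length_on (cpoint c) 0 t"
      unfolding length_on_def by (intro SUP_upper2[of D]) auto
  qed
qed

text \<open>The curve \<open>wind c k\<close> runs \<open>k + 1\<close> times around the closed curve \<open>c\<close>.\<close>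

primrec wind :: "'a curve \<Rightarrow> nat \<Rightarrow> 'a curve" where
  "wind c 0 = c"
| "wind c (Suc k) = concat_curve (wind c k) c"

lemma wind:
  assumes "piecewise_geodesic c" "closed_curve c"
  shows "piecewise_geodesic (wind c k) \<and> cstart (wind c k) = cstart c \<and> cend (wind c k) = cstart c \<and>
    clen (wind c k) = real (Suc k) * clen c"
proof (induction k)
  case 0
  then show ?case using assms by (simp add: closed_curve_def)
next
  case (Suc k)
  have nn: "0 \<le> clen c" "0 \<le> clen (wind c k)"
    using assms(1) Suc by (auto simp: lipschitz_curve_nonneg piecewise_geodesic_lipschitz)
  then show ?case
    using Suc assms by (simp add: piecewise_geodesic_concat cstart_concat cend_concat closed_curve_def algebra_simps)
qed

lemma curve_current_wind:
  assumes "piecewise_geodesic c" "closed_curve c" "f \<in> Lip_funs" "\<pi> \<in> Lip_funs"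
  shows "curve_current (wind c k) (f, \<pi>) = real (Suc k) * curve_current c (f, \<pi>)"
proof (induction k)
  case (Suc k)
  have "lipschitz_curve (wind c k)" "cend (wind c k) = cstart c"
    using wind[OF assms(1,2), of k] piecewise_geodesic_lipschitz by auto
  then show ?case
    using Suc curve_current_concat[OF _ piecewise_geodesic_lipschitz[OF assms(1)] _ assms(3,4)]
    by (simp add: algebra_simps)
qed simp

lemma arc_integral_wind:
  assumes "piecewise_geodesic c" "closed_curve c" "h \<in> Lip_funs"
  shows "arc_integral (wind c k) h = real (Suc k) * arc_integral c h"
proof (induction k)
  case (Suc k)
  have "lipschitz_curve (wind c k)" "cend (wind c k) = cstart c"
    using wind[OF assms(1,2), of k] piecewise_geodesic_lipschitz by auto
  then show ?case
    using Suc arc_integral_concat[OF _ piecewise_geodesic_lipschitz[OF assms(1)] _ assms(3)]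
    by (simp add: algebra_simps)
qed simp

section \<open>Functionals dominated by a finite measure\<close>

locale finite_borel_measure = finite_measure \<mu>
  for \<mu> :: "'a::polish_space measure" +
  assumes sets_borel [simp, measurable_cong]: "sets \<mu> = sets borel"
begin

lemma space_UNIV [simp]: "space \<mu> = UNIV"
  using sets_eq_imp_space_eq[OF sets_borel] by simp

lemma integrable_bounded:
  assumes "f \<in> borel_measurable borel" "\<And>x. \<bar>f x\<bar> \<le> (B :: real)"
  shows "integrable \<mu> f"
proof -
  have "f \<in> borel_measurable \<mu>" using assms(1) by measurable
  then show ?thesis by (intro integrable_const_bound[of _ B]) (use assms(2) in auto)
qed

lemma integrable_Lipb [simp]: assumes "f \<in> Lipb_funs" shows "integrable \<mu> f"
proof -
  obtain B where "\<And>x. \<bar>f x\<bar> \<le> B" using Lipb_bound[OF assms] by blast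
  then show ?thesis by (rule integrable_bounded[OF Lipb_measurable[OF assms]])
qed

lemma integrable_Lipb_diff:
  "f \<in> Lipb_funs \<Longrightarrow> integrable \<mu> u \<Longrightarrow> integrable \<mu> (\<lambda>x. \<bar>f x - u x\<bar>)"
  by (intro integrable_abs Bochner_Integration.integrable_diff) auto

lemma integrable_bounded_mult:
  fixes h :: "'a \<Rightarrow> real"
  assumes h: "h \<in> borel_measurable borel" "\<And>x. \<bar>h x\<bar> \<le> 1" and u: "integrable \<mu> u"
  shows "integrable \<mu> (\<lambda>x. u x * h x)"
proof (rule Bochner_Integration.integrable_bound[OF u])
  show "(\<lambda>x. u x * h x) \<in> borel_measurable \<mu>" using u h(1) by measurable
  show "AE x in \<mu>. norm (u x * h x) \<le> norm (u x)"
    using h(2) by (intro AE_I2) (simp add: abs_mult mult_left_le)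
qed

lemma integrable_indicator_real: "A \<in> sets borel \<Longrightarrow> integrable \<mu> (indicator A :: 'a \<Rightarrow> real)"
  by (simp add: emeasure_finite less_top[symmetric])

lemma L1_triangle:
  fixes u v w :: "'a \<Rightarrow> real"
  assumes "integrable \<mu> u" "integrable \<mu> v" "integrable \<mu> w"
  shows "(LINT x|\<mu>. \<bar>u x - w x\<bar>) \<le> (LINT x|\<mu>. \<bar>u x - v x\<bar>) + (LINT x|\<mu>. \<bar>v x - w x\<bar>)"
proof -
  have i: "integrable \<mu> (\<lambda>x. \<bar>u x - v x\<bar>)" "integrable \<mu> (\<lambda>x. \<bar>v x - w x\<bar>)" "integrable \<mu> (\<lambda>x. \<bar>u x - w x\<bar>)"
    using assms by (auto intro!: integrable_abs Bochner_Integration.integrable_diff)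
  have "(LINT x|\<mu>. \<bar>u x - w x\<bar>) \<le> (LINT x|\<mu>. \<bar>u x - v x\<bar> + \<bar>v x - w x\<bar>)"
    by (intro integral_mono Bochner_Integration.integrable_add i) auto
  then show ?thesis by (simp only: Bochner_Integration.integral_add[OF i(1,2)])
qed

lemma L1_add:
  fixes f g u v :: "'a \<Rightarrow> real"
  assumes "integrable \<mu> f" "integrable \<mu> g" "integrable \<mu> u" "integrable \<mu> v"
  shows "(LINT x|\<mu>. \<bar>(f x + g x) - (u x + v x)\<bar>) \<le> (LINT x|\<mu>. \<bar>f x - u x\<bar>) + (LINT x|\<mu>. \<bar>g x - v x\<bar>)"
proof -
  have i: "integrable \<mu> (\<lambda>x. \<bar>f x - u x\<bar>)" "integrable \<mu> (\<lambda>x. \<bar>g x - v x\<bar>)"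
    using assms by (auto intro!: integrable_abs Bochner_Integration.integrable_diff)
  have "(LINT x|\<mu>. \<bar>(f x + g x) - (u x + v x)\<bar>) \<le> (LINT x|\<mu>. \<bar>f x - u x\<bar> + \<bar>g x - v x\<bar>)"
    by (intro integral_mono integrable_abs Bochner_Integration.integrable_diff
        Bochner_Integration.integrable_add i assms) auto
  then show ?thesis by (simp only: Bochner_Integration.integral_add[OF i])
qed

lemma L1_limit:
  fixes u :: "'a \<Rightarrow> real"
  assumes s: "\<And>i. integrable \<mu> (s i)" and u: "integrable \<mu> u"
    and lim: "\<And>x. (\<lambda>i. s i x) \<longlonglongrightarrow> u x" and le: "\<And>i x. \<bar>s i x\<bar> \<le> 2 * \<bar>u x\<bar>"
  shows "(\<lambda>i. LINT x|\<mu>. \<bar>s i x - u x\<bar>) \<longlonglongrightarrow> 0"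
proof -
  have "(\<lambda>i. LINT x|\<mu>. \<bar>s i x - u x\<bar>) \<longlonglongrightarrow> (LINT x|\<mu>. 0)"
  proof (rule integral_dominated_convergence[where w = "\<lambda>x. 3 * \<bar>u x\<bar>"])
    show "AE x in \<mu>. (\<lambda>i. \<bar>s i x - u x\<bar>) \<longlonglongrightarrow> 0"
      by (intro AE_I2 tendsto_rabs_zero LIM_zero lim)
    show "AE x in \<mu>. norm \<bar>s i x - u x\<bar> \<le> 3 * \<bar>u x\<bar>" for i
    proof (rule AE_I2)
      fix x show "norm \<bar>s i x - u x\<bar> \<le> 3 * \<bar>u x\<bar>" using le[of i x] by simp
    qed
  qed (use s u in \<open>auto intro!: borel_measurable_integrable\<close>)
  then show ?thesis by simp
qed

text \<open>The cutoffs \<open>1 - n d(x, K)\<close> decrease to the indicator of \<open>K\<close>, because \<open>K\<close> is closed.\<close>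

lemma compact_cutoff:
  assumes "compact K" "K \<noteq> {}"
  shows "(\<lambda>n. LINT x|\<mu>. \<bar>max 0 (1 - real n * infdist x K) - indicator K x\<bar>) \<longlonglongrightarrow> 0"
proof -
  have cl: "closed K" using assms(1) by (rule compact_imp_closed)
  have [measurable]: "K \<in> sets borel" using cl by simp
  have [measurable]: "(\<lambda>x. infdist x K) \<in> borel_measurable borel"
    by (intro borel_measurable_continuous_onI continuous_intros)
  have "(\<lambda>n. LINT x|\<mu>. \<bar>max 0 (1 - real n * infdist x K) - indicator K x\<bar>) \<longlonglongrightarrow> (LINT x|\<mu>. 0)"
  proof (rule integral_dominated_convergence[where w = "\<lambda>_. 1"])
    show "AE x in \<mu>. (\<lambda>n. \<bar>max 0 (1 - real n * infdist x K) - indicator K x\<bar>) \<longlonglongrightarrow> 0"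
    proof (rule AE_I2)
      fix x
      show "(\<lambda>n. \<bar>max 0 (1 - real n * infdist x K) - indicator K x\<bar>) \<longlonglongrightarrow> 0"
      proof (cases "x \<in> K")
        case False
        then have "0 < infdist x K"
          using in_closed_iff_infdist_zero[OF cl assms(2)] infdist_nonneg[of x K] by force
        then obtain N where N: "1 < real N * infdist x K" using reals_Archimedean3 by blast
        have "\<bar>max 0 (1 - real n * infdist x K) - indicator K x\<bar> = 0" if "N \<le> n" for n
        proof -
          have "real N * infdist x K \<le> real n * infdist x K"
            using that infdist_nonneg[of x K] by (intro mult_right_mono) auto
          then show ?thesis using N False by simp
        qed
        then show ?thesis by (intro tendsto_eventually eventually_sequentiallyI)
      qed simp
    qed
    show "AE x in \<mu>. norm \<bar>max 0 (1 - real n * infdist x K) - indicator K x\<bar> \<le> 1" for n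
      by (rule AE_I2) (auto simp: indicator_def infdist_nonneg)
    show "(\<lambda>x. \<bar>max 0 (1 - real n * infdist x K) - indicator K x\<bar>) \<in> borel_measurable \<mu>" for n
      by measurable
  qed simp_all
  then show ?thesis by simp
qed

end

lemma infdist_cutoff_Lipb: "(\<lambda>x. max 0 (1 - real n * infdist x K)) \<in> Lipb_funs"
proof (rule LipbI[of _ 1])
  have "(\<lambda>x. infdist x K) \<in> Lip_funs"
    by (rule Lip_funsI[of _ 1]) (simp add: infdist_triangle_abs)
  then have "(\<lambda>x. 1 + (- real n) * infdist x K) \<in> Lip_funs" by (intro Lip_add Lip_cmult) auto
  then have "(\<lambda>x. max 0 (1 + (- real n) * infdist x K)) \<in> Lip_funs" by (intro Lip_max) auto
  then show "(\<lambda>x. max 0 (1 - real n * infdist x K)) \<in> Lip_funs" by simp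
qed (simp add: infdist_nonneg)

text \<open>
  The approximation is made for two measures at once, so that bounds by different measures can be
  compared: \<open>K1\<close> exhausts \<open>A\<close> up to \<open>e / 2\<close> for \<open>\<mu>\<close> and \<open>K2\<close> does so for \<open>\<nu>\<close>, hence their union for both.
\<close>

lemma indicator_approx:
  fixes \<mu> \<nu> :: "'a::polish_space measure"
  assumes "finite_borel_measure \<mu>" "finite_borel_measure \<nu>" and A: "A \<in> sets borel" and "0 < e"
  obtains f where "f \<in> Lipb_funs" "\<And>x. 0 \<le> f x" "\<And>x. f x \<le> 1"
    "(LINT x|\<mu>. \<bar>f x - indicator A x\<bar>) < e" "(LINT x|\<nu>. \<bar>f x - indicator A x\<bar>) < e"
proof -
  interpret \<mu>: finite_borel_measure \<mu> by fact
  interpret \<nu>: finite_borel_measure \<nu> by fact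
  have inner: "\<exists>K. compact K \<and> K \<subseteq> A \<and> measure M A < measure M K + e / 2"
    if "finite_borel_measure M" for M :: "'a measure"
  proof -
    interpret M: finite_borel_measure M by fact
    show ?thesis
    proof (cases "measure M A = 0")
      case True
      then show ?thesis using \<open>0 < e\<close> by (intro exI[of _ "{}"]) simp
    next
      case False
      have pos: "0 < measure M A" using False by (simp add: zero_less_measure_iff)
      have "ennreal (measure M A - e / 2) < ennreal (measure M A)"
        using pos \<open>0 < e\<close> by (intro ennreal_lessI) auto
      also have "ennreal (measure M A) = (SUP K \<in> {K. K \<subseteq> A \<and> compact K}. emeasure M K)"
        using inner_regular[of M A] A M.emeasure_finite by (simp add: M.emeasure_eq_measure)
      finally obtain K where K: "K \<subseteq> A" "compact K" "ennreal (measure M A - e / 2) < emeasure M K"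
        by (auto simp: less_SUP_iff)
      then have "measure M A - e / 2 < measure M K"
        by (simp add: M.emeasure_eq_measure ennreal_less_iff) 
          (meson ennreal_leI leD not_le_imp_less)
      then show ?thesis using K by (intro exI[of _ K]) auto
    qed
  qed
  obtain K1 where K1: "compact K1" "K1 \<subseteq> A" "measure \<mu> A < measure \<mu> K1 + e / 2"
    using inner[OF assms(1)] by blast
  obtain K2 where K2: "compact K2" "K2 \<subseteq> A" "measure \<nu> A < measure \<nu> K2 + e / 2"
    using inner[OF assms(2)] by blast
  define K where "K = K1 \<union> K2"
  have K: "compact K" "K \<subseteq> A" using K1 K2 by (auto simp: K_def)
  have Kb [measurable]: "K1 \<in> sets borel" "K2 \<in> sets borel" "K \<in> sets borel" 
    using K1 K2 K by (simp_all add: borel_compact)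
  note A [measurable]
  have close: "(LINT x|M. \<bar>indicator K x - indicator A x\<bar>) < e / 2"
    if M: "finite_borel_measure M" and le: "measure M A < measure M K' + e / 2" and "K' \<subseteq> K"
      and "K' \<in> sets borel"
    for M :: "'a measure" and K'
  proof -
    interpret M: finite_borel_measure M by fact
    have "\<bar>indicator K x - indicator A x :: real\<bar> = indicator (A - K) x" for x
      using K(2) by (auto simp: indicator_def)
    then have "(LINT x|M. \<bar>indicator K x - indicator A x\<bar>) = measure M (A - K)" by simp
    also have "\<dots> = measure M A - measure M K"
      using K(2) by (intro M.finite_measure_Diff) auto
    finally have "(LINT x|M. \<bar>indicator K x - indicator A x\<bar>) = measure M A - measure M K" .
    moreover have "measure M K' \<le> measure M K"
      using \<open>K' \<subseteq> K\<close> by (intro M.finite_measure_mono) auto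
    ultimately show ?thesis using le by linarith
  qed
  show thesis
  proof (cases "K = {}")
    case True
    show ?thesis
    proof (rule that[of "\<lambda>_. 0"])
      show "(LINT x|\<mu>. \<bar>0 - indicator A x\<bar>) < e"
        using close[OF assms(1) K1(3)] True \<open>0 < e\<close> by (simp add: K_def)
      show "(LINT x|\<nu>. \<bar>0 - indicator A x\<bar>) < e"
        using close[OF assms(2) K2(3)] True \<open>0 < e\<close> by (simp add: K_def)
    qed auto
  next
    case False
    let ?f = "\<lambda>n x. max 0 (1 - real n * infdist x K)"
    have "\<forall>\<^sub>F n in sequentially. (LINT x|\<mu>. \<bar>?f n x - indicator K x\<bar>) < e / 2"
      by (rule order_tendstoD[OF \<mu>.compact_cutoff[OF K(1) False]]) (use \<open>0 < e\<close> in simp)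
    moreover have "\<forall>\<^sub>F n in sequentially. (LINT x|\<nu>. \<bar>?f n x - indicator K x\<bar>) < e / 2"
      by (rule order_tendstoD[OF \<nu>.compact_cutoff[OF K(1) False]]) (use \<open>0 < e\<close> in simp)
    ultimately have "\<forall>\<^sub>F n in sequentially. (LINT x|\<mu>. \<bar>?f n x - indicator K x\<bar>) < e / 2 \<and>
        (LINT x|\<nu>. \<bar>?f n x - indicator K x\<bar>) < e / 2" by (rule eventually_conj)
    then obtain n where n: "(LINT x|\<mu>. \<bar>?f n x - indicator K x\<bar>) < e / 2"
      "(LINT x|\<nu>. \<bar>?f n x - indicator K x\<bar>) < e / 2"
      by (auto simp: eventually_sequentially)
    have sum: "(LINT x|M. \<bar>?f n x - indicator A x\<bar>) < e"
      if M: "finite_borel_measure M" and a: "(LINT x|M. \<bar>?f n x - indicator K x\<bar>) < e / 2"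
        and b: "(LINT x|M. \<bar>indicator K x - indicator A x\<bar>) < e / 2" for M :: "'a measure"
    proof -
      interpret M: finite_borel_measure M by fact
      have i: "integrable M (indicator K :: 'a \<Rightarrow> real)" "integrable M (indicator A :: 'a \<Rightarrow> real)"
        by (simp_all add: M.emeasure_finite less_top[symmetric])
      show ?thesis
        using M.L1_triangle[OF M.integrable_Lipb[OF infdist_cutoff_Lipb[of n K]] i] a b by linarith
    qed
    show ?thesis
    proof (rule that[of "?f n"])
      show "(LINT x|\<mu>. \<bar>?f n x - indicator A x\<bar>) < e"
        by (rule sum[OF assms(1) n(1) close[OF assms(1) K1(3)]]) (auto simp: K_def)
      show "(LINT x|\<nu>. \<bar>?f n x - indicator A x\<bar>) < e"
        by (rule sum[OF assms(2) n(2) close[OF assms(2) K2(3)]]) (auto simp: K_def)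
    qed (simp_all add: infdist_cutoff_Lipb infdist_nonneg)
  qed
qed

context finite_borel_measure
begin

lemma fbm: "finite_borel_measure \<mu>" by unfold_locales

lemma Lipb_dense:
  assumes "integrable \<mu> u" "0 < e"
  shows "\<exists>f\<in>Lipb_funs. (LINT x|\<mu>. \<bar>f x - u x\<bar>) < e"
  using assms
proof (induction arbitrary: e rule: integrable_induct)
  case (base A c)
  obtain f where f: "f \<in> Lipb_funs" "(LINT x|\<mu>. \<bar>f x - indicator A x\<bar>) < e / (\<bar>c\<bar> + 1)"
  proof -
    have "A \<in> sets borel" "0 < e / (\<bar>c\<bar> + 1)" using base by auto
    from indicator_approx[OF fbm fbm this] show ?thesis using that by metis
  qed
  have "(LINT x|\<mu>. \<bar>c * f x - indicator A x *\<^sub>R c\<bar>) = (LINT x|\<mu>. \<bar>c\<bar> * \<bar>f x - indicator A x\<bar>)"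
    by (intro Bochner_Integration.integral_cong refl) (simp add: abs_mult[symmetric] algebra_simps)
  also have "\<dots> = \<bar>c\<bar> * (LINT x|\<mu>. \<bar>f x - indicator A x\<bar>)" by simp
  also have "\<dots> \<le> \<bar>c\<bar> * (e / (\<bar>c\<bar> + 1))" using f by (intro mult_left_mono) auto
  also have "\<dots> < e" using base by (simp add: field_simps)
  finally show ?case using Lipb_cmult[OF f(1), of c] by (intro bexI[of _ "\<lambda>x. c * f x"])
next
  case (add u v)
  obtain f where f: "f \<in> Lipb_funs" "(LINT x|\<mu>. \<bar>f x - u x\<bar>) < e / 2"
    using add.IH(1)[of "e / 2"] add.prems by auto
  obtain g where g: "g \<in> Lipb_funs" "(LINT x|\<mu>. \<bar>g x - v x\<bar>) < e / 2"
    using add.IH(2)[of "e / 2"] add.prems by auto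
  have "(LINT x|\<mu>. \<bar>(f x + g x) - (u x + v x)\<bar>) < e"
    using L1_add[OF integrable_Lipb[OF f(1)] integrable_Lipb[OF g(1)] add.hyps] f(2) g(2) by linarith
  then show ?case using Lipb_add[OF f(1) g(1)] by (intro bexI[of _ "\<lambda>x. f x + g x"])
next
  case (lim u s)
  have "(\<lambda>i. LINT x|\<mu>. \<bar>s i x - u x\<bar>) \<longlonglongrightarrow> 0"
    by (rule L1_limit) (use lim.hyps in auto)
  then have "\<forall>\<^sub>F i in sequentially. (LINT x|\<mu>. \<bar>s i x - u x\<bar>) < e / 2"
    by (rule order_tendstoD) (use lim.prems in simp)
  then obtain i where i: "(LINT x|\<mu>. \<bar>s i x - u x\<bar>) < e / 2"
    by (auto simp: eventually_sequentially)
  obtain f where f: "f \<in> Lipb_funs" "(LINT x|\<mu>. \<bar>f x - s i x\<bar>) < e / 2"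
    using lim.IH[of "e / 2" i] lim.prems by auto
  have "(LINT x|\<mu>. \<bar>f x - u x\<bar>) < e"
    using L1_triangle[OF integrable_Lipb[OF f(1)] lim.hyps(1,4), of i] f(2) i by linarith
  then show ?case using f by blast
qed

text \<open>The set on which the inequality fails is itself one of the sets \<open>A\<close>.\<close>

lemma AE_le_if_integrals_le:
  fixes f g :: "'a \<Rightarrow> real"
  assumes int: "integrable \<mu> f" "integrable \<mu> g"
    and le: "\<And>A. A \<in> sets borel \<Longrightarrow> (LINT x|\<mu>. indicator A x * f x) \<le> (LINT x|\<mu>. indicator A x * g x)"
  shows "AE x in \<mu>. f x \<le> g x"
proof -
  have [measurable]: "f \<in> borel_measurable borel" "g \<in> borel_measurable borel"
    using borel_measurable_integrable[OF int(1)] borel_measurable_integrable[OF int(2)] by auto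
  define A where "A = {x. g x < f x}"
  have A [measurable]: "A \<in> sets borel" unfolding A_def by measurable
  have ii: "integrable \<mu> (\<lambda>x. indicator A x * f x)" "integrable \<mu> (\<lambda>x. indicator A x * g x)"
    using integrable_mult_indicator[of A \<mu> f] integrable_mult_indicator[of A \<mu> g] int by auto
  have i: "integrable \<mu> (\<lambda>x. indicator A x * f x - indicator A x * g x)"
    using ii by (rule Bochner_Integration.integrable_diff)
  have nn: "0 \<le> indicator A x * f x - indicator A x * g x" for x
    by (auto simp: A_def indicator_def)
  have "(LINT x|\<mu>. indicator A x * f x - indicator A x * g x) \<le> 0"
    using le[OF A] by (simp add: Bochner_Integration.integral_diff[OF ii])
  moreover have "0 \<le> (LINT x|\<mu>. indicator A x * f x - indicator A x * g x)"
    by (rule Bochner_Integration.integral_nonneg) (rule nn)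
  ultimately have "AE x in \<mu>. indicator A x * f x - indicator A x * g x = 0"
    using integral_nonneg_eq_0_iff_AE[OF i] nn by simp
  then show ?thesis
    by eventually_elim (auto simp: A_def indicator_def split: if_splits)
qed

end

text \<open>
  A functional on bounded Lipschitz functions that is dominated by the \<open>L\<close>-one seminorm of a finite
  measure extends to integrable functions; after adding \<open>\<mu>\<close> the extension becomes a measure on
  Borel sets, whose Radon-Nikodym density represents the functional.
\<close>

locale dominated_functional = finite_borel_measure \<mu>
  for \<mu> :: "'a::polish_space measure" +
  fixes \<Lambda> :: "('a \<Rightarrow> real) \<Rightarrow> real"
  assumes linear: "f \<in> Lipb_funs \<Longrightarrow> g \<in> Lipb_funs \<Longrightarrow>
      \<Lambda> (\<lambda>x. a * f x + b * g x) = a * \<Lambda> f + b * \<Lambda> g"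
    and dominated: "f \<in> Lipb_funs \<Longrightarrow> \<bar>\<Lambda> f\<bar> \<le> (LINT x|\<mu>. \<bar>f x\<bar>)"
begin

text \<open>
  The extension at \<open>u\<close> must lie between \<open>\<Lambda> g - \<parallel>g - u\<parallel>\<close> and \<open>\<Lambda> h + \<parallel>h - u\<parallel>\<close> for all bounded Lipschitz
  \<open>g\<close> and \<open>h\<close>. All these lower bounds are below all upper bounds, so their supremum is a value that
  satisfies both; by density it is the only one.
\<close>

definition ext :: "('a \<Rightarrow> real) \<Rightarrow> real" where
  "ext u = (SUP f\<in>Lipb_funs. \<Lambda> f - (LINT x|\<mu>. \<bar>f x - u x\<bar>))"

lemma ext_near:
  assumes u: "integrable \<mu> u" and f: "f \<in> Lipb_funs"
  shows "\<bar>\<Lambda> f - ext u\<bar> \<le> (LINT x|\<mu>. \<bar>f x - u x\<bar>)"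
proof -
  have key: "\<Lambda> g - (LINT x|\<mu>. \<bar>g x - u x\<bar>) \<le> \<Lambda> h + (LINT x|\<mu>. \<bar>h x - u x\<bar>)"
    if g: "g \<in> Lipb_funs" and h: "h \<in> Lipb_funs" for g h
  proof -
    have "\<Lambda> g - \<Lambda> h = \<Lambda> (\<lambda>x. 1 * g x + (- 1) * h x)" using linear[OF g h, of 1 "- 1"] by simp
    also have "\<dots> \<le> (LINT x|\<mu>. \<bar>1 * g x + (- 1) * h x\<bar>)"
      using dominated[OF Lipb_add[OF Lipb_cmult[OF g, of 1] Lipb_cmult[OF h, of "- 1"]]] by linarith
    also have "\<dots> \<le> (LINT x|\<mu>. \<bar>g x - u x\<bar> + \<bar>h x - u x\<bar>)"
    proof (rule integral_mono)
      show "integrable \<mu> (\<lambda>x. \<bar>1 * g x + (- 1) * h x\<bar>)"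
        using integrable_Lipb_diff[OF g integrable_Lipb[OF h]] by simp
    qed (intro Bochner_Integration.integrable_add integrable_Lipb_diff g h u, simp)
    also have "\<dots> = (LINT x|\<mu>. \<bar>g x - u x\<bar>) + (LINT x|\<mu>. \<bar>h x - u x\<bar>)"
      by (intro Bochner_Integration.integral_add integrable_Lipb_diff g h u)
    finally show ?thesis by linarith
  qed
  have "ext u \<le> \<Lambda> f + (LINT x|\<mu>. \<bar>f x - u x\<bar>)"
    unfolding ext_def by (rule cSUP_least) (use key f in auto)
  moreover have "\<Lambda> f - (LINT x|\<mu>. \<bar>f x - u x\<bar>) \<le> ext u"
    unfolding ext_def
    by (rule cSUP_upper[OF f]) (rule bdd_aboveI2[where M = "\<Lambda> f + (LINT x|\<mu>. \<bar>f x - u x\<bar>)"], rule key[OF _ f])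
  ultimately show ?thesis by linarith
qed

lemma ext_Lipb: "f \<in> Lipb_funs \<Longrightarrow> ext f = \<Lambda> f"
  using ext_near[of f f] by simp

lemma ext_close:
  assumes u: "integrable \<mu> u" and v: "integrable \<mu> v"
  shows "\<bar>ext u - ext v\<bar> \<le> (LINT x|\<mu>. \<bar>u x - v x\<bar>)"
proof (rule field_le_epsilon)
  fix e :: real assume "0 < e"
  obtain f where f: "f \<in> Lipb_funs" "(LINT x|\<mu>. \<bar>f x - u x\<bar>) < e / 2"
    using Lipb_dense[OF u, of "e / 2"] \<open>0 < e\<close> by auto
  show "\<bar>ext u - ext v\<bar> \<le> (LINT x|\<mu>. \<bar>u x - v x\<bar>) + e"
    using ext_near[OF u f(1)] ext_near[OF v f(1)] f(2) L1_triangle[OF integrable_Lipb[OF f(1)] u v]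
    by linarith
qed

lemma ext_add:
  assumes u: "integrable \<mu> u" and v: "integrable \<mu> v"
  shows "ext (\<lambda>x. u x + v x) = ext u + ext v"
proof -
  have "\<bar>ext (\<lambda>x. u x + v x) - (ext u + ext v)\<bar> \<le> e" if "0 < e" for e :: real
  proof -
    obtain f where f: "f \<in> Lipb_funs" "(LINT x|\<mu>. \<bar>f x - u x\<bar>) < e / 4"
      using Lipb_dense[OF u, of "e / 4"] \<open>0 < e\<close> by auto
    obtain g where g: "g \<in> Lipb_funs" "(LINT x|\<mu>. \<bar>g x - v x\<bar>) < e / 4"
      using Lipb_dense[OF v, of "e / 4"] \<open>0 < e\<close> by auto
    have "(LINT x|\<mu>. \<bar>(f x + g x) - (u x + v x)\<bar>) < e / 2"
      using L1_add[OF integrable_Lipb[OF f(1)] integrable_Lipb[OF g(1)] u v] f(2) g(2) by linarith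
    then have "\<bar>\<Lambda> (\<lambda>x. f x + g x) - ext (\<lambda>x. u x + v x)\<bar> \<le> e / 2"
      using ext_near[OF Bochner_Integration.integrable_add[OF u v] Lipb_add[OF f(1) g(1)]] by simp
    moreover have "\<Lambda> (\<lambda>x. f x + g x) = \<Lambda> f + \<Lambda> g" using linear[OF f(1) g(1), of 1 1] by simp
    ultimately show ?thesis
      using ext_near[OF u f(1)] ext_near[OF v g(1)] f(2) g(2) by linarith
  qed
  then have "\<bar>ext (\<lambda>x. u x + v x) - (ext u + ext v)\<bar> \<le> 0"
    by (rule field_le_epsilon) auto
  then show ?thesis by simp
qed

lemma ext_cmult:
  assumes u: "integrable \<mu> u"
  shows "ext (\<lambda>x. c * u x) = c * ext u"
proof -
  have "\<bar>ext (\<lambda>x. c * u x) - c * ext u\<bar> \<le> e" if "0 < e" for e :: real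
  proof -
    define d where "d = e / (2 * (\<bar>c\<bar> + 1))"
    have "0 < d" using that by (simp add: d_def)
    then obtain f where f: "f \<in> Lipb_funs" "(LINT x|\<mu>. \<bar>f x - u x\<bar>) < d"
      using Lipb_dense[OF u] by auto
    have "(LINT x|\<mu>. \<bar>c * f x - c * u x\<bar>) = \<bar>c\<bar> * (LINT x|\<mu>. \<bar>f x - u x\<bar>)"
      by (simp add: abs_mult flip: right_diff_distrib)
    then have 1: "\<bar>\<Lambda> (\<lambda>x. c * f x) - ext (\<lambda>x. c * u x)\<bar> \<le> \<bar>c\<bar> * (LINT x|\<mu>. \<bar>f x - u x\<bar>)"
      using ext_near[OF integrable_mult_right[OF u, of c] Lipb_cmult[OF f(1), of c]] by simp
    have 2: "\<Lambda> (\<lambda>x. c * f x) = c * \<Lambda> f" using linear[OF f(1) f(1), of c 0] by simp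
    have 3: "\<bar>c * \<Lambda> f - c * ext u\<bar> \<le> \<bar>c\<bar> * (LINT x|\<mu>. \<bar>f x - u x\<bar>)"
      using ext_near[OF u f(1)] by (simp add: abs_mult mult_left_mono flip: right_diff_distrib)
    have 4: "\<bar>c\<bar> * (LINT x|\<mu>. \<bar>f x - u x\<bar>) \<le> \<bar>c\<bar> * d" using f(2) by (intro mult_left_mono) auto
    have 5: "2 * (\<bar>c\<bar> * d) \<le> e" using that by (simp add: d_def field_simps)
    show ?thesis using 1 2 3 4 5 by linarith
  qed
  then have "\<bar>ext (\<lambda>x. c * u x) - c * ext u\<bar> \<le> 0"
    by (rule field_le_epsilon) auto
  then show ?thesis by simp
qed

lemma ext_0: "ext (\<lambda>_. 0) = 0" "ext (indicator {}) = 0"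
proof -
  show "ext (\<lambda>_. 0) = 0" using ext_cmult[of "\<lambda>_. 0" 0] by simp
  moreover have "(indicator {} :: 'a \<Rightarrow> real) = (\<lambda>_. 0)" by (simp add: fun_eq_iff)
  ultimately show "ext (indicator {}) = 0" by simp
qed

lemma ext_bound: "integrable \<mu> u \<Longrightarrow> \<bar>ext u\<bar> \<le> (LINT x|\<mu>. \<bar>u x\<bar>)"
  using ext_close[of u "\<lambda>_. 0"] by (simp add: ext_0)

text \<open>Adding \<open>\<mu>\<close> makes the set function nonnegative.\<close>

definition shifted :: "'a measure" where
  "shifted = measure_of UNIV (sets borel) (\<lambda>A. ennreal (ext (indicator A) + measure \<mu> A))"

lemma shifted_nonneg: "A \<in> sets borel \<Longrightarrow> 0 \<le> ext (indicator A) + measure \<mu> A"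
  using ext_bound[OF integrable_indicator_real, of A] by (simp add: abs_le_iff)

lemma sets_shifted: "sets shifted = sets borel"
  using sets.sigma_sets_eq[of "borel :: 'a measure"] sets.space_closed[of "borel :: 'a measure"]
  by (simp add: shifted_def sets_measure_of_conv)

lemma emeasure_shifted:
  assumes A: "A \<in> sets borel"
  shows "emeasure shifted A = ennreal (ext (indicator A) + measure \<mu> A)"
  unfolding shifted_def
proof (rule emeasure_measure_of_sigma[where \<mu> = "\<lambda>A. ennreal (ext (indicator A) + measure \<mu> A)"])
  show "sigma_algebra UNIV (sets (borel :: 'a measure))"
    using sets.sigma_algebra_axioms[of "borel :: 'a measure"] by simp
  show "positive (sets borel) (\<lambda>A. ennreal (ext (indicator A) + measure \<mu> A))"
    by (simp add: positive_def ext_0)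
  show "countably_additive (sets borel) (\<lambda>A. ennreal (ext (indicator A) + measure \<mu> A))"
  proof (rule countably_additiveI)
    fix A :: "nat \<Rightarrow> 'a set"
    assume A: "range A \<subseteq> sets borel" "disjoint_family A" "(\<Union>i. A i) \<in> sets borel"
    have Ai: "A i \<in> sets borel" for i using A(1) by auto
    have fin: "ext (indicator (\<Union>i<n. A i)) = (\<Sum>i<n. ext (indicator (A i)))" for n
    proof (induction n)
      case (Suc n)
      have dis: "x \<notin> A i" if "x \<in> A n" "i < n" for x i
        using disjoint_family_onD[OF A(2), of i n] that by auto
      have "(indicator (\<Union>i<Suc n. A i) :: 'a \<Rightarrow> real) = (\<lambda>x. indicator (\<Union>i<n. A i) x + indicator (A n) x)"
      proof
        fix x
        show "indicator (\<Union>i<Suc n. A i) x = (indicator (\<Union>i<n. A i) x + indicator (A n) x :: real)"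
        proof (cases "x \<in> A n")
          case True
          then have "x \<notin> (\<Union>i<n. A i)" using dis by blast
          then show ?thesis using True by (simp add: lessThan_Suc)
        next
          case False
          then show ?thesis by (simp add: lessThan_Suc indicator_def)
        qed
      qed
      then show ?case using Suc Ai by (simp add: ext_add integrable_indicator_real)
    qed (simp add: ext_0)
    have m: "(\<lambda>i. measure \<mu> (A i)) sums measure \<mu> (\<Union>i. A i)"
      using A by (intro finite_measure_UNION) auto
    have mfin: "measure \<mu> (\<Union>i<n. A i) = (\<Sum>i<n. measure \<mu> (A i))" for n
      using A(2) Ai by (intro finite_measure_finite_Union) (auto intro: disjoint_family_on_mono)
    have "(\<lambda>i. ext (indicator (A i))) sums ext (indicator (\<Union>i. A i))"
      unfolding sums_def fin[symmetric]
    proof (rule Lim_null[THEN iffD2], rule Lim_null_comparison)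
      have "measure \<mu> (\<Union>i. A i) - (\<Sum>i<n. measure \<mu> (A i)) = (LINT x|\<mu>. \<bar>indicator (\<Union>i<n. A i) x - indicator (\<Union>i. A i) x\<bar>)" for n
      proof -
        have "(LINT x|\<mu>. \<bar>indicator (\<Union>i<n. A i) x - indicator (\<Union>i. A i) x :: real\<bar>) = (LINT x|\<mu>. indicator ((\<Union>i. A i) - (\<Union>i<n. A i)) x)"
          by (intro Bochner_Integration.integral_cong) (auto simp: indicator_def)
        also have "\<dots> = measure \<mu> ((\<Union>i. A i) - (\<Union>i<n. A i))"
          using A(3) Ai by simp
        also have "\<dots> = measure \<mu> (\<Union>i. A i) - measure \<mu> (\<Union>i<n. A i)"
          using A(3) Ai by (intro finite_measure_Diff) auto
        finally show ?thesis by (simp add: mfin)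
      qed
      then have "norm (ext (indicator (\<Union>i<n. A i)) - ext (indicator (\<Union>i. A i)))
          \<le> measure \<mu> (\<Union>i. A i) - (\<Sum>i<n. measure \<mu> (A i))" for n
        using ext_close[OF integrable_indicator_real integrable_indicator_real, of "\<Union>i<n. A i" "\<Union>i. A i"] A(3) Ai by simp
      then show "\<forall>\<^sub>F n in sequentially. norm (ext (indicator (\<Union>i<n. A i)) - ext (indicator (\<Union>i. A i)))
          \<le> measure \<mu> (\<Union>i. A i) - (\<Sum>i<n. measure \<mu> (A i))" by simp
      have partial: "(\<lambda>n. \<Sum>i<n. measure \<mu> (A i)) \<longlonglongrightarrow> measure \<mu> (\<Union>i. A i)" using m by (simp add: sums_def)
      then show "(\<lambda>n. measure \<mu> (\<Union>i. A i) - (\<Sum>i<n. measure \<mu> (A i))) \<longlonglongrightarrow> 0"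
        using tendsto_diff[OF tendsto_const partial, of "measure \<mu> (\<Union>i. A i)"] by simp
    qed
    from sums_add[OF this m]
    show "(\<Sum>i. ennreal (ext (indicator (A i)) + measure \<mu> (A i)))
      = ennreal (ext (indicator (\<Union>i. A i)) + measure \<mu> (\<Union>i. A i))"
      using shifted_nonneg[OF Ai] by (intro suminf_ennreal_eq)
  qed
qed (rule A)

theorem density_exists:
  obtains g where "g \<in> borel_measurable borel" "\<And>x. \<bar>g x\<bar> \<le> 1"
    "\<And>f. f \<in> Lipb_funs \<Longrightarrow> \<Lambda> f = (LINT x|\<mu>. f x * g x)"
proof -
  have [simp]: "space shifted = UNIV"
    using sets_eq_imp_space_eq[OF sets_shifted] by simp
  have fin: "finite_measure shifted"
    by (rule finite_measureI) (simp add: emeasure_shifted)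
  have ac: "absolutely_continuous \<mu> shifted"
    unfolding absolutely_continuous_def
  proof
    fix N assume "N \<in> null_sets \<mu>"
    then have N: "N \<in> sets borel" "measure \<mu> N = 0" by (auto simp: null_sets_def measure_def)
    then have "ext (indicator N) = 0" using ext_bound[OF integrable_indicator_real[OF N(1)]] by simp
    then show "N \<in> null_sets shifted"
      using N by (simp add: null_sets_def sets_shifted emeasure_shifted)
  qed
  obtain k where k: "k \<in> borel_measurable \<mu>" "density \<mu> k = shifted"
    using Radon_Nikodym_finite_measure[OF fin _ ac] sets_shifted by auto
  have nnk: "(\<integral>\<^sup>+x. k x * indicator A x \<partial>\<mu>) = ennreal (ext (indicator A) + measure \<mu> A)" if "A \<in> sets borel" for A
    using emeasure_density[OF k(1), of A] that k(2) by (simp add: emeasure_shifted)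
  have "(\<integral>\<^sup>+x. k x \<partial>\<mu>) \<noteq> \<infinity>" using nnk[of UNIV] by simp
  then have kfin: "AE x in \<mu>. k x \<noteq> \<infinity>" by (rule nn_integral_noteq_infinite[OF k(1)])
  define h where "h x = enn2real (k x)" for x
  have h [measurable]: "h \<in> borel_measurable borel"
    using k(1) unfolding h_def by measurable
  have hk: "AE x in \<mu>. ennreal (h x) = k x"
    using kfin by eventually_elim (simp add: h_def less_top)
  have hint: "integrable \<mu> h"
  proof (rule integrableI_nonneg)
    have "(\<integral>\<^sup>+x. ennreal (h x) \<partial>\<mu>) = (\<integral>\<^sup>+x. k x \<partial>\<mu>)" by (rule nn_integral_cong_AE[OF hk])
    then show "(\<integral>\<^sup>+x. ennreal (h x) \<partial>\<mu>) < \<infinity>" using nnk[of UNIV] by simp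
  qed (auto simp: h_def)
  have hA: "(LINT x|\<mu>. indicator A x * h x) = ext (indicator A) + measure \<mu> A" if A: "A \<in> sets borel" for A
  proof -
    have "(LINT x|\<mu>. indicator A x * h x) = enn2real (\<integral>\<^sup>+x. ennreal (indicator A x * h x) \<partial>\<mu>)"
    proof (rule integral_eq_nn_integral)
      show "(\<lambda>x. indicator A x * h x) \<in> borel_measurable \<mu>" using A by measurable
    qed (simp add: h_def)
    also have "(\<integral>\<^sup>+x. ennreal (indicator A x * h x) \<partial>\<mu>) = (\<integral>\<^sup>+x. k x * indicator A x \<partial>\<mu>)"
      by (rule nn_integral_cong_AE) (use hk in eventually_elim, auto simp: indicator_def)
    finally show ?thesis using nnk[OF A] shifted_nonneg[OF A] by simp
  qed
  define g0 where "g0 x = h x - 1" for x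
  have g0 [measurable]: "g0 \<in> borel_measurable borel" unfolding g0_def by measurable
  have g0int: "integrable \<mu> g0" unfolding g0_def using hint by simp
  have g0A: "(LINT x|\<mu>. indicator A x * g0 x) = ext (indicator A)" if A: "A \<in> sets borel" for A
  proof -
    have "integrable \<mu> (\<lambda>x. indicator A x * h x)"
      using integrable_mult_indicator[of A \<mu> h] hint A by simp
    then show ?thesis
      using hA[OF A] A integrable_indicator_real[OF A] by (simp add: g0_def right_diff_distrib)
  qed
  have meas: "(LINT x|\<mu>. indicator A x * c) = c * measure \<mu> A" if "A \<in> sets borel" for A and c :: real
    using that by simp
  have ind_bound: "\<bar>ext (indicator A)\<bar> \<le> measure \<mu> A" if "A \<in> sets borel" for A
    using ext_bound[OF integrable_indicator_real[OF that]] that by simp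
  have "AE x in \<mu>. g0 x \<le> 1"
    by (rule AE_le_if_integrals_le[OF g0int]) (use g0A meas[of _ 1] ind_bound in \<open>auto simp: abs_le_iff\<close>)
  moreover have "AE x in \<mu>. - 1 \<le> g0 x"
  proof (rule AE_le_if_integrals_le[OF _ g0int])
    fix A :: "'a set" assume A: "A \<in> sets borel"
    show "(LINT x|\<mu>. indicator A x * - 1) \<le> (LINT x|\<mu>. indicator A x * g0 x)"
      using g0A[OF A] meas[OF A, of "- 1"] ind_bound[OF A] by (simp add: abs_le_iff)
  qed simp
  ultimately have bound: "AE x in \<mu>. max (- 1) (min 1 (g0 x)) = g0 x"
    by eventually_elim auto
  define g where "g x = max (- 1) (min 1 (g0 x))" for x
  have g [measurable]: "g \<in> borel_measurable borel" unfolding g_def by measurable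
  have gb: "\<bar>g x\<bar> \<le> 1" for x by (auto simp: g_def)
  have ug: "integrable \<mu> (\<lambda>x. u x * g x)" if "integrable \<mu> u" for u
    by (rule integrable_bounded_mult[OF g gb that])
  have "ext u = (LINT x|\<mu>. u x * g x)" if "integrable \<mu> u" for u
    using that
  proof (induction rule: integrable_induct)
    case (base A c)
    have "(LINT x|\<mu>. (indicator A x *\<^sub>R c) * g x) = c * (LINT x|\<mu>. indicator A x * g x)"
      by (simp add: mult_ac flip: integral_mult_right_zero)
    also have "(LINT x|\<mu>. indicator A x * g x) = (LINT x|\<mu>. indicator A x * g0 x)"
      by (rule integral_cong_AE) (use base bound in \<open>auto simp: g_def\<close>)
    also have "\<dots> = ext (indicator A)" using base by (intro g0A) simp
    finally show ?case using ext_cmult[OF integrable_indicator_real, of A c] base by (simp add: mult.commute)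
  next
    case (add u v)
    then show ?case
      by (simp add: ext_add distrib_right Bochner_Integration.integral_add[OF ug ug])
  next
    case (lim u s)
    have "(\<lambda>i. LINT x|\<mu>. s i x * g x) \<longlonglongrightarrow> (LINT x|\<mu>. u x * g x)"
    proof (rule integral_dominated_convergence[where w = "\<lambda>x. 2 * \<bar>u x\<bar>"])
      show "AE x in \<mu>. norm (s i x * g x) \<le> 2 * \<bar>u x\<bar>" for i
      proof (rule AE_I2)
        fix x
        have "\<bar>s i x * g x\<bar> \<le> \<bar>s i x\<bar>" using gb[of x] by (simp add: abs_mult mult_left_le)
        also have "\<dots> \<le> 2 * \<bar>u x\<bar>" using lim.hyps(3)[of x i] by simp
        finally show "norm (s i x * g x) \<le> 2 * \<bar>u x\<bar>" by simp
      qed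
      show "AE x in \<mu>. (\<lambda>i. s i x * g x) \<longlonglongrightarrow> u x * g x"
        using lim.hyps(2) by (intro AE_I2 tendsto_mult_right) simp
      show "(\<lambda>x. u x * g x) \<in> borel_measurable \<mu>" by (rule borel_measurable_integrable[OF ug[OF lim.hyps(4)]])
      show "(\<lambda>x. s i x * g x) \<in> borel_measurable \<mu>" for i
        by (rule borel_measurable_integrable[OF ug[OF lim.hyps(1)]])
    qed (use lim.hyps in auto)
    moreover have "(\<lambda>i. ext (s i)) \<longlonglongrightarrow> ext u"
    proof (rule Lim_null[THEN iffD2], rule Lim_null_comparison)
      show "\<forall>\<^sub>F i in sequentially. norm (ext (s i) - ext u) \<le> (LINT x|\<mu>. \<bar>s i x - u x\<bar>)"
        using ext_close lim.hyps by simp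
      show "(\<lambda>i. LINT x|\<mu>. \<bar>s i x - u x\<bar>) \<longlonglongrightarrow> 0"
        by (rule L1_limit) (use lim.hyps in auto)
    qed
    ultimately show ?case using lim.IH LIMSEQ_unique by simp
  qed
  then show thesis using that[OF g gb] ext_Lipb by simp
qed

end

section \<open>The mass measure\<close>

lemma mass_bound_fbm: "mass_bound T \<mu> \<Longrightarrow> finite_borel_measure (\<mu> :: 'a::polish_space measure)"
  by (simp add: mass_bound_def finite_borel_measure_def finite_borel_measure_axioms_def)

lemma mass_boundD:
  "mass_bound T \<mu> \<Longrightarrow> f \<in> Lipb_funs \<Longrightarrow> \<pi> \<in> Lip_funs \<Longrightarrow>
    \<bar>T (f, \<pi>)\<bar> \<le> lip_const \<pi> * (LINT x|\<mu>. \<bar>f x\<bar>)"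
  by (auto simp: mass_bound_def D1_def)

definition Lip1 :: "('a::metric_space \<Rightarrow> real) set" where
  "Lip1 = {\<pi> \<in> Lip_funs. lip_const \<pi> \<le> 1}"

lemma Lip1_minus: assumes "\<pi> \<in> Lip1" shows "(\<lambda>x. - \<pi> x) \<in> Lip1"
proof -
  have \<pi>: "\<pi> \<in> Lip_funs" "lip_const \<pi> \<le> 1" using assms by (auto simp: Lip1_def)
  have "lip_const (\<lambda>x. - \<pi> x) \<le> lip_const \<pi>"
  proof (rule lip_const_leI[OF lip_const_nonneg[OF \<pi>(1)]])
    fix x y show "\<bar>- \<pi> x - - \<pi> y\<bar> \<le> lip_const \<pi> * dist x y"
      using lip_constD[OF \<pi>(1), of x y] by linarith
  qed
  then show ?thesis using \<pi> by (simp add: Lip1_def Lip_minus)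
qed

lemma bilinear_left:
  "bilinear_on_D1 T \<Longrightarrow> f \<in> Lipb_funs \<Longrightarrow> g \<in> Lipb_funs \<Longrightarrow> \<pi> \<in> Lip_funs \<Longrightarrow>
    T (\<lambda>x. a * f x + b * g x, \<pi>) = a * T (f, \<pi>) + b * T (g, \<pi>)"
  by (simp add: bilinear_on_D1_def)

lemma bilinear_right:
  "bilinear_on_D1 T \<Longrightarrow> f \<in> Lipb_funs \<Longrightarrow> \<pi> \<in> Lip_funs \<Longrightarrow> \<rho> \<in> Lip_funs \<Longrightarrow>
    T (f, \<lambda>x. a * \<pi> x + b * \<rho> x) = a * T (f, \<pi>) + b * T (f, \<rho>)"
  by (simp add: bilinear_on_D1_def)

lemma bilinear_simps:
  assumes T: "bilinear_on_D1 T" and f: "f \<in> Lipb_funs" and \<pi>: "\<pi> \<in> Lip_funs"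
  shows "T (\<lambda>x. c * f x, \<pi>) = c * T (f, \<pi>)" "T (f, \<lambda>x. c * \<pi> x) = c * T (f, \<pi>)"
    "T (f, \<lambda>x. - \<pi> x) = - T (f, \<pi>)" "T (f, \<lambda>_. 0) = 0" "T (\<lambda>_. 0, \<pi>) = 0"
    "g \<in> Lipb_funs \<Longrightarrow> T (\<lambda>x. f x + g x, \<pi>) = T (f, \<pi>) + T (g, \<pi>)"
    "g \<in> Lipb_funs \<Longrightarrow> T (\<lambda>x. f x - g x, \<pi>) = T (f, \<pi>) - T (g, \<pi>)"
    "\<rho> \<in> Lip_funs \<Longrightarrow> T (f, \<lambda>x. \<pi> x + \<rho> x) = T (f, \<pi>) + T (f, \<rho>)"
    "\<rho> \<in> Lip_funs \<Longrightarrow> T (f, \<lambda>x. \<pi> x - \<rho> x) = T (f, \<pi>) - T (f, \<rho>)"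
  using bilinear_left[OF T f f \<pi>, of c 0] bilinear_right[OF T f \<pi> \<pi>, of c 0]
    bilinear_right[OF T f \<pi> \<pi>, of "- 1" 0] bilinear_right[OF T f \<pi> \<pi>, of 0 0]
    bilinear_left[OF T f f \<pi>, of 0 0] bilinear_left[OF T f _ \<pi>, of g 1 1]
    bilinear_left[OF T f _ \<pi>, of g 1 "- 1"] bilinear_right[OF T f \<pi>, of \<rho> 1 1]
    bilinear_right[OF T f \<pi>, of \<rho> 1 "- 1"]
  by simp_all

lemma bilinear_sum_left:
  assumes T: "bilinear_on_D1 T" and \<pi>: "\<pi> \<in> Lip_funs"
  shows "(\<And>i. i \<in> I \<Longrightarrow> f i \<in> Lipb_funs) \<Longrightarrow> T (\<lambda>x. \<Sum>i\<in>I. f i x, \<pi>) = (\<Sum>i\<in>I. T (f i, \<pi>))"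
proof (induction I rule: infinite_finite_induct)
  case (insert i I)
  then show ?case using bilinear_simps(6)[OF T _ \<pi>, of "f i" "\<lambda>x. \<Sum>i\<in>I. f i x"] by (simp add: Lipb_sum)
qed (simp_all add: bilinear_simps(5)[OF T Lipb_const \<pi>])

lemma bilinear_sum_right:
  assumes T: "bilinear_on_D1 T" and f: "f \<in> Lipb_funs"
  shows "(\<And>i. i \<in> I \<Longrightarrow> \<pi> i \<in> Lip_funs) \<Longrightarrow> T (f, \<lambda>x. \<Sum>i\<in>I. \<pi> i x) = (\<Sum>i\<in>I. T (f, \<pi> i))"
proof (induction I rule: infinite_finite_induct)
  case (insert i I)
  then show ?case using bilinear_simps(8)[OF T f, of "\<pi> i" "\<lambda>x. \<Sum>i\<in>I. \<pi> i x"] by (simp add: Lip_sum)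
qed (simp_all add: bilinear_simps(4)[OF T f Lip_const])

text \<open>
  For each 1-Lipschitz \<open>\<pi>\<close> the functional \<open>f \<mapsto> T (f, \<pi>)\<close> has a density with respect to any bound \<open>\<mu>\<close>.
  The mass measure is the essential supremum of these densities times \<open>\<mu>\<close>. It is approached by
  densities of the form \<open>x \<mapsto> density (s x) x\<close>, where \<open>s\<close> selects one of finitely many functions \<open>\<pi>\<close>
  on each piece of a Borel partition.
\<close>

locale mass_bounded = finite_borel_measure \<mu>
  for \<mu> :: "'a::polish_space measure" +
  fixes T :: "'a form \<Rightarrow> real"
  assumes bilinear: "bilinear_on_D1 T" and bound: "mass_bound T \<mu>"
begin

text \<open>The density for \<open>\<pi> = 0\<close> is chosen to vanish everywhere: it keeps the suprema nonnegative.\<close>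

lemma densities_exist:
  "\<exists>G. (\<forall>\<pi>\<in>Lip1. G \<pi> \<in> borel_measurable borel \<and> (\<forall>x. \<bar>G \<pi> x\<bar> \<le> 1) \<and>
      (\<forall>f\<in>Lipb_funs. T (f, \<pi>) = (LINT x|\<mu>. f x * G \<pi> x))) \<and> G (\<lambda>_. 0) = (\<lambda>_. 0)"
proof -
  have "\<forall>\<pi>. \<exists>g. (\<pi> \<in> Lip1 \<longrightarrow> g \<in> borel_measurable borel \<and> (\<forall>x. \<bar>g x\<bar> \<le> 1) \<and>
      (\<forall>f\<in>Lipb_funs. T (f, \<pi>) = (LINT x|\<mu>. f x * g x))) \<and> (\<pi> = (\<lambda>_. 0) \<longrightarrow> g = (\<lambda>_. 0))"
  proof
    fix \<pi> :: "'a \<Rightarrow> real"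
    show "\<exists>g. (\<pi> \<in> Lip1 \<longrightarrow> g \<in> borel_measurable borel \<and> (\<forall>x. \<bar>g x\<bar> \<le> 1) \<and>
      (\<forall>f\<in>Lipb_funs. T (f, \<pi>) = (LINT x|\<mu>. f x * g x))) \<and> (\<pi> = (\<lambda>_. 0) \<longrightarrow> g = (\<lambda>_. 0))"
    proof (cases "\<pi> = (\<lambda>_. 0) \<or> \<pi> \<notin> Lip1")
      case True
      then show ?thesis
        using bilinear_simps(4)[OF bilinear _ Lip_const] by (intro exI[of _ "\<lambda>_. 0"]) auto
    next
      case False
      then have \<pi>: "\<pi> \<in> Lip_funs" "lip_const \<pi> \<le> 1" by (auto simp: Lip1_def)
      interpret dominated_functional \<mu> "\<lambda>f. T (f, \<pi>)"
      proof
        fix f :: "'a \<Rightarrow> real" assume f: "f \<in> Lipb_funs"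
        have "lip_const \<pi> * (LINT x|\<mu>. \<bar>f x\<bar>) \<le> 1 * (LINT x|\<mu>. \<bar>f x\<bar>)"
          using \<pi>(2) by (intro mult_right_mono Bochner_Integration.integral_nonneg) auto
        then show "\<bar>T (f, \<pi>)\<bar> \<le> (LINT x|\<mu>. \<bar>f x\<bar>)" using mass_boundD[OF bound f \<pi>(1)] by simp
      qed (rule bilinear_left[OF bilinear _ _ \<pi>(1)])
      show ?thesis using density_exists False by metis
    qed
  qed
  then obtain G where "\<forall>\<pi>. (\<pi> \<in> Lip1 \<longrightarrow> G \<pi> \<in> borel_measurable borel \<and> (\<forall>x. \<bar>G \<pi> x\<bar> \<le> 1) \<and>
      (\<forall>f\<in>Lipb_funs. T (f, \<pi>) = (LINT x|\<mu>. f x * G \<pi> x))) \<and> (\<pi> = (\<lambda>_. 0) \<longrightarrow> G \<pi> = (\<lambda>_. 0))"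
    by (rule choice[THEN exE])
  then show ?thesis by (intro exI[of _ G]) blast
qed

definition dens :: "('a \<Rightarrow> real) \<Rightarrow> 'a \<Rightarrow> real" where
  "dens = (SOME G. (\<forall>\<pi>\<in>Lip1. G \<pi> \<in> borel_measurable borel \<and> (\<forall>x. \<bar>G \<pi> x\<bar> \<le> 1) \<and>
      (\<forall>f\<in>Lipb_funs. T (f, \<pi>) = (LINT x|\<mu>. f x * G \<pi> x))) \<and> G (\<lambda>_. 0) = (\<lambda>_. 0))"

lemma dens:
  shows "\<pi> \<in> Lip1 \<Longrightarrow> dens \<pi> \<in> borel_measurable borel"
    and "\<pi> \<in> Lip1 \<Longrightarrow> \<bar>dens \<pi> x\<bar> \<le> 1"
    and "\<pi> \<in> Lip1 \<Longrightarrow> f \<in> Lipb_funs \<Longrightarrow> T (f, \<pi>) = (LINT x|\<mu>. f x * dens \<pi> x)"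
    and "dens (\<lambda>_. 0) = (\<lambda>_. 0)"
  using someI_ex[OF densities_exist, folded dens_def] by blast+

definition selection :: "('a \<Rightarrow> 'a \<Rightarrow> real) \<Rightarrow> bool" where
  "selection s \<longleftrightarrow> simple_function borel s \<and> range s \<subseteq> Lip1"

definition sel_dens :: "('a \<Rightarrow> 'a \<Rightarrow> real) \<Rightarrow> 'a \<Rightarrow> real" where
  "sel_dens s x = dens (s x) x"

lemma selection_finite: "selection s \<Longrightarrow> finite (range s)"
  and selection_sets: "selection s \<Longrightarrow> s -` {\<pi>} \<in> sets borel"
  and selection_Lip1: "selection s \<Longrightarrow> s x \<in> Lip1"
proof -
  assume s: "selection s"
  show fin: "finite (range s)" using s by (simp add: selection_def simple_function_def)
  show "s x \<in> Lip1" using s by (auto simp: selection_def)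
  show "s -` {\<pi>} \<in> sets borel"
  proof (cases "\<pi> \<in> range s")
    case True
    then show ?thesis using s by (auto simp: selection_def simple_function_def)
  next
    case False
    then have "s -` {\<pi>} = {}" by auto
    then show ?thesis by simp
  qed
qed

lemma sel_dens_sum:
  assumes "selection s"
  shows "sel_dens s x = (\<Sum>\<pi>\<in>range s. indicator (s -` {\<pi>}) x * dens \<pi> x)"
proof -
  have "(\<Sum>\<pi>\<in>range s. indicator (s -` {\<pi>}) x * dens \<pi> x)
      = (\<Sum>\<pi>\<in>range s. if \<pi> = s x then dens \<pi> x else 0)"
    by (intro sum.cong) (auto simp: indicator_def)
  also have "\<dots> = sel_dens s x" using selection_finite[OF assms] by (simp add: sel_dens_def)
  finally show ?thesis by simp
qed

lemma sel_dens_measurable: "selection s \<Longrightarrow> sel_dens s \<in> borel_measurable borel"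
proof -
  assume s: "selection s"
  have "(\<lambda>x. \<Sum>\<pi>\<in>range s. indicator (s -` {\<pi>}) x * dens \<pi> x) \<in> borel_measurable borel"
    using selection_sets[OF s] selection_Lip1[OF s] dens(1)
    by (intro borel_measurable_sum borel_measurable_times borel_measurable_indicator) auto
  then show ?thesis using sel_dens_sum[OF s] by (simp cong: measurable_cong)
qed

lemma sel_dens_bound: "selection s \<Longrightarrow> \<bar>sel_dens s x\<bar> \<le> 1"
  by (simp add: sel_dens_def dens(2) selection_Lip1)

lemma sel_dens_integrable: "selection s \<Longrightarrow> integrable \<mu> (sel_dens s)"
  by (rule integrable_bounded[OF sel_dens_measurable sel_dens_bound])

lemma sel_dens_integral:
  assumes s: "selection s" and B: "B \<in> sets borel"
  shows "(LINT x|\<mu>. indicator B x * sel_dens s x)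
    = (\<Sum>\<pi>\<in>range s. LINT x|\<mu>. indicator (B \<inter> s -` {\<pi>}) x * dens \<pi> x)"
proof -
  have "(LINT x|\<mu>. indicator B x * sel_dens s x)
      = (LINT x|\<mu>. (\<Sum>\<pi>\<in>range s. indicator (B \<inter> s -` {\<pi>}) x * dens \<pi> x))"
    by (intro Bochner_Integration.integral_cong refl)
      (simp add: sel_dens_sum[OF s] sum_distrib_left indicator_inter_arith mult.assoc)
  also have "\<dots> = (\<Sum>\<pi>\<in>range s. LINT x|\<mu>. indicator (B \<inter> s -` {\<pi>}) x * dens \<pi> x)"
    using B selection_sets[OF s] selection_Lip1[OF s] dens(1,2)
    by (intro Bochner_Integration.integral_sum integrable_bounded_mult integrable_indicator_real) auto
  finally show ?thesis .
qed

lemma sel_dens_max: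
  assumes "selection s" "selection t"
  shows "\<exists>r. selection r \<and> (\<forall>x. sel_dens r x = max (sel_dens s x) (sel_dens t x))"
proof -
  have [measurable]: "sel_dens s \<in> borel_measurable borel" "sel_dens t \<in> borel_measurable borel"
    using assms by (auto intro: sel_dens_measurable)
  define r where "r x = (if sel_dens t x \<le> sel_dens s x then s x else t x)" for x
  have "simple_function borel r" unfolding r_def
    using assms by (intro simple_function_If) (auto simp: selection_def)
  moreover have "range r \<subseteq> Lip1" using assms by (auto simp: r_def selection_Lip1)
  ultimately show ?thesis
    by (intro exI[of _ r]) (auto simp: selection_def r_def sel_dens_def)
qed

text \<open>
  No relation between \<open>\<mu>\<close> and \<open>\<nu>\<close> is known except that both bound \<open>T\<close>; they are compared through
  Lipschitz functions that approximate the indicator with respect to both.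
\<close>

lemma dens_le_bound:
  assumes \<nu>: "mass_bound T \<nu>" and \<pi>: "\<pi> \<in> Lip1" and C: "C \<in> sets borel"
  shows "(LINT x|\<mu>. indicator C x * dens \<pi> x) \<le> measure \<nu> C"
proof (rule field_le_epsilon)
  interpret \<nu>: finite_borel_measure \<nu> by (rule mass_bound_fbm[OF \<nu>])
  fix e :: real assume "0 < e"
  then have "0 < e / 2" by simp
  obtain f where f: "f \<in> Lipb_funs" "(LINT x|\<mu>. \<bar>f x - indicator C x\<bar>) < e / 2"
    "(LINT x|\<nu>. \<bar>f x - indicator C x\<bar>) < e / 2"
    using indicator_approx[OF fbm \<nu>.fbm C \<open>0 < e / 2\<close>] by metis
  have \<pi>': "\<pi> \<in> Lip_funs" "lip_const \<pi> \<le> 1" using \<pi> by (auto simp: Lip1_def)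
  have i: "integrable \<mu> (\<lambda>x. f x * dens \<pi> x)" "integrable \<mu> (\<lambda>x. \<bar>f x - indicator C x\<bar>)"
    using f(1) C \<pi> dens(1,2) by (auto intro!: integrable_bounded_mult integrable_Lipb_diff integrable_indicator_real)
  have "(LINT x|\<mu>. indicator C x * dens \<pi> x) \<le> (LINT x|\<mu>. f x * dens \<pi> x + \<bar>f x - indicator C x\<bar>)"
  proof (rule integral_mono)
    show "integrable \<mu> (\<lambda>x. indicator C x * dens \<pi> x)"
      using C \<pi> dens(1,2) by (intro integrable_bounded_mult integrable_indicator_real) auto
    show "integrable \<mu> (\<lambda>x. f x * dens \<pi> x + \<bar>f x - indicator C x\<bar>)"
      by (rule Bochner_Integration.integrable_add[OF i])
    fix x
    have "\<bar>(f x - indicator C x) * dens \<pi> x\<bar> \<le> \<bar>f x - indicator C x\<bar>"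
      using dens(2)[OF \<pi>, of x] by (simp add: abs_mult mult_left_le)
    then show "indicator C x * dens \<pi> x \<le> f x * dens \<pi> x + \<bar>f x - indicator C x\<bar>"
      by (simp add: left_diff_distrib abs_le_iff)
  qed
  also have "\<dots> = T (f, \<pi>) + (LINT x|\<mu>. \<bar>f x - indicator C x\<bar>)"
    by (simp add: Bochner_Integration.integral_add[OF i] dens(3)[OF \<pi> f(1)])
  finally have 1: "(LINT x|\<mu>. indicator C x * dens \<pi> x) \<le> T (f, \<pi>) + e / 2" using f(2) by linarith
  have "lip_const \<pi> * (LINT x|\<nu>. \<bar>f x\<bar>) \<le> 1 * (LINT x|\<nu>. \<bar>f x\<bar>)"
    using \<pi>'(2) by (intro mult_right_mono Bochner_Integration.integral_nonneg) auto
  then have 2: "T (f, \<pi>) \<le> (LINT x|\<nu>. \<bar>f x\<bar>)" using mass_boundD[OF \<nu> f(1) \<pi>'(1)] by linarith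
  have j: "integrable \<nu> (indicator C :: 'a \<Rightarrow> real)" using C by (simp add: \<nu>.emeasure_finite less_top[symmetric])
  have "(LINT x|\<nu>. \<bar>f x\<bar>) \<le> (LINT x|\<nu>. indicator C x + \<bar>f x - indicator C x\<bar>)"
    by (intro integral_mono Bochner_Integration.integrable_add \<nu>.integrable_Lipb_diff[OF f(1) j] j
        \<nu>.integrable_Lipb[OF Lipb_abs[OF f(1)]]) (auto simp: indicator_def)
  also have "\<dots> = measure \<nu> C + (LINT x|\<nu>. \<bar>f x - indicator C x\<bar>)"
    using C by (simp add: Bochner_Integration.integral_add[OF j \<nu>.integrable_Lipb_diff[OF f(1) j]])
  finally show "(LINT x|\<mu>. indicator C x * dens \<pi> x) \<le> measure \<nu> C + e" using 1 2 f(3) by linarith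
qed

lemma sel_dens_le_bound:
  assumes \<nu>: "mass_bound T \<nu>" and s: "selection s" and B: "B \<in> sets borel"
  shows "(LINT x|\<mu>. indicator B x * sel_dens s x) \<le> measure \<nu> B"
proof -
  interpret \<nu>: finite_borel_measure \<nu> by (rule mass_bound_fbm[OF \<nu>])
  have sets: "B \<inter> s -` {\<pi>} \<in> sets borel" for \<pi> using B selection_sets[OF s] by auto
  have "(LINT x|\<mu>. indicator B x * sel_dens s x) \<le> (\<Sum>\<pi>\<in>range s. measure \<nu> (B \<inter> s -` {\<pi>}))"
    unfolding sel_dens_integral[OF s B]
    using selection_Lip1[OF s] sets by (intro sum_mono dens_le_bound[OF \<nu>]) auto
  also have "\<dots> = measure \<nu> (\<Union>\<pi>\<in>range s. B \<inter> s -` {\<pi>})"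
    using selection_finite[OF s] sets
    by (intro \<nu>.finite_measure_finite_Union[symmetric]) (auto simp: disjoint_family_on_def)
  also have "(\<Union>\<pi>\<in>range s. B \<inter> s -` {\<pi>}) = B" by auto
  finally show ?thesis .
qed

text \<open>This number will turn out to be the mass of \<open>T\<close>.\<close>

definition top_mass :: real where
  "top_mass = (SUP s\<in>{s. selection s}. LINT x|\<mu>. sel_dens s x)"

lemma sel_zero: "selection (\<lambda>_ _. 0)" "sel_dens (\<lambda>_ _. 0) = (\<lambda>_. 0)"
proof -
  have "lip_const (\<lambda>_ :: 'a. 0 :: real) \<le> 1" by (rule lip_const_leI) auto
  then show "selection (\<lambda>_ _. 0)" by (auto simp: selection_def Lip1_def)
  show "sel_dens (\<lambda>_ _. 0) = (\<lambda>_. 0)" by (simp add: sel_dens_def dens(4) fun_eq_iff)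
qed

lemma sel_dens_le_top: "selection s \<Longrightarrow> (LINT x|\<mu>. sel_dens s x) \<le> top_mass"
  unfolding top_mass_def
proof (rule cSUP_upper)
  show "bdd_above ((\<lambda>s. LINT x|\<mu>. sel_dens s x) ` {s. selection s})"
    using sel_dens_le_bound[OF bound, of _ UNIV]
    by (intro bdd_aboveI2[where M = "measure \<mu> UNIV"]) simp
qed simp

lemma top_mass_approx: "0 < e \<Longrightarrow> \<exists>s. selection s \<and> top_mass - e < (LINT x|\<mu>. sel_dens s x)"
proof -
  assume "0 < e"
  have "\<exists>y\<in>(\<lambda>s. LINT x|\<mu>. sel_dens s x) ` {s. selection s}. top_mass - e < y"
    unfolding top_mass_def
    by (rule less_cSupD) (use sel_zero(1) \<open>0 < e\<close> in auto)
  then show ?thesis by auto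
qed

text \<open>
  A maximizing sequence of selections, made increasing, converges to the density sought: a selection
  that exceeded the limit on a set of positive measure would, joined to the sequence, push the
  integrals above their supremum.
\<close>

lemma maximal_density:
  obtains u where "u \<in> borel_measurable borel" "\<And>x. 0 \<le> u x" "\<And>x. u x \<le> 1"
    "(LINT x|\<mu>. u x) = top_mass" "\<And>s. selection s \<Longrightarrow> AE x in \<mu>. sel_dens s x \<le> u x"
    "\<And>\<nu> B. mass_bound T \<nu> \<Longrightarrow> B \<in> sets borel \<Longrightarrow> (LINT x|\<mu>. indicator B x * u x) \<le> measure \<nu> B"
proof -
  have "\<forall>n. \<exists>s. selection s \<and> top_mass - 1 / real (Suc n) < (LINT x|\<mu>. sel_dens s x)"
    by (intro allI top_mass_approx) simp
  then obtain w where w: "\<And>n. selection (w n)" "\<And>n. top_mass - 1 / real (Suc n) < (LINT x|\<mu>. sel_dens (w n) x)"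
    by metis
  have "\<forall>s t. \<exists>r. selection s \<longrightarrow> selection t \<longrightarrow> selection r \<and> (\<forall>x. sel_dens r x = max (sel_dens s x) (sel_dens t x))"
    using sel_dens_max by blast
  then obtain join where join: "\<And>s t. selection s \<Longrightarrow> selection t \<Longrightarrow> selection (join s t)"
    "\<And>s t x. selection s \<Longrightarrow> selection t \<Longrightarrow> sel_dens (join s t) x = max (sel_dens s x) (sel_dens t x)"
    by metis
  define v where "v = rec_nat (join (\<lambda>_ _. 0) (w 0)) (\<lambda>n s. join s (w (Suc n)))"
  have v_Suc: "v (Suc n) = join (v n) (w (Suc n))" and v_0: "v 0 = join (\<lambda>_ _. 0) (w 0)" for n
    by (simp_all add: v_def)
  have sv: "selection (v n)" for n
    by (induction n) (simp_all add: v_0 v_Suc join w sel_zero)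
  have w_le: "sel_dens (w n) x \<le> sel_dens (v n) x" for n x
    by (cases n) (simp_all add: v_0 v_Suc join w sel_zero sv)
  have mono: "incseq (\<lambda>n. sel_dens (v n) x)" for x
    by (rule incseq_SucI) (simp add: v_Suc join sv w)
  have v_nn: "0 \<le> sel_dens (v n) x" for n x
  proof -
    have "0 \<le> sel_dens (v 0) x" by (simp add: v_0 join sel_zero w)
    also have "\<dots> \<le> sel_dens (v n) x" using mono[of x] by (simp add: incseq_def)
    finally show ?thesis .
  qed
  have v_le: "sel_dens (v n) x \<le> 1" for n x using sel_dens_bound[OF sv, of n x] by linarith
  define u where "u x = (SUP n. sel_dens (v n) x)" for x
  have bdd: "bdd_above (range (\<lambda>n. sel_dens (v n) x))" for x
    by (rule bdd_aboveI2[of _ _ 1]) (rule v_le)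
  have lim: "(\<lambda>n. sel_dens (v n) x) \<longlonglongrightarrow> u x" for x
    unfolding u_def by (rule LIMSEQ_incseq_SUP[OF bdd mono])
  have u0: "0 \<le> u x" for x by (rule LIMSEQ_le_const[OF lim]) (use v_nn in auto)
  have u1: "u x \<le> 1" for x by (rule LIMSEQ_le_const2[OF lim]) (use v_le in auto)
  have u [measurable]: "u \<in> borel_measurable borel"
    by (rule borel_measurable_LIMSEQ_real[OF lim sel_dens_measurable[OF sv]])
  have u_abs: "\<bar>u x\<bar> \<le> 1" for x using u0[of x] u1[of x] by simp
  have int_u: "integrable \<mu> u" by (rule integrable_bounded[OF u u_abs])
  have conv: "(\<lambda>n. LINT x|\<mu>. sel_dens (v n) x) \<longlonglongrightarrow> (LINT x|\<mu>. u x)"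
  proof (rule integral_dominated_convergence[where w = "\<lambda>_. 1"])
    show "sel_dens (v n) \<in> borel_measurable \<mu>" for n
      using sel_dens_measurable[OF sv] by measurable
    show "u \<in> borel_measurable \<mu>" by measurable
  qed (use lim sel_dens_bound[OF sv] in auto)
  have "top_mass \<le> (LINT x|\<mu>. u x)"
  proof -
    have "top_mass - 1 / real (Suc n) \<le> (LINT x|\<mu>. sel_dens (v n) x)" for n
    proof -
      have "(LINT x|\<mu>. sel_dens (w n) x) \<le> (LINT x|\<mu>. sel_dens (v n) x)"
        by (intro integral_mono sel_dens_integrable sv w w_le)
      then show ?thesis using w(2)[of n] by linarith
    qed
    moreover have "(\<lambda>n. top_mass - 1 / real (Suc n)) \<longlonglongrightarrow> top_mass - 0"
      by (intro tendsto_diff tendsto_const lim_1_over_n[THEN LIMSEQ_Suc])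
    ultimately have "top_mass - 0 \<le> (LINT x|\<mu>. u x)"
      using conv by (intro LIMSEQ_le) auto
    then show ?thesis by simp
  qed
  moreover have "(LINT x|\<mu>. u x) \<le> top_mass"
    by (rule LIMSEQ_le_const2[OF conv]) (use sel_dens_le_top[OF sv] in auto)
  ultimately have u_top: "(LINT x|\<mu>. u x) = top_mass" by simp
  have max: "AE x in \<mu>. sel_dens s x \<le> u x" if s: "selection s" for s
  proof -
    have [measurable]: "sel_dens s \<in> borel_measurable borel" by (rule sel_dens_measurable[OF s])
    have mb: "\<bar>max (u x) (sel_dens s x)\<bar> \<le> 1" for x
      using sel_dens_bound[OF s, of x] u_abs[of x] by (simp add: max_def)
    have int_max: "integrable \<mu> (\<lambda>x. max (u x) (sel_dens s x))"
      by (rule integrable_bounded[OF _ mb]) measurable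
    have "(\<lambda>n. LINT x|\<mu>. sel_dens (join (v n) s) x) \<longlonglongrightarrow> (LINT x|\<mu>. max (u x) (sel_dens s x))"
    proof (rule integral_dominated_convergence[where w = "\<lambda>_. 1"])
      show "sel_dens (join (v n) s) \<in> borel_measurable \<mu>" for n
        using sel_dens_measurable[OF join(1)[OF sv s]] by measurable
      show "(\<lambda>x. max (u x) (sel_dens s x)) \<in> borel_measurable \<mu>" by measurable
      show "AE x in \<mu>. (\<lambda>n. sel_dens (join (v n) s) x) \<longlonglongrightarrow> max (u x) (sel_dens s x)"
        unfolding join(2)[OF sv s] by (intro AE_I2 tendsto_max lim tendsto_const)
    qed (use sel_dens_bound[OF join(1)[OF sv s]] in auto)
    then have "(LINT x|\<mu>. max (u x) (sel_dens s x)) \<le> top_mass"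
      by (rule LIMSEQ_le_const2) (use sel_dens_le_top[OF join(1)[OF sv s]] in auto)
    then have "(LINT x|\<mu>. max (u x) (sel_dens s x) - u x) \<le> 0"
      using u_top by (simp add: Bochner_Integration.integral_diff[OF int_max int_u])
    moreover have "0 \<le> (LINT x|\<mu>. max (u x) (sel_dens s x) - u x)"
      by (rule Bochner_Integration.integral_nonneg) simp
    ultimately have "AE x in \<mu>. max (u x) (sel_dens s x) - u x = 0"
      using integral_nonneg_eq_0_iff_AE[OF Bochner_Integration.integrable_diff[OF int_max int_u]] by simp
    then show ?thesis by eventually_elim (simp add: max_def split: if_splits)
  qed
  have min: "(LINT x|\<mu>. indicator B x * u x) \<le> measure \<nu> B" if \<nu>: "mass_bound T \<nu>" and B: "B \<in> sets borel" for \<nu> B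
  proof -
    have "(\<lambda>n. LINT x|\<mu>. indicator B x * sel_dens (v n) x) \<longlonglongrightarrow> (LINT x|\<mu>. indicator B x * u x)"
    proof (rule integral_dominated_convergence[where w = "\<lambda>_. 1"])
      show "(\<lambda>x. indicator B x * sel_dens (v n) x) \<in> borel_measurable \<mu>" for n
        using sel_dens_measurable[OF sv] B by measurable
      show "(\<lambda>x. indicator B x * u x) \<in> borel_measurable \<mu>" using B by measurable
      show "AE x in \<mu>. (\<lambda>n. indicator B x * sel_dens (v n) x) \<longlonglongrightarrow> indicator B x * u x"
        by (intro AE_I2 tendsto_mult tendsto_const lim)
      show "AE x in \<mu>. norm (indicator B x * sel_dens (v n) x) \<le> 1" for n
        using sel_dens_bound[OF sv] by (intro AE_I2) (simp add: indicator_def)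
    qed simp
    then show ?thesis
      by (rule LIMSEQ_le_const2) (use sel_dens_le_bound[OF \<nu> sv B] in auto)
  qed
  show thesis using that[OF u u0 u1 u_top max min] .
qed

lemma constant_selection:
  assumes "\<pi> \<in> Lip1" shows "selection (\<lambda>_. \<pi>)" "sel_dens (\<lambda>_. \<pi>) = dens \<pi>"
  using assms by (auto simp: selection_def sel_dens_def fun_eq_iff)

text \<open>
  The negative part of \<open>f\<close> is paired with \<open>- \<pi>\<close>, so that upper bounds for densities suffice.
\<close>

lemma density_bounds_T:
  assumes u: "u \<in> borel_measurable borel" "\<And>x. 0 \<le> u x" "\<And>x. u x \<le> 1"
    and le: "\<And>s. selection s \<Longrightarrow> AE x in \<mu>. sel_dens s x \<le> u x"
    and f: "f \<in> Lipb_funs" and \<pi>: "\<pi> \<in> Lip1"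
  shows "T (f, \<pi>) \<le> (LINT x|\<mu>. \<bar>f x\<bar> * u x)"
proof -
  have ub: "\<bar>u x\<bar> \<le> 1" for x using u(2,3)[of x] by simp
  have \<pi>L: "\<pi> \<in> Lip_funs" using \<pi> by (simp add: Lip1_def)
  have pos: "T (g, \<rho>) \<le> (LINT x|\<mu>. g x * u x)" if g: "g \<in> Lipb_funs" "\<And>x. 0 \<le> g x" and \<rho>: "\<rho> \<in> Lip1" for g \<rho>
  proof -
    have "AE x in \<mu>. dens \<rho> x \<le> u x" using le[OF constant_selection(1)[OF \<rho>]] constant_selection(2)[OF \<rho>] by simp
    then have "AE x in \<mu>. g x * dens \<rho> x \<le> g x * u x"
      by eventually_elim (use g(2) in \<open>auto intro: mult_left_mono\<close>)
    then show ?thesis unfolding dens(3)[OF \<rho> g(1)]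
      using g(1) \<rho> dens(1,2) u ub by (intro integral_mono_AE integrable_bounded_mult) auto
  qed
  have fp: "(\<lambda>x. max (f x) 0) \<in> Lipb_funs" and fm: "(\<lambda>x. max (- f x) 0) \<in> Lipb_funs"
    using f by (auto intro: Lipb_max Lipb_minus)
  have "f = (\<lambda>x. max (f x) 0 - max (- f x) 0)" by (auto simp: fun_eq_iff max_def)
  then have "T (f, \<pi>) = T (\<lambda>x. max (f x) 0, \<pi>) - T (\<lambda>x. max (- f x) 0, \<pi>)"
    using bilinear_simps(7)[OF bilinear fp \<pi>L fm] by simp
  then have "T (f, \<pi>) = T (\<lambda>x. max (f x) 0, \<pi>) + T (\<lambda>x. max (- f x) 0, \<lambda>x. - \<pi> x)"
    using bilinear_simps(3)[OF bilinear fm \<pi>L] by simp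
  also have "\<dots> \<le> (LINT x|\<mu>. max (f x) 0 * u x) + (LINT x|\<mu>. max (- f x) 0 * u x)"
    by (intro add_mono pos fp fm \<pi> Lip1_minus) auto
  also have "\<dots> = (LINT x|\<mu>. max (f x) 0 * u x + max (- f x) 0 * u x)"
    by (intro Bochner_Integration.integral_add[symmetric] integrable_bounded_mult integrable_Lipb u ub fp fm)
  also have "\<dots> = (LINT x|\<mu>. \<bar>f x\<bar> * u x)"
    by (intro Bochner_Integration.integral_cong) (auto simp: max_def)
  finally show ?thesis .
qed

lemma least_bound_exists:
  "\<exists>\<mu>'. mass_bound T \<mu>' \<and> measure \<mu>' UNIV = top_mass \<and>
     (\<forall>\<nu>. mass_bound T \<nu> \<longrightarrow> (\<forall>A\<in>sets borel. emeasure \<mu>' A \<le> emeasure \<nu> A))"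
proof -
  obtain u where u [measurable]: "u \<in> borel_measurable borel" and u0: "\<And>x. 0 \<le> u x" and u1: "\<And>x. u x \<le> 1"
    and top: "(LINT x|\<mu>. u x) = top_mass" and max: "\<And>s. selection s \<Longrightarrow> AE x in \<mu>. sel_dens s x \<le> u x"
    and min: "\<And>\<nu> B. mass_bound T \<nu> \<Longrightarrow> B \<in> sets borel \<Longrightarrow> (LINT x|\<mu>. indicator B x * u x) \<le> measure \<nu> B"
    using maximal_density by blast
  have ub: "\<bar>u x\<bar> \<le> 1" for x using u0 u1[of x] by (simp add: abs_of_nonneg)
  define \<mu>' where "\<mu>' = density \<mu> (\<lambda>x. ennreal (u x))"
  have em: "emeasure \<mu>' A = ennreal (LINT x|\<mu>. indicator A x * u x)" if A: "A \<in> sets borel" for A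
  proof -
    have "emeasure \<mu>' A = (\<integral>\<^sup>+x. ennreal (u x) * indicator A x \<partial>\<mu>)"
      unfolding \<mu>'_def using A by (intro emeasure_density) auto
    also have "\<dots> = (\<integral>\<^sup>+x. ennreal (indicator A x * u x) \<partial>\<mu>)"
      by (intro nn_integral_cong) (auto simp: indicator_def)
    also have "\<dots> = ennreal (LINT x|\<mu>. indicator A x * u x)"
      using A u0 by (intro nn_integral_eq_integral integrable_bounded_mult[OF u ub] integrable_indicator_real) auto
    finally show ?thesis .
  qed
  have m': "measure \<mu>' UNIV = top_mass"
  proof -
    have "0 \<le> top_mass" unfolding top[symmetric] by (rule Bochner_Integration.integral_nonneg) (rule u0)
    then show ?thesis using em[of UNIV] top by (simp add: measure_def)
  qed
  have int: "(LINT x|\<mu>'. \<bar>f x\<bar>) = (LINT x|\<mu>. \<bar>f x\<bar> * u x)" if f: "f \<in> Lipb_funs" for f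
  proof -
    have [measurable]: "f \<in> borel_measurable borel" by (rule Lipb_measurable[OF f])
    have "(LINT x|\<mu>'. \<bar>f x\<bar>) = (LINT x|\<mu>. u x *\<^sub>R \<bar>f x\<bar>)"
      unfolding \<mu>'_def using u0 by (intro integral_density) auto
    then show ?thesis by (simp add: mult.commute)
  qed
  have fin: "finite_measure \<mu>'"
    using em[of UNIV] by (intro finite_measureI) (simp add: \<mu>'_def)
  have sets: "sets \<mu>' = sets borel" by (simp add: \<mu>'_def)
  have "\<bar>T (f, \<pi>)\<bar> \<le> lip_const \<pi> * (LINT x|\<mu>'. \<bar>f x\<bar>)" if f: "f \<in> Lipb_funs" and \<pi>: "\<pi> \<in> Lip_funs" for f \<pi>
  proof (cases "lip_const \<pi> = 0")
    case True
    then show ?thesis using mass_boundD[OF bound f \<pi>] by simp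
  next
    case False
    define K where "K = lip_const \<pi>"
    have K: "0 < K" using False lip_const_nonneg[OF \<pi>] by (simp add: K_def)
    define \<rho> where "\<rho> = (\<lambda>x. (1 / K) * \<pi> x)"
    have \<rho>L: "\<rho> \<in> Lip_funs" unfolding \<rho>_def by (rule Lip_cmult[OF \<pi>])
    have "lip_const \<rho> \<le> 1"
    proof (rule lip_const_leI)
      fix x y
      have "\<bar>\<rho> x - \<rho> y\<bar> = (1 / K) * \<bar>\<pi> x - \<pi> y\<bar>"
        using K by (simp add: \<rho>_def flip: diff_divide_distrib)
      also have "\<dots> \<le> (1 / K) * (K * dist x y)"
        using K lip_constD[OF \<pi>, of x y] unfolding K_def by (intro mult_left_mono) auto
      finally show "\<bar>\<rho> x - \<rho> y\<bar> \<le> 1 * dist x y" using K by simp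
    qed simp
    then have \<rho>: "\<rho> \<in> Lip1" using \<rho>L by (simp add: Lip1_def)
    have T\<pi>: "T (f, \<pi>) = K * T (f, \<rho>)"
      using bilinear_simps(2)[OF bilinear f \<pi>, of "1 / K"] K by (simp add: \<rho>_def)
    have "T (f, \<rho>) \<le> (LINT x|\<mu>'. \<bar>f x\<bar>)"
      unfolding int[OF f] by (rule density_bounds_T[OF u u0 u1 max f \<rho>])
    moreover have "- T (f, \<rho>) \<le> (LINT x|\<mu>'. \<bar>f x\<bar>)"
      unfolding int[OF f] bilinear_simps(3)[OF bilinear f \<rho>L, symmetric]
      by (rule density_bounds_T[OF u u0 u1 max f Lip1_minus[OF \<rho>]])
    ultimately have "\<bar>T (f, \<rho>)\<bar> \<le> (LINT x|\<mu>'. \<bar>f x\<bar>)" by linarith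
    then have "K * \<bar>T (f, \<rho>)\<bar> \<le> K * (LINT x|\<mu>'. \<bar>f x\<bar>)" using K by (intro mult_left_mono) auto
    then show ?thesis unfolding T\<pi> K_def[symmetric] using K by (simp add: abs_mult)
  qed
  then have "mass_bound T \<mu>'"
    using fin sets by (auto simp: mass_bound_def D1_def)
  moreover have "emeasure \<mu>' A \<le> emeasure \<nu> A" if \<nu>: "mass_bound T \<nu>" and A: "A \<in> sets borel" for \<nu> A
  proof -
    interpret \<nu>: finite_borel_measure \<nu> by (rule mass_bound_fbm[OF \<nu>])
    show ?thesis using min[OF \<nu> A] by (simp add: em[OF A] \<nu>.emeasure_eq_measure ennreal_leI)
  qed
  ultimately show ?thesis using m' by blast
qed

lemma mass_measure_props:
  shows "mass_bound T (mass_measure T)"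
    and "mass_bound T \<nu> \<Longrightarrow> A \<in> sets borel \<Longrightarrow> emeasure (mass_measure T) A \<le> emeasure \<nu> A"
    and "mass T = top_mass"
proof -
  obtain \<mu>' where \<mu>': "mass_bound T \<mu>'" "measure \<mu>' UNIV = top_mass"
     "\<And>\<nu> A. mass_bound T \<nu> \<Longrightarrow> A \<in> sets borel \<Longrightarrow> emeasure \<mu>' A \<le> emeasure \<nu> A"
    using least_bound_exists by blast
  have eq: "mass_measure T = \<mu>'"
    unfolding mass_measure_def
  proof (rule the_equality)
    fix \<nu> assume \<nu>: "mass_bound T \<nu> \<and> (\<forall>\<nu>'. mass_bound T \<nu>' \<longrightarrow> (\<forall>A\<in>sets borel. emeasure \<nu> A \<le> emeasure \<nu>' A))"
    have "sets \<nu> = sets borel" "sets \<mu>' = sets borel" using \<nu> \<mu>'(1) by (auto simp: mass_bound_def)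
    then show "\<nu> = \<mu>'"
      using \<nu> \<mu>' by (intro measure_eqI) (auto intro!: antisym)
  qed (use \<mu>' in blast)
  show "mass_bound T (mass_measure T)" using \<mu>' eq by simp
  show "mass_bound T \<nu> \<Longrightarrow> A \<in> sets borel \<Longrightarrow> emeasure (mass_measure T) A \<le> emeasure \<nu> A"
    using \<mu>' eq by simp
  show "mass T = top_mass" using \<mu>' eq by (simp add: mass_def)
qed

end

lemma Lipb_divide_max1:
  assumes "f \<in> Lipb_funs" "N \<in> Lipb_funs"
  shows "(\<lambda>x. f x / max 1 (N x)) \<in> Lipb_funs"
proof -
  have N: "(\<lambda>x. max 1 (N x)) \<in> Lip_funs" using assms(2) by (intro Lip_max) auto
  have "(\<lambda>x. 1 / max 1 (N x)) \<in> Lipb_funs"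
  proof (rule LipbI[of _ 1], rule Lip_funsI)
    fix x y
    let ?a = "max 1 (N x)" and ?b = "max 1 (N y)"
    have "1 / ?a - 1 / ?b = (?b - ?a) / (?a * ?b)" by (simp add: field_simps)
    then have "\<bar>1 / ?a - 1 / ?b\<bar> = \<bar>?a - ?b\<bar> / (?a * ?b)" by (simp add: abs_minus_commute)
    also have "\<dots> \<le> \<bar>?a - ?b\<bar> / 1"
    proof (rule divide_left_mono)
      have "1 * 1 \<le> ?a * ?b" by (intro mult_mono) auto
      then show "1 \<le> ?a * ?b" by simp
    qed auto
    also have "\<dots> \<le> lip_const (\<lambda>x. max 1 (N x)) * dist x y" using lip_constD[OF N, of x y] by simp
    finally show "\<bar>1 / ?a - 1 / ?b\<bar> \<le> lip_const (\<lambda>x. max 1 (N x)) * dist x y" .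
  qed (simp add: field_simps)
  from Lipb_mult[OF assms(1) this] show ?thesis by simp
qed

text \<open>
  Approximating the indicators of a partition one at a time spoils the bound \<open>1\<close> for the sum. Dividing
  by the excess restores this bound and at most doubles the total error.
\<close>

lemma normalize_close:
  fixes f :: "'i \<Rightarrow> real"
  assumes "finite R" "\<And>i. i \<in> R \<Longrightarrow> 0 \<le> f i" "(\<Sum>i\<in>R. k i) = 1"
  defines "N \<equiv> max 1 (\<Sum>i\<in>R. f i)"
  shows "(\<Sum>i\<in>R. \<bar>f i / N - k i\<bar>) \<le> 2 * (\<Sum>i\<in>R. \<bar>f i - k i\<bar>)"
proof -
  have N: "1 \<le> N" by (simp add: N_def)
  have "(\<Sum>i\<in>R. \<bar>f i / N - k i\<bar>) \<le> (\<Sum>i\<in>R. (f i - f i / N) + \<bar>f i - k i\<bar>)"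
  proof (rule sum_mono)
    fix i assume "i \<in> R"
    then have "0 \<le> f i" by (rule assms(2))
    then have "f i / N \<le> f i" using N mult_left_mono[of 1 N "f i"] by (simp add: divide_le_eq)
    then show "\<bar>f i / N - k i\<bar> \<le> (f i - f i / N) + \<bar>f i - k i\<bar>" by linarith
  qed
  also have "\<dots> = ((\<Sum>i\<in>R. f i) - (\<Sum>i\<in>R. f i) / N) + (\<Sum>i\<in>R. \<bar>f i - k i\<bar>)"
    by (simp add: sum.distrib sum_subtractf sum_divide_distrib)
  also have "(\<Sum>i\<in>R. f i) - (\<Sum>i\<in>R. f i) / N \<le> N - 1"
  proof -
    have "(\<Sum>i\<in>R. f i) * (1 - 1 / N) \<le> N * (1 - 1 / N)"
      using N by (intro mult_right_mono) (auto simp: N_def)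
    then show ?thesis using N by (simp add: right_diff_distrib)
  qed
  also have "N - 1 \<le> \<bar>(\<Sum>i\<in>R. f i) - (\<Sum>i\<in>R. k i)\<bar>" using assms(3) by (simp add: N_def)
  also have "\<dots> \<le> (\<Sum>i\<in>R. \<bar>f i - k i\<bar>)" by (simp add: sum_subtractf[symmetric] sum_abs)
  finally show ?thesis by simp
qed

context mass_bounded
begin

text \<open>
  On each piece of the partition of an almost maximal selection the indicator is replaced by a
  Lipschitz function. For pointwise limits of currents such finite sums pass to the limit, which makes
  the mass lower semicontinuous.
\<close>

lemma mass_formula:
  assumes "0 < e"
  obtains R f where "finite R" "R \<subseteq> Lip1" "\<And>\<pi>. \<pi> \<in> R \<Longrightarrow> f \<pi> \<in> Lipb_funs"
    "\<And>x. (\<Sum>\<pi>\<in>R. \<bar>f \<pi> x\<bar>) \<le> 1" "mass T - e < (\<Sum>\<pi>\<in>R. T (f \<pi>, \<pi>))"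
proof -
  obtain s where s: "selection s" "top_mass - e / 2 < (LINT x|\<mu>. sel_dens s x)"
    using top_mass_approx[of "e / 2"] assms by auto
  define R where "R = range s"
  have fin: "finite R" unfolding R_def by (rule selection_finite[OF s(1)])
  have RL: "R \<subseteq> Lip1" using selection_Lip1[OF s(1)] by (auto simp: R_def)
  have A: "s -` {\<pi>} \<in> sets borel" for \<pi> by (rule selection_sets[OF s(1)])
  define d where "d = e / (4 * (real (card R) + 1))"
  have "0 < d" using assms by (simp add: d_def)
  have "\<forall>\<pi>. \<exists>f. f \<in> Lipb_funs \<and> (\<forall>x. 0 \<le> f x) \<and> (LINT x|\<mu>. \<bar>f x - indicator (s -` {\<pi>}) x\<bar>) < d"
    using indicator_approx[OF fbm fbm A \<open>0 < d\<close>] by metis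
  then obtain f where f: "\<And>\<pi>. f \<pi> \<in> Lipb_funs" "\<And>\<pi> x. 0 \<le> f \<pi> x"
    "\<And>\<pi>. (LINT x|\<mu>. \<bar>f \<pi> x - indicator (s -` {\<pi>}) x\<bar>) < d" by metis
  define h where "h \<pi> x = f \<pi> x / max 1 (\<Sum>\<rho>\<in>R. f \<rho> x)" for \<pi> x
  have h: "h \<pi> \<in> Lipb_funs" for \<pi>
  proof -
    have "(\<lambda>x. f \<pi> x / max 1 (\<Sum>\<rho>\<in>R. f \<rho> x)) \<in> Lipb_funs"
      by (intro Lipb_divide_max1 Lipb_sum f)
    then show ?thesis by (simp add: h_def[abs_def])
  qed
  have h1: "(\<Sum>\<pi>\<in>R. \<bar>h \<pi> x\<bar>) \<le> 1" for x
  proof -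
    have "(\<Sum>\<pi>\<in>R. \<bar>h \<pi> x\<bar>) = (\<Sum>\<pi>\<in>R. f \<pi> x) / max 1 (\<Sum>\<rho>\<in>R. f \<rho> x)"
      using f(2) by (simp add: h_def sum_divide_distrib abs_of_nonneg divide_nonneg_pos)
    also have "\<dots> \<le> 1" by (simp add: divide_le_eq)
    finally show ?thesis .
  qed
  let ?k = "\<lambda>\<pi> x. indicator (s -` {\<pi>}) x :: real"
  have ik: "integrable \<mu> (?k \<pi>)" for \<pi> by (rule integrable_indicator_real[OF A])
  have one: "(\<Sum>\<pi>\<in>R. ?k \<pi> x) = 1" for x
  proof -
    have "(\<Sum>\<pi>\<in>R. ?k \<pi> x) = (\<Sum>\<pi>\<in>R. if \<pi> = s x then 1 else 0)"
      by (intro sum.cong) (auto simp: indicator_def)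
    also have "\<dots> = 1" using fin by (simp add: R_def)
    finally show ?thesis .
  qed
  have ihk: "integrable \<mu> (\<lambda>x. \<bar>h \<pi> x - ?k \<pi> x\<bar>)" and ifk: "integrable \<mu> (\<lambda>x. \<bar>f \<pi> x - ?k \<pi> x\<bar>)" for \<pi>
    by (intro integrable_Lipb_diff h f ik)+
  have "(\<Sum>\<pi>\<in>R. LINT x|\<mu>. \<bar>h \<pi> x - ?k \<pi> x\<bar>) = (LINT x|\<mu>. (\<Sum>\<pi>\<in>R. \<bar>h \<pi> x - ?k \<pi> x\<bar>))"
    by (intro Bochner_Integration.integral_sum[symmetric] ihk)
  also have "\<dots> \<le> (LINT x|\<mu>. 2 * (\<Sum>\<pi>\<in>R. \<bar>f \<pi> x - ?k \<pi> x\<bar>))"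
    unfolding h_def
  proof (rule integral_mono)
    show "integrable \<mu> (\<lambda>x. \<Sum>\<pi>\<in>R. \<bar>f \<pi> x / max 1 (\<Sum>\<rho>\<in>R. f \<rho> x) - ?k \<pi> x\<bar>)"
      using ihk unfolding h_def by (intro Bochner_Integration.integrable_sum)
    show "integrable \<mu> (\<lambda>x. 2 * (\<Sum>\<pi>\<in>R. \<bar>f \<pi> x - ?k \<pi> x\<bar>))"
      by (intro integrable_mult_right Bochner_Integration.integrable_sum ifk)
  qed (intro normalize_close fin f(2) one)
  also have "\<dots> = 2 * (\<Sum>\<pi>\<in>R. LINT x|\<mu>. \<bar>f \<pi> x - ?k \<pi> x\<bar>)"
    by (simp add: Bochner_Integration.integral_sum ifk)
  also have "\<dots> \<le> 2 * (\<Sum>\<pi>\<in>R. d)"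
    using f(3) by (intro mult_left_mono sum_mono) (auto intro: less_imp_le)
  also have "\<dots> \<le> e / 2" using assms by (simp add: d_def field_simps)
  finally have close: "(\<Sum>\<pi>\<in>R. LINT x|\<mu>. \<bar>h \<pi> x - ?k \<pi> x\<bar>) \<le> e / 2" .
  have "(LINT x|\<mu>. ?k \<pi> x * dens \<pi> x) \<le> T (h \<pi>, \<pi>) + (LINT x|\<mu>. \<bar>h \<pi> x - ?k \<pi> x\<bar>)" if "\<pi> \<in> R" for \<pi>
  proof -
    have \<pi>: "\<pi> \<in> Lip1" using that RL by auto
    have i: "integrable \<mu> (\<lambda>x. h \<pi> x * dens \<pi> x)"
      using dens(1,2)[OF \<pi>] h by (intro integrable_bounded_mult) auto
    have "(LINT x|\<mu>. ?k \<pi> x * dens \<pi> x) \<le> (LINT x|\<mu>. h \<pi> x * dens \<pi> x + \<bar>h \<pi> x - ?k \<pi> x\<bar>)"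
    proof (rule integral_mono)
      show "integrable \<mu> (\<lambda>x. ?k \<pi> x * dens \<pi> x)"
        using dens(1,2)[OF \<pi>] ik by (intro integrable_bounded_mult) auto
      show "integrable \<mu> (\<lambda>x. h \<pi> x * dens \<pi> x + \<bar>h \<pi> x - ?k \<pi> x\<bar>)"
        by (rule Bochner_Integration.integrable_add[OF i ihk])
      fix x
      have "\<bar>(h \<pi> x - ?k \<pi> x) * dens \<pi> x\<bar> \<le> \<bar>h \<pi> x - ?k \<pi> x\<bar>"
        using dens(2)[OF \<pi>, of x] by (simp add: abs_mult mult_left_le)
      then show "?k \<pi> x * dens \<pi> x \<le> h \<pi> x * dens \<pi> x + \<bar>h \<pi> x - ?k \<pi> x\<bar>"
        by (simp add: left_diff_distrib abs_le_iff)
    qed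
    also have "\<dots> = T (h \<pi>, \<pi>) + (LINT x|\<mu>. \<bar>h \<pi> x - ?k \<pi> x\<bar>)"
      by (simp add: Bochner_Integration.integral_add[OF i ihk] dens(3)[OF \<pi> h])
    finally show ?thesis .
  qed
  then have "(\<Sum>\<pi>\<in>R. LINT x|\<mu>. ?k \<pi> x * dens \<pi> x) \<le> (\<Sum>\<pi>\<in>R. T (h \<pi>, \<pi>) + (LINT x|\<mu>. \<bar>h \<pi> x - ?k \<pi> x\<bar>))"
    by (rule sum_mono)
  moreover have "(LINT x|\<mu>. sel_dens s x) = (\<Sum>\<pi>\<in>R. LINT x|\<mu>. ?k \<pi> x * dens \<pi> x)"
    using sel_dens_integral[OF s(1), of UNIV] by (simp add: R_def)
  ultimately have "mass T - e < (\<Sum>\<pi>\<in>R. T (h \<pi>, \<pi>))"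
    using s(2) close by (simp add: sum.distrib mass_measure_props(3))
  then show thesis using that[OF fin RL h h1] by blast
qed

end

subsection \<open>The mass of a curve\<close>

lemma curve_mass_bounded:
  fixes c :: "'a::polish_space curve"
  assumes c: "lipschitz_curve c"
  obtains \<mu> where "mass_bounded \<mu> (curve_current c)" "measure \<mu> UNIV = clen c"
proof -
  let ?I = "{0..clen c}"
  let ?M = "restrict_space lborel ?I"
  have nn: "0 \<le> clen c" by (rule lipschitz_curve_nonneg[OF c])
  have cont: "continuous_on ?I (cpoint c)"
  proof (rule lipschitz_on_continuous_on[of 1], rule lipschitz_onI)
    fix s t assume "s \<in> ?I" "t \<in> ?I"
    then show "dist (cpoint c s) (cpoint c t) \<le> 1 * dist s t"
      using c by (simp add: lipschitz_curve_def dist_real_def)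
  qed simp
  have meas [measurable]: "cpoint c \<in> measurable ?M borel"
    using borel_measurable_continuous_on_restrict[OF cont]
    by (simp add: measurable_def sets_restrict_space space_restrict_space)
  define \<mu> where "\<mu> = distr ?M borel (cpoint c)"
  have em: "emeasure \<mu> UNIV = ennreal (clen c)"
    unfolding \<mu>_def using nn by (subst emeasure_distr) (auto simp: emeasure_restrict_space space_restrict_space)
  have fin: "finite_measure \<mu>" by (rule finite_measureI) (simp add: \<mu>_def em[unfolded \<mu>_def])
  have int: "(LINT x|\<mu>. h x) = arc_integral c h" if h: "h \<in> Lip_funs" for h
  proof -
    have hm [measurable]: "h \<in> borel_measurable borel" by (rule Lip_funs_measurable[OF h])
    have cont: "continuous_on ?I (\<lambda>t. h (cpoint c t))"
      by (rule lipschitz_on_continuous_on[OF Lip_along_curve[OF c h]])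
    have "(LINT x|\<mu>. h x) = (LINT t|?M. h (cpoint c t))"
      unfolding \<mu>_def by (rule integral_distr) measurable
    also have "\<dots> = (LINT t:?I|lborel. h (cpoint c t))"
      unfolding set_lebesgue_integral_def by (rule integral_restrict_space) simp
    also have "\<dots> = integral ?I (\<lambda>t. h (cpoint c t))"
      by (rule set_borel_integral_eq_integral(2)[OF borel_integrable_atLeastAtMost'[OF cont]])
    finally show ?thesis by (simp add: arc_integral_def)
  qed
  have "mass_bound (curve_current c) \<mu>"
    unfolding mass_bound_def
  proof (intro conjI fin)
    show "sets \<mu> = sets borel" by (simp add: \<mu>_def)
    show "\<forall>(f, \<pi>)\<in>D1. \<bar>curve_current c (f, \<pi>)\<bar> \<le> lip_const \<pi> * (LINT x|\<mu>. \<bar>f x\<bar>)"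
      using curve_current_bound[OF c] by (auto simp: D1_def int Lip_abs)
  qed
  then have "mass_bounded \<mu> (curve_current c)"
    using curve_current_bilinear[OF c] mass_bound_fbm
    by (simp add: mass_bounded_def mass_bounded_axioms_def)
  moreover have "measure \<mu> UNIV = clen c" using em nn by (simp add: measure_def)
  ultimately show thesis using that by blast
qed

lemma curve_mass_le_length:
  fixes c :: "'a::polish_space curve"
  assumes "lipschitz_curve c"
  shows "mass (curve_current c) \<le> clen c"
proof -
  obtain \<mu> where \<mu>: "mass_bounded \<mu> (curve_current c)" "measure \<mu> UNIV = clen c"
    by (rule curve_mass_bounded[OF assms])
  interpret mass_bounded \<mu> "curve_current c" by fact
  interpret m: finite_borel_measure "mass_measure (curve_current c)"
    by (rule mass_bound_fbm[OF mass_measure_props(1)])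
  have "emeasure (mass_measure (curve_current c)) UNIV \<le> emeasure \<mu> UNIV"
    by (rule mass_measure_props(2)[OF bound]) simp
  then show ?thesis
    using \<mu>(2) lipschitz_curve_nonneg[OF assms]
    by (simp add: mass_def m.emeasure_eq_measure emeasure_eq_measure)
qed

text \<open>The easy half of the mass formula; it bounds the masses of the approximating curves from below.\<close>

lemma curve_mass_ge:
  fixes c :: "'a::polish_space curve"
  assumes c: "lipschitz_curve c" and R: "finite R" "R \<subseteq> Lip1" "\<And>\<pi>. \<pi> \<in> R \<Longrightarrow> f \<pi> \<in> Lipb_funs"
    and le: "\<And>x. (\<Sum>\<pi>\<in>R. \<bar>f \<pi> x\<bar>) \<le> 1"
  shows "(\<Sum>\<pi>\<in>R. curve_current c (f \<pi>, \<pi>)) \<le> mass (curve_current c)"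
proof -
  obtain \<mu> where \<mu>: "mass_bounded \<mu> (curve_current c)" "measure \<mu> UNIV = clen c"
    by (rule curve_mass_bounded[OF c])
  interpret mass_bounded \<mu> "curve_current c" by fact
  let ?m = "mass_measure (curve_current c)"
  note mb = mass_measure_props(1)
  interpret m: finite_borel_measure ?m by (rule mass_bound_fbm[OF mb])
  have "(\<Sum>\<pi>\<in>R. curve_current c (f \<pi>, \<pi>)) \<le> (\<Sum>\<pi>\<in>R. LINT x|?m. \<bar>f \<pi> x\<bar>)"
  proof (rule sum_mono)
    fix \<pi> assume \<pi>: "\<pi> \<in> R"
    then have p: "\<pi> \<in> Lip_funs" "lip_const \<pi> \<le> 1" using R(2) by (auto simp: Lip1_def)
    have "lip_const \<pi> * (LINT x|?m. \<bar>f \<pi> x\<bar>) \<le> 1 * (LINT x|?m. \<bar>f \<pi> x\<bar>)"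
      using p(2) by (intro mult_right_mono Bochner_Integration.integral_nonneg) auto
    then show "curve_current c (f \<pi>, \<pi>) \<le> (LINT x|?m. \<bar>f \<pi> x\<bar>)"
      using mass_boundD[OF mb R(3)[OF \<pi>] p(1)] by linarith
  qed
  also have "\<dots> = (LINT x|?m. (\<Sum>\<pi>\<in>R. \<bar>f \<pi> x\<bar>))"
    using R(3) by (intro Bochner_Integration.integral_sum[symmetric] m.integrable_Lipb Lipb_abs)
  also have "\<dots> \<le> (LINT x|?m. 1)"
    using R(3) le by (intro integral_mono Bochner_Integration.integrable_sum m.integrable_Lipb Lipb_abs) auto
  also have "\<dots> = mass (curve_current c)" by (simp add: mass_def)
  finally show ?thesis .
qed

section \<open>Closed curves that are nearly optimal for a given form\<close>

lemma current_eq_if_eq_on_open: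
  assumes T: "bilinear_on_D1 T" "current_local T" and g: "g \<in> Lipb_funs"
    and \<pi>: "\<pi> \<in> Lip_funs" "\<rho> \<in> Lip_funs"
    and U: "open U" "{x. g x \<noteq> 0} \<subseteq> U" "\<And>x. x \<in> U \<Longrightarrow> \<pi> x = \<rho> x"
  shows "T (g, \<pi>) = T (g, \<rho>)"
proof -
  have d: "(\<lambda>x. \<pi> x - \<rho> x) \<in> Lip_funs" by (intro Lip_diff \<pi>)
  have "(\<lambda>x. \<pi> x - \<rho> x) constant_on U" unfolding constant_on_def using U(3) by auto
  then have "T (g, \<lambda>x. \<pi> x - \<rho> x) = 0"
    using T(2) g d U(1,2) unfolding current_local_def by blast
  then show ?thesis using bilinear_simps(9)[OF T(1) g \<pi>(1) \<pi>(2)] by simp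
qed

text \<open>
  On a ball of radius \<open>r\<close> the coefficients \<open>f\<close> are almost constant, so that the form \<open>\<Sum> f d\<pi>\<close> is almost the
  differential of one function, whose Lipschitz constant on the ball is almost \<open>k\<close>; locality permits
  replacing this function by its McShane extension. A Lipschitz partition of unity subordinate to
  countably many balls puts the local estimates together, and \<open>r\<close> tends to \<open>0\<close>.
\<close>

lemma current_le_integral:
  fixes T :: "'a::polish_space form \<Rightarrow> real"
  assumes T: "bilinear_on_D1 T" "current_local T" and mb: "mass_bound T \<mu>"
    and f: "\<And>j. j \<in> J \<Longrightarrow> f j \<in> Lipb_funs" and \<pi>: "\<And>j. j \<in> J \<Longrightarrow> \<pi> j \<in> Lip_funs"
    and k: "k \<in> Lipb_funs" and C: "0 \<le> C"
    and le: "\<And>p r x y. 0 < r \<Longrightarrow> dist x p < r \<Longrightarrow> dist y p < r \<Longrightarrow>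
      (\<Sum>j\<in>J. f j p * (\<pi> j y - \<pi> j x)) \<le> (k p + C * r) * dist x y"
    and nontrivial: "\<And>(p::'a) r. 0 < r \<Longrightarrow> \<exists>x y. dist x p < r \<and> dist y p < r \<and> x \<noteq> y"
  shows "(\<Sum>j\<in>J. T (f j, \<pi> j)) \<le> (LINT x|\<mu>. k x)"
proof -
  interpret finite_borel_measure \<mu> by (rule mass_bound_fbm[OF mb])
  define D where "D = C + lip_const k + (\<Sum>j\<in>J. lip_const (\<pi> j) * lip_const (f j))"
  have main: "(\<Sum>j\<in>J. T (f j, \<pi> j)) \<le> (LINT x|\<mu>. k x + D * r)" if r: "0 < r" for r
  proof -
    (* The running maxima m n of the cutoffs increase to 1; their increments g are the partition of unity. *)
    define b where "b i = bump (dense_seq i :: 'a) r" for i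
    define m where "m = rec_nat (\<lambda>_. 0) (\<lambda>n u x. max (u x) (b n x))"
    have m_0: "m 0 = (\<lambda>_. 0)" and m_Suc: "m (Suc n) = (\<lambda>x. max (m n x) (b n x))" for n
      by (simp_all add: m_def)
    have mL: "m n \<in> Lipb_funs" for n
      by (induction n) (auto simp: m_0 m_Suc b_def intro: Lipb_max bump_Lipb)
    have m01: "0 \<le> m n x" "m n x \<le> 1" for n x
      by (induction n) (auto simp: m_0 m_Suc b_def bump_range)
    have m_mono: "n \<le> n' \<Longrightarrow> m n x \<le> m n' x" for n n' x
      by (induction rule: dec_induct) (auto simp: m_Suc)
    have m_lim: "(\<lambda>n. m n x) \<longlonglongrightarrow> 1" for x
    proof -
      obtain i where i: "dist x (dense_seq i) < r / 2" using dense_seq_dist[of "r / 2" x] r by auto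
      have "m n x = 1" if "Suc i \<le> n" for n
      proof -
        have "1 \<le> m (Suc i) x" using bump_eq_1[OF r, of x "dense_seq i"] i by (simp add: m_Suc b_def)
        then show ?thesis using m_mono[OF that, of x] m01(2)[of n x] by linarith
      qed
      then show ?thesis by (intro tendsto_eventually eventually_sequentiallyI)
    qed
    define g where "g i x = m (Suc i) x - m i x" for i x
    have gL: "g i \<in> Lipb_funs" for i
      using Lipb_diff[OF mL[of "Suc i"] mL[of i]] by (simp add: g_def[abs_def])
    have g0: "0 \<le> g i x" for i x using m_mono[of i "Suc i" x] by (simp add: g_def)
    have g_supp: "dist x (dense_seq i) < r" if "g i x \<noteq> 0" for i x
    proof -
      have "b i x \<noteq> 0" using that m01(1)[of i x] by (auto simp: g_def m_Suc max_def split: if_splits)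
      then show ?thesis unfolding b_def by (rule bump_support[OF r])
    qed
    have m_sum: "m n x = (\<Sum>i<n. g i x)" for n x
      by (induction n) (simp_all add: m_0 g_def)
    have local: "(\<Sum>j\<in>J. T (\<lambda>x. g i x * f j x, \<pi> j)) \<le> (LINT x|\<mu>. g i x * (k x + D * r))" for i
    proof -
      define e where "e = (dense_seq i :: 'a)"
      define I where "I = (LINT x|\<mu>. g i x)"
      have I0: "0 \<le> I" unfolding I_def by (rule Bochner_Integration.integral_nonneg) (rule g0)
      define \<kappa> where "\<kappa> = k e + C * r"
      define \<Psi> where "\<Psi> = (\<lambda>x. \<Sum>j\<in>J. f j e * \<pi> j x)"
      have \<Psi>L: "\<Psi> \<in> Lip_funs" unfolding \<Psi>_def by (intro Lip_sum Lip_cmult \<pi>)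
      have \<Psi>_le: "\<Psi> y - \<Psi> x \<le> \<kappa> * dist x y" if "dist x e < r" "dist y e < r" for x y
        using le[OF r that] by (simp add: \<Psi>_def \<kappa>_def right_diff_distrib sum_subtractf)
      have \<kappa>0: "0 \<le> \<kappa>"
      proof -
        obtain x y where xy: "dist x e < r" "dist y e < r" "x \<noteq> y" using nontrivial[OF r] by blast
        have "0 \<le> 2 * (\<kappa> * dist x y)"
          using \<Psi>_le[OF xy(1,2)] \<Psi>_le[OF xy(2,1)] by (simp add: dist_commute)
        then show ?thesis using xy(3) by (simp add: zero_le_mult_iff)
      qed
      obtain v where v: "\<And>x. x \<in> ball e r \<Longrightarrow> v x = \<Psi> x" "\<And>x y. \<bar>v x - v y\<bar> \<le> \<kappa> * dist x y"
      proof (rule McShane_extension[OF \<kappa>0, of "ball e r" \<Psi>])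
        show "ball e r \<noteq> {}" using r by simp
        show "\<Psi> y - \<Psi> x \<le> \<kappa> * dist x y" if "x \<in> ball e r" "y \<in> ball e r" for x y
          using that by (intro \<Psi>_le) (simp_all add: dist_commute)
      qed blast
      have vL: "v \<in> Lip_funs" by (rule Lip_funsI[of _ \<kappa>]) (rule v(2))
      have "T (g i, \<Psi>) = T (g i, v)"
        by (rule current_eq_if_eq_on_open[OF T gL \<Psi>L vL, of "ball e r"])
          (use g_supp v(1) in \<open>auto simp: e_def dist_commute\<close>)
      also have "\<dots> \<le> lip_const v * (LINT x|\<mu>. \<bar>g i x\<bar>)"
        using mass_boundD[OF mb gL vL, of i] by linarith
      also have "\<dots> \<le> \<kappa> * I"
        using lip_const_leI[OF \<kappa>0 v(2)] I0 g0 by (simp add: I_def mult_right_mono)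
      finally have 1: "T (g i, \<Psi>) \<le> \<kappa> * I" .
      have 2: "T (\<lambda>x. g i x * f j x, \<pi> j) \<le> f j e * T (g i, \<pi> j) + lip_const (\<pi> j) * lip_const (f j) * r * I"
        if j: "j \<in> J" for j
      proof -
        let ?w = "\<lambda>x. g i x * (f j x - f j e)"
        have wL: "?w \<in> Lipb_funs" by (intro Lipb_mult gL Lipb_diff f j) auto
        have "(\<lambda>x. g i x * f j x) = (\<lambda>x. f j e * g i x + 1 * ?w x)" by (simp add: algebra_simps)
        then have "T (\<lambda>x. g i x * f j x, \<pi> j) = f j e * T (g i, \<pi> j) + T (?w, \<pi> j)"
          using bilinear_left[OF T(1) gL[of i] wL \<pi>[OF j], of "f j e" 1] by simp
        also have "T (?w, \<pi> j) \<le> lip_const (\<pi> j) * (LINT x|\<mu>. \<bar>?w x\<bar>)"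
          using mass_boundD[OF mb wL \<pi>[OF j]] by linarith
        also have "(LINT x|\<mu>. \<bar>?w x\<bar>) \<le> (LINT x|\<mu>. lip_const (f j) * r * g i x)"
        proof (rule integral_mono)
          show "integrable \<mu> (\<lambda>x. \<bar>?w x\<bar>)" by (intro integrable_Lipb Lipb_abs wL)
          show "integrable \<mu> (\<lambda>x. lip_const (f j) * r * g i x)" by (intro integrable_Lipb Lipb_cmult gL)
          fix x
          show "\<bar>?w x\<bar> \<le> lip_const (f j) * r * g i x"
          proof (cases "g i x = 0")
            case False
            have "\<bar>f j x - f j e\<bar> \<le> lip_const (f j) * dist x e" by (rule lip_constD[OF Lipb_Lip[OF f[OF j]]])
            also have "\<dots> \<le> lip_const (f j) * r"
              using g_supp[OF False] by (intro mult_left_mono lip_const_nonneg Lipb_Lip f j) (simp add: e_def)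
            finally show ?thesis using g0[of i x] by (simp add: abs_mult mult.commute mult_left_mono)
          qed simp
        qed
        then have "lip_const (\<pi> j) * (LINT x|\<mu>. \<bar>?w x\<bar>) \<le> lip_const (\<pi> j) * (lip_const (f j) * r * I)"
          by (intro mult_left_mono lip_const_nonneg \<pi> j) (simp add: I_def)
        finally show ?thesis by (simp add: mult.assoc)
      qed
      have "(\<Sum>j\<in>J. T (\<lambda>x. g i x * f j x, \<pi> j))
          \<le> (\<Sum>j\<in>J. f j e * T (g i, \<pi> j) + lip_const (\<pi> j) * lip_const (f j) * r * I)"
        by (rule sum_mono) (rule 2)
      also have "\<dots> = T (g i, \<Psi>) + (\<Sum>j\<in>J. lip_const (\<pi> j) * lip_const (f j)) * r * I"
      proof -
        have "T (g i, \<Psi>) = (\<Sum>j\<in>J. T (g i, \<lambda>x. f j e * \<pi> j x))"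
          unfolding \<Psi>_def by (intro bilinear_sum_right[OF T(1) gL] Lip_cmult \<pi>)
        also have "\<dots> = (\<Sum>j\<in>J. f j e * T (g i, \<pi> j))"
          by (intro sum.cong refl bilinear_simps(2)[OF T(1) gL] \<pi>)
        finally show ?thesis by (simp add: sum.distrib sum_distrib_right)
      qed
      also have "\<dots> \<le> \<kappa> * I + (\<Sum>j\<in>J. lip_const (\<pi> j) * lip_const (f j)) * r * I" using 1 by simp
      also have "\<dots> = (LINT x|\<mu>. g i x * (k e + (C + (\<Sum>j\<in>J. lip_const (\<pi> j) * lip_const (f j))) * r))"
        unfolding integral_mult_left_zero I_def \<kappa>_def by (simp add: algebra_simps)
      also have "\<dots> \<le> (LINT x|\<mu>. g i x * (k x + D * r))"
      proof (rule integral_mono)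
        show "integrable \<mu> (\<lambda>x. g i x * (k e + (C + (\<Sum>j\<in>J. lip_const (\<pi> j) * lip_const (f j))) * r))"
          by (intro integrable_Lipb Lipb_mult gL) auto
        show "integrable \<mu> (\<lambda>x. g i x * (k x + D * r))"
          by (intro integrable_Lipb Lipb_mult Lipb_add gL k) auto
        fix x
        show "g i x * (k e + (C + (\<Sum>j\<in>J. lip_const (\<pi> j) * lip_const (f j))) * r) \<le> g i x * (k x + D * r)"
        proof (cases "g i x = 0")
          case False
          have "\<bar>k x - k e\<bar> \<le> lip_const k * dist x e" by (rule lip_constD[OF Lipb_Lip[OF k]])
          also have "\<dots> \<le> lip_const k * r"
            using g_supp[OF False] by (intro mult_left_mono lip_const_nonneg Lipb_Lip k) (simp add: e_def)
          finally have "k e \<le> k x + lip_const k * r" by linarith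
          then show ?thesis by (intro mult_left_mono g0) (simp add: D_def distrib_right)
        qed simp
      qed
      finally show ?thesis .
    qed
    have partial: "(\<Sum>j\<in>J. T (\<lambda>x. m n x * f j x, \<pi> j)) \<le> (LINT x|\<mu>. m n x * (k x + D * r))" for n
    proof -
      have "(\<Sum>j\<in>J. T (\<lambda>x. m n x * f j x, \<pi> j)) = (\<Sum>j\<in>J. \<Sum>i<n. T (\<lambda>x. g i x * f j x, \<pi> j))"
      proof (rule sum.cong[OF refl])
        fix j assume j: "j \<in> J"
        have "(\<lambda>x. m n x * f j x) = (\<lambda>x. \<Sum>i<n. g i x * f j x)"
          by (simp add: m_sum sum_distrib_right)
        then show "T (\<lambda>x. m n x * f j x, \<pi> j) = (\<Sum>i<n. T (\<lambda>x. g i x * f j x, \<pi> j))"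
          using bilinear_sum_left[OF T(1) \<pi>[OF j], of "{..<n}" "\<lambda>i x. g i x * f j x"]
          by (simp add: Lipb_mult gL f j)
      qed
      also have "\<dots> = (\<Sum>i<n. \<Sum>j\<in>J. T (\<lambda>x. g i x * f j x, \<pi> j))" by (rule sum.swap)
      also have "\<dots> \<le> (\<Sum>i<n. LINT x|\<mu>. g i x * (k x + D * r))" by (intro sum_mono local)
      also have "\<dots> = (LINT x|\<mu>. (\<Sum>i<n. g i x * (k x + D * r)))"
        by (intro Bochner_Integration.integral_sum[symmetric] integrable_Lipb Lipb_mult Lipb_add gL k) auto
      also have "\<dots> = (LINT x|\<mu>. m n x * (k x + D * r))" by (simp add: m_sum sum_distrib_right)
      finally show ?thesis .
    qed
    have dom: "(\<lambda>n. LINT x|\<mu>. m n x * u x) \<longlonglongrightarrow> (LINT x|\<mu>. u x)" if u: "u \<in> Lipb_funs" for u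
    proof -
      have [measurable]: "u \<in> borel_measurable borel" "m n \<in> borel_measurable borel" for n
        using u mL by (auto intro: Lipb_measurable)
      have "(\<lambda>n. LINT x|\<mu>. m n x * u x) \<longlonglongrightarrow> (LINT x|\<mu>. 1 * u x)"
      proof (rule integral_dominated_convergence[where w = "\<lambda>x. \<bar>u x\<bar>"])
        show "AE x in \<mu>. (\<lambda>n. m n x * u x) \<longlonglongrightarrow> 1 * u x"
          by (intro AE_I2 tendsto_mult m_lim tendsto_const)
        show "AE x in \<mu>. norm (m n x * u x) \<le> \<bar>u x\<bar>" for n
          using m01[of n] by (intro AE_I2) (simp add: abs_mult mult_left_le_one_le)
        show "integrable \<mu> (\<lambda>x. \<bar>u x\<bar>)" by (intro integrable_Lipb Lipb_abs u)
      qed measurable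
      then show ?thesis by simp
    qed
    have "(\<lambda>n. \<Sum>j\<in>J. T (\<lambda>x. m n x * f j x, \<pi> j)) \<longlonglongrightarrow> (\<Sum>j\<in>J. T (f j, \<pi> j))"
    proof (rule tendsto_sum)
      fix j assume j: "j \<in> J"
      have mf: "(\<lambda>x. m n x * f j x) \<in> Lipb_funs" for n by (intro Lipb_mult mL f j)
      show "(\<lambda>n. T (\<lambda>x. m n x * f j x, \<pi> j)) \<longlonglongrightarrow> T (f j, \<pi> j)"
      proof (rule Lim_null[THEN iffD2], rule Lim_null_comparison)
        have "\<bar>T (\<lambda>x. m n x * f j x, \<pi> j) - T (f j, \<pi> j)\<bar> \<le> lip_const (\<pi> j) * ((LINT x|\<mu>. \<bar>f j x\<bar>) - (LINT x|\<mu>. m n x * \<bar>f j x\<bar>))" for n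
        proof -
          have "T (\<lambda>x. m n x * f j x, \<pi> j) - T (f j, \<pi> j) = T (\<lambda>x. m n x * f j x - f j x, \<pi> j)"
            by (rule bilinear_simps(7)[OF T(1) mf \<pi>[OF j] f[OF j], symmetric])
          then have "\<bar>T (\<lambda>x. m n x * f j x, \<pi> j) - T (f j, \<pi> j)\<bar> \<le> lip_const (\<pi> j) * (LINT x|\<mu>. \<bar>m n x * f j x - f j x\<bar>)"
            using mass_boundD[OF mb Lipb_diff[OF mf f[OF j]] \<pi>[OF j], of n] by simp
          also have "(LINT x|\<mu>. \<bar>m n x * f j x - f j x\<bar>) = (LINT x|\<mu>. \<bar>f j x\<bar> - m n x * \<bar>f j x\<bar>)"
          proof (rule Bochner_Integration.integral_cong[OF refl])
            fix x
            have "m n x * f j x - f j x = - ((1 - m n x) * f j x)" by (simp add: algebra_simps)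
            then have "\<bar>m n x * f j x - f j x\<bar> = (1 - m n x) * \<bar>f j x\<bar>"
              using m01(2)[of n x] by (simp only: abs_minus_cancel abs_mult abs_of_nonneg diff_ge_0_iff_ge)
            then show "\<bar>m n x * f j x - f j x\<bar> = \<bar>f j x\<bar> - m n x * \<bar>f j x\<bar>" by (simp add: left_diff_distrib)
          qed
          also have "\<dots> = (LINT x|\<mu>. \<bar>f j x\<bar>) - (LINT x|\<mu>. m n x * \<bar>f j x\<bar>)"
            by (intro Bochner_Integration.integral_diff integrable_Lipb Lipb_abs Lipb_mult mL f j)
          finally show ?thesis .
        qed
        then show "\<forall>\<^sub>F n in sequentially. norm (T (\<lambda>x. m n x * f j x, \<pi> j) - T (f j, \<pi> j))
            \<le> lip_const (\<pi> j) * ((LINT x|\<mu>. \<bar>f j x\<bar>) - (LINT x|\<mu>. m n x * \<bar>f j x\<bar>))" by simp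
        have "(\<lambda>n. lip_const (\<pi> j) * ((LINT x|\<mu>. \<bar>f j x\<bar>) - (LINT x|\<mu>. m n x * \<bar>f j x\<bar>)))
            \<longlonglongrightarrow> lip_const (\<pi> j) * ((LINT x|\<mu>. \<bar>f j x\<bar>) - (LINT x|\<mu>. \<bar>f j x\<bar>))"
          by (intro tendsto_mult tendsto_diff tendsto_const dom Lipb_abs f j)
        then show "(\<lambda>n. lip_const (\<pi> j) * ((LINT x|\<mu>. \<bar>f j x\<bar>) - (LINT x|\<mu>. m n x * \<bar>f j x\<bar>))) \<longlonglongrightarrow> 0" by simp
      qed
    qed
    moreover have "(\<lambda>n. LINT x|\<mu>. m n x * (k x + D * r)) \<longlonglongrightarrow> (LINT x|\<mu>. k x + D * r)"
      by (intro dom Lipb_add k) auto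
    ultimately show ?thesis by (rule LIMSEQ_le) (use partial in auto)
  qed
  have ev: "(\<Sum>j\<in>J. T (f j, \<pi> j)) \<le> (LINT x|\<mu>. k x) + D * measure \<mu> UNIV * (1 / real (Suc n))" for n
  proof -
    have "(LINT x|\<mu>. k x + D * (1 / real (Suc n))) = (LINT x|\<mu>. k x) + (LINT x|\<mu>. D * (1 / real (Suc n)))"
      by (intro Bochner_Integration.integral_add integrable_Lipb k) auto
    then show ?thesis using main[of "1 / real (Suc n)"] by (simp add: mult.commute)
  qed
  have "(\<lambda>n. (LINT x|\<mu>. k x) + D * measure \<mu> UNIV * (1 / real (Suc n))) \<longlonglongrightarrow> (LINT x|\<mu>. k x) + D * measure \<mu> UNIV * 0"
    by (intro tendsto_add tendsto_mult tendsto_const lim_1_over_n[THEN LIMSEQ_Suc])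
  then have "(\<Sum>j\<in>J. T (f j, \<pi> j)) \<le> (LINT x|\<mu>. k x) + D * measure \<mu> UNIV * 0"
    by (rule LIMSEQ_le_const) (use ev in auto)
  then show ?thesis by simp
qed

text \<open>
  The vanishing boundary is assumed on bounded functions, but the potential constructed below need not
  be bounded; truncation and the continuity axiom take care of it.
\<close>

lemma boundary_unbounded:
  assumes T: "current_continuous T" and b: "\<forall>f\<in>Lipb_funs. boundary T f = 0" and \<phi>: "\<phi> \<in> Lip_funs"
  shows "T (\<lambda>_. 1, \<phi>) = 0"
proof -
  define \<rho> where "\<rho> n x = max (- real n) (min (real n) (\<phi> x))" for n x
  have \<rho>lip: "\<bar>\<rho> n x - \<rho> n y\<bar> \<le> lip_const \<phi> * dist x y" for n x y
  proof -
    have "\<bar>max (- c) (min c s) - max (- c) (min c t)\<bar> \<le> \<bar>s - t\<bar>" for c s t :: real by linarith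
    from this[of "real n" "\<phi> x" "\<phi> y"] show ?thesis
      using lip_constD[OF \<phi>, of x y] unfolding \<rho>_def by linarith
  qed
  have \<rho>L: "\<rho> n \<in> Lip_funs" for n by (rule Lip_funsI[of _ "lip_const \<phi>"]) (rule \<rho>lip)
  have \<rho>b: "\<rho> n \<in> Lipb_funs" for n by (rule LipbI[OF \<rho>L, of n "real n"]) (simp add: \<rho>_def)
  have bdd: "bdd_above (range (\<lambda>n. lip_const (\<rho> n)))"
    by (rule bdd_aboveI2[of _ _ "lip_const \<phi>"]) (rule lip_const_leI[OF lip_const_nonneg[OF \<phi>] \<rho>lip])
  have lim: "(\<lambda>n. \<rho> n x) \<longlonglongrightarrow> \<phi> x" for x
  proof -
    obtain N :: nat where N: "\<bar>\<phi> x\<bar> \<le> real N" using real_arch_simple by blast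
    have "\<rho> n x = \<phi> x" if "N \<le> n" for n
    proof -
      have "\<bar>\<phi> x\<bar> \<le> real n" using N that by linarith
      then show ?thesis by (simp add: \<rho>_def)
    qed
    then show ?thesis by (intro tendsto_eventually eventually_sequentiallyI)
  qed
  have "(\<lambda>n. T (\<lambda>_. 1, \<rho> n)) \<longlonglongrightarrow> T (\<lambda>_. 1, \<phi>)"
    using T \<phi> \<rho>L bdd lim unfolding current_continuous_def by (metis Lipb_const)
  moreover have "T (\<lambda>_. 1, \<rho> n) = 0" for n using b \<rho>b by (simp add: boundary_def)
  ultimately show ?thesis by (simp add: LIMSEQ_const_iff)
qed

text \<open>
  Two points in every ball are what makes the local Lipschitz constant in \<open>current_le_integral\<close>
  nonnegative.
\<close>

lemma geodesic_space_ball: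
  assumes geo: "geodesic_space TYPE('a::metric_space)" and ab: "(a::'a) \<noteq> b" and r: "0 < r"
  shows "\<exists>x y. dist x (p::'a) < r \<and> dist y p < r \<and> x \<noteq> y"
proof -
  obtain z where z: "z \<noteq> p" using ab by metis
  obtain c where c: "geodesic c" "cstart c = p" "cend c = z" using geo unfolding geodesic_space_def by blast
  have iso: "dist (cpoint c s) (cpoint c t) = \<bar>s - t\<bar>" if "s \<in> {0..clen c}" "t \<in> {0..clen c}" for s t
    using c(1) that unfolding geodesic_def by blast
  have "clen c \<noteq> 0" using c z by (auto simp: cstart_def cend_def)
  then have L: "0 < clen c" using c(1) by (simp add: geodesic_def)
  define t where "t = min (r / 2) (clen c)"
  have t: "0 < t" "t < r" "t \<le> clen c" using r L by (auto simp: t_def)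
  have "dist (cpoint c t) p = t" using iso[of t 0] t c(2) by (simp add: cstart_def)
  then show ?thesis using t r by (intro exI[of _ p] exI[of _ "cpoint c t"]) auto
qed

text \<open>
  Let \<open>\<Lambda>\<close> be the lower bound claimed for the mean along the curve. If every closed curve missed it, then
  \<open>\<Lambda> ds - h ds - \<Sum> f d\<pi>\<close> would have nonnegative integrals along all closed curves. The infimum of its
  integrals along curves from a base point would be a Lipschitz function \<open>\<phi>\<close> with
  \<open>d\<phi> + \<Sum> f d\<pi> \<le> \<Lambda> - h\<close> infinitesimally; as \<open>T\<close> has no boundary, \<open>T\<close> does not see \<open>d\<phi>\<close>.
\<close>

lemma closed_curve_exists:
  fixes T :: "'a::polish_space form \<Rightarrow> real" and N :: nat
  assumes geo: "geodesic_space TYPE('a)" and ab: "(a::'a) \<noteq> b"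
    and T: "bilinear_on_D1 T" "current_local T" "current_continuous T" and mb: "mass_bound T \<mu>"
    and bd: "\<forall>f\<in>Lipb_funs. boundary T f = 0"
    and f: "\<And>j. j < N \<Longrightarrow> f j \<in> Lipb_funs" and \<pi>: "\<And>j. j < N \<Longrightarrow> \<pi> j \<in> Lip_funs"
    and h: "h \<in> Lipb_funs" and M: "0 < measure \<mu> UNIV" and \<eta>: "0 < \<eta>"
  obtains c where "piecewise_geodesic c" "closed_curve c" "0 < clen c"
    "((\<Sum>j<N. T (f j, \<pi> j)) + (LINT x|\<mu>. h x)) / measure \<mu> UNIV - \<eta>
      \<le> ((\<Sum>j<N. curve_current c (f j, \<pi> j)) + arc_integral c h) / clen c"
proof -
  interpret finite_borel_measure \<mu> by (rule mass_bound_fbm[OF mb])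
  define \<Lambda> where "\<Lambda> = ((\<Sum>j<N. T (f j, \<pi> j)) + (LINT x|\<mu>. h x)) / measure \<mu> UNIV - \<eta>"
  define cost where "cost c = \<Lambda> * clen c - arc_integral c h - (\<Sum>j<N. curve_current c (f j, \<pi> j))" for c :: "'a curve"
  have "\<exists>c :: 'a curve. piecewise_geodesic c \<and> closed_curve c \<and> cost c < 0"
  proof (rule ccontr)
    assume "\<not> (\<exists>c :: 'a curve. piecewise_geodesic c \<and> closed_curve c \<and> cost c < 0)"
    then have nn: "0 \<le> cost c" if "piecewise_geodesic c" "closed_curve c" for c :: "'a curve"
      using that by (metis not_le)
    have "\<forall>x y :: 'a. \<exists>c. geodesic c \<and> cstart c = x \<and> cend c = y"
      using geo unfolding geodesic_space_def .
    then obtain G where G: "\<And>x y :: 'a. geodesic (G x y)" "\<And>x y. cstart (G x y) = x" "\<And>x y. cend (G x y) = y"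
      by metis
    have Glip: "lipschitz_curve (G x y)" for x y by (rule geodesic_lipschitz[OF G(1)])
    have Glen: "clen (G x y) = dist x y" for x y
    proof -
      have L: "0 \<le> clen (G x y)" using G(1) by (simp add: geodesic_def)
      then have "dist (cpoint (G x y) 0) (cpoint (G x y) (clen (G x y))) = \<bar>0 - clen (G x y)\<bar>"
        using G(1)[of x y] unfolding geodesic_def by force
      then show ?thesis using G(2,3)[of x y] L by (simp add: cstart_def cend_def)
    qed
    have Gnear: "dist (cpoint (G x y) t) x \<le> dist x y" if "0 \<le> t" "t \<le> clen (G x y)" for x y t
      using lipschitz_curveD[OF Glip, of 0 t x y] that G(2)[of x y] Glen[of x y]
      by (simp add: cstart_def dist_commute)
    have cost_concat: "cost (concat_curve c d) = cost c + cost d"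
      if "lipschitz_curve c" "lipschitz_curve d" "cend c = cstart d" for c d
      using that f \<pi> h
      by (simp add: cost_def curve_current_concat arc_integral_concat sum.distrib algebra_simps)
    define P where "P x = {c. piecewise_geodesic c \<and> cstart c = a \<and> cend c = x}" for x
    define \<phi> where "\<phi> x = (INF c\<in>P x. cost c)" for x
    have GP: "G a x \<in> P x" for x using G by (simp add: P_def piecewise_geodesic.single)
    have Plip: "c \<in> P x \<Longrightarrow> lipschitz_curve c" for c x by (simp add: P_def piecewise_geodesic_lipschitz)
    have Pext: "concat_curve c (G x y) \<in> P y" if c: "c \<in> P x" for c x y
      using c G(1,2,3)[of x y] lipschitz_curve_nonneg[OF Plip[OF c]] lipschitz_curve_nonneg[OF Glip, of x y]
      by (simp add: P_def piecewise_geodesic.append cstart_concat cend_concat)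
    have lower: "- cost (G x a) \<le> cost c" if c: "c \<in> P x" for c x
    proof -
      have "concat_curve c (G x a) \<in> P a" by (rule Pext[OF c])
      then have "0 \<le> cost (concat_curve c (G x a))" by (intro nn) (auto simp: P_def closed_curve_def)
      also have "\<dots> = cost c + cost (G x a)"
        using c G(2)[of x a] by (intro cost_concat Plip[OF c] Glip) (simp add: P_def)
      finally show ?thesis by simp
    qed
    have bdd: "bdd_below (cost ` P x)" for x by (rule bdd_belowI2) (rule lower)
    have step: "\<phi> y \<le> \<phi> x + cost (G x y)" for x y
    proof -
      have "\<phi> y - cost (G x y) \<le> \<phi> x"
        unfolding \<phi>_def[of x]
      proof (rule cINF_greatest)
        fix c assume c: "c \<in> P x"
        have "\<phi> y \<le> cost (concat_curve c (G x y))"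
          unfolding \<phi>_def by (rule cINF_lower[OF bdd Pext[OF c]])
        also have "\<dots> = cost c + cost (G x y)"
          using c G(2)[of x y] by (intro cost_concat Plip[OF c] Glip) (simp add: P_def)
        finally show "\<phi> y - cost (G x y) \<le> cost c" by simp
      qed (use GP in blast)
      then show ?thesis by simp
    qed
    define C where "C = 3 * (lip_const h + (\<Sum>j<N. lip_const (\<pi> j) * lip_const (f j)))"
    have C: "0 \<le> C" unfolding C_def using h f \<pi>
      by (intro mult_nonneg_nonneg add_nonneg_nonneg sum_nonneg lip_const_nonneg) auto
    (* A geodesic between points of the ball stays within distance 3 r of the centre p,
       so the coefficients may be frozen there. *)
    have frozen: "cost (G x y) \<le> (\<Lambda> - h p + C * r) * dist x y - (\<Sum>j<N. f j p * (\<pi> j y - \<pi> j x))"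
      if r: "0 < r" and x: "dist x p < r" and y: "dist y p < r" for x y p r
    proof -
      let ?c = "G x y"
      have near: "dist (cpoint ?c t) p \<le> 3 * r" if "0 \<le> t" "t \<le> clen ?c" for t
      proof -
        have "dist (cpoint ?c t) p \<le> dist (cpoint ?c t) x + dist x p" by (rule dist_triangle)
        moreover have "dist x y \<le> dist x p + dist y p" by (metis dist_commute dist_triangle)
        ultimately show ?thesis using Gnear[OF that] x y by linarith
      qed
      have hL: "h \<in> Lip_funs" using h by simp
      have "(h p - lip_const h * (3 * r)) * clen ?c \<le> arc_integral ?c h"
        unfolding arc_integral_const[OF Glip, symmetric]
      proof (rule arc_integral_mono[OF Glip Lip_const hL])
        fix t assume "0 \<le> t" "t \<le> clen ?c"
        then have "lip_const h * dist (cpoint ?c t) p \<le> lip_const h * (3 * r)"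
          by (intro mult_left_mono near lip_const_nonneg hL)
        then show "h p - lip_const h * (3 * r) \<le> h (cpoint ?c t)"
          using lip_constD[OF hL, of "cpoint ?c t" p] by linarith
      qed
      then have 1: "h p * dist x y - 3 * lip_const h * r * dist x y \<le> arc_integral ?c h"
        by (simp add: Glen algebra_simps)
      have 2: "f j p * (\<pi> j y - \<pi> j x) - 3 * (lip_const (\<pi> j) * lip_const (f j)) * r * dist x y
          \<le> curve_current ?c (f j, \<pi> j)" if j: "j < N" for j
      proof -
        have fL: "f j \<in> Lip_funs" using f[OF j] by simp
        let ?w = "\<lambda>z. 1 * f j z + (- f j p) * 1"
        have wL: "?w \<in> Lip_funs" by (intro Lip_add Lip_cmult fL) auto
        have eq: "curve_current ?c (?w, \<pi> j) = curve_current ?c (f j, \<pi> j) - f j p * (\<pi> j y - \<pi> j x)"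
          using curve_current_linear_left[OF Glip fL Lip_const \<pi>[OF j], of x y 1 "- f j p" 1]
            curve_current_const[OF Glip \<pi>[OF j], of x y 1] G(2,3)[of x y] by simp
        have "\<bar>curve_current ?c (?w, \<pi> j)\<bar> \<le> lip_const (\<pi> j) * arc_integral ?c (\<lambda>z. \<bar>?w z\<bar>)"
          by (rule curve_current_bound[OF Glip wL \<pi>[OF j]])
        also have "arc_integral ?c (\<lambda>z. \<bar>?w z\<bar>) \<le> arc_integral ?c (\<lambda>_. lip_const (f j) * (3 * r))"
        proof (rule arc_integral_mono[OF Glip Lip_abs[OF wL] Lip_const])
          fix t assume "0 \<le> t" "t \<le> clen ?c"
          then have "lip_const (f j) * dist (cpoint ?c t) p \<le> lip_const (f j) * (3 * r)"
            by (intro mult_left_mono near lip_const_nonneg fL)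
          then show "\<bar>?w (cpoint ?c t)\<bar> \<le> lip_const (f j) * (3 * r)"
            using lip_constD[OF fL, of "cpoint ?c t" p] by simp
        qed
        also have "\<dots> = lip_const (f j) * (3 * r) * dist x y"
          by (simp add: arc_integral_const[OF Glip] Glen)
        finally have "\<bar>curve_current ?c (?w, \<pi> j)\<bar> \<le> lip_const (\<pi> j) * (lip_const (f j) * (3 * r) * dist x y)"
          using lip_const_nonneg[OF \<pi>[OF j]] by (simp add: mult_left_mono)
        then show ?thesis using eq by (simp add: mult_ac abs_le_iff)
      qed
      have "(\<Sum>j<N. f j p * (\<pi> j y - \<pi> j x) - 3 * (lip_const (\<pi> j) * lip_const (f j)) * r * dist x y)
          \<le> (\<Sum>j<N. curve_current ?c (f j, \<pi> j))"
        by (rule sum_mono) (simp add: 2)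
      then have "(\<Sum>j<N. f j p * (\<pi> j y - \<pi> j x)) - 3 * (\<Sum>j<N. lip_const (\<pi> j) * lip_const (f j)) * r * dist x y
          \<le> (\<Sum>j<N. curve_current ?c (f j, \<pi> j))"
        by (simp add: sum_subtractf sum_distrib_left sum_distrib_right)
      then show ?thesis using 1 by (simp add: cost_def Glen C_def algebra_simps)
    qed
    have \<phi>L: "\<phi> \<in> Lip_funs"
    proof -
      obtain H where H: "0 \<le> H" "\<And>x. \<bar>h x\<bar> \<le> H" using Lipb_bound[OF h] by blast
      have "\<forall>j. \<exists>B. j < N \<longrightarrow> 0 \<le> B \<and> (\<forall>x. \<bar>f j x\<bar> \<le> B)" using f Lipb_bound by metis
      then obtain B where B: "\<And>j. j < N \<Longrightarrow> 0 \<le> B j" "\<And>j x. j < N \<Longrightarrow> \<bar>f j x\<bar> \<le> B j" by metis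
      define K where "K = \<bar>\<Lambda>\<bar> + H + (\<Sum>j<N. lip_const (\<pi> j) * B j)"
      have ub: "cost (G x y) \<le> K * dist x y" for x y
      proof -
        have "\<Lambda> * dist x y \<le> \<bar>\<Lambda>\<bar> * dist x y" by (intro mult_right_mono) auto
        moreover have "(- H) * clen (G x y) \<le> arc_integral (G x y) h"
          unfolding arc_integral_const[OF Glip, symmetric]
        proof (rule arc_integral_mono[OF Glip Lip_const Lipb_Lip[OF h]])
          show "- H \<le> h (cpoint (G x y) t)" for t
            using H(2)[of "cpoint (G x y) t"] by linarith
        qed
        moreover have "- (\<Sum>j<N. curve_current (G x y) (f j, \<pi> j)) \<le> (\<Sum>j<N. lip_const (\<pi> j) * B j) * dist x y"
          unfolding sum_negf[symmetric] sum_distrib_right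
        proof (rule sum_mono)
          fix j assume "j \<in> {..<N}"
          then have j: "j < N" by simp
          have "arc_integral (G x y) (\<lambda>z. \<bar>f j z\<bar>) \<le> arc_integral (G x y) (\<lambda>_. B j)"
            using B(2)[OF j] by (intro arc_integral_mono Glip Lip_abs Lipb_Lip f j) auto
          then have "lip_const (\<pi> j) * arc_integral (G x y) (\<lambda>z. \<bar>f j z\<bar>) \<le> lip_const (\<pi> j) * (B j * dist x y)"
            by (intro mult_left_mono lip_const_nonneg \<pi> j) (simp add: arc_integral_const[OF Glip] Glen)
          then show "- curve_current (G x y) (f j, \<pi> j) \<le> lip_const (\<pi> j) * B j * dist x y"
            using curve_current_bound[OF Glip Lipb_Lip[OF f[OF j]] \<pi>[OF j], of x y] by (simp add: mult.assoc)
        qed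
        ultimately show ?thesis by (simp add: cost_def K_def Glen distrib_right)
      qed
      show ?thesis
      proof (rule Lip_funsI[of _ K])
        fix x y
        show "\<bar>\<phi> x - \<phi> y\<bar> \<le> K * dist x y"
          using step[of x y] step[of y x] ub[of x y] ub[of y x] by (simp add: abs_le_iff dist_commute)
      qed
    qed
    (* The differential of \<phi> is adjoined as a further form, with index N and coefficient 1. *)
    define F where "F j = (if j < N then f j else (\<lambda>_. 1))" for j
    define Q where "Q j = (if j < N then \<pi> j else \<phi>)" for j
    have "(\<Sum>j<Suc N. T (F j, Q j)) \<le> (LINT x|\<mu>. \<Lambda> - h x)"
    proof (rule current_le_integral[OF T(1,2) mb _ _ _ C])
      show "F j \<in> Lipb_funs" "Q j \<in> Lip_funs" for j using f \<pi> \<phi>L by (auto simp: F_def Q_def)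
      show "(\<lambda>x. \<Lambda> - h x) \<in> Lipb_funs" by (intro Lipb_diff h) auto
      show "\<exists>x y. dist x p < r \<and> dist y p < r \<and> x \<noteq> y" if "0 < r" for p :: 'a and r
        by (rule geodesic_space_ball[OF geo ab that])
      fix p :: 'a and r x y
      assume *: "0 < r" "dist x p < r" "dist y p < r"
      have "(\<Sum>j<Suc N. F j p * (Q j y - Q j x)) = (\<Sum>j<N. f j p * (\<pi> j y - \<pi> j x)) + (\<phi> y - \<phi> x)"
        by (simp add: F_def Q_def)
      also have "\<dots> \<le> (\<Lambda> - h p + C * r) * dist x y" using frozen[OF *] step[of y x] by linarith
      finally show "(\<Sum>j<Suc N. F j p * (Q j y - Q j x)) \<le> (\<Lambda> - h p + C * r) * dist x y" .
    qed
    moreover have "(\<Sum>j<Suc N. T (F j, Q j)) = (\<Sum>j<N. T (f j, \<pi> j))"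
      by (simp add: F_def Q_def boundary_unbounded[OF T(3) bd \<phi>L])
    moreover have "(LINT x|\<mu>. \<Lambda> - h x) = \<Lambda> * measure \<mu> UNIV - (LINT x|\<mu>. h x)"
      using integrable_Lipb[OF h] by (simp add: mult.commute)
    ultimately have "(\<Sum>j<N. T (f j, \<pi> j)) + (LINT x|\<mu>. h x) \<le> \<Lambda> * measure \<mu> UNIV" by simp
    also have "\<dots> = (\<Sum>j<N. T (f j, \<pi> j)) + (LINT x|\<mu>. h x) - \<eta> * measure \<mu> UNIV"
      using M by (simp add: \<Lambda>_def left_diff_distrib)
    finally show False using M \<eta> by (simp add: mult_le_0_iff)
  qed
  then obtain c :: "'a curve" where c: "piecewise_geodesic c" "closed_curve c" "cost c < 0" by blast
  have cl: "lipschitz_curve c" by (rule piecewise_geodesic_lipschitz[OF c(1)])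
  have "clen c \<noteq> 0"
  proof
    assume 0: "clen c = 0"
    have z: "arc_integral c k = 0" for k unfolding arc_integral_def 0 by simp
    have "curve_current c (f j, \<pi> j) = 0" if "j < N" for j
      using curve_current_bound[OF cl Lipb_Lip[OF f[OF that]] \<pi>[OF that]] z by simp
    then show False using c(3) by (simp add: cost_def 0 z)
  qed
  then have L: "0 < clen c" using lipschitz_curve_nonneg[OF cl] by simp
  have "\<Lambda> * clen c \<le> (\<Sum>j<N. curve_current c (f j, \<pi> j)) + arc_integral c h"
    using c(3) by (simp add: cost_def)
  then have "\<Lambda> \<le> ((\<Sum>j<N. curve_current c (f j, \<pi> j)) + arc_integral c h) / clen c"
    using L by (simp add: pos_le_divide_eq)
  then show thesis using that[OF c(1,2) L] by (simp add: \<Lambda>_def)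
qed

section \<open>Averages that approach a target\<close>

text \<open>
  Choosing each new point so that it does not point in the direction of the accumulated error keeps the
  squared length of this error linear in the number of points; hence the averages converge to \<open>p\<close>.
\<close>

lemma averages_approach:
  fixes V :: "'c \<Rightarrow> 'j \<Rightarrow> real"
  assumes J: "finite J" and R: "\<And>c j. c \<in> S \<Longrightarrow> j \<in> J \<Longrightarrow> \<bar>V c j - p j\<bar> \<le> R"
    and ex: "\<And>a. \<exists>c\<in>S. (\<Sum>j\<in>J. a j * p j) - 1 \<le> (\<Sum>j\<in>J. a j * V c j)"
  obtains c :: "nat \<Rightarrow> 'c" where "\<And>i. c i \<in> S"
    "\<And>e. 0 < e \<Longrightarrow> \<forall>\<^sub>F n in sequentially. \<forall>j\<in>J. \<bar>(\<Sum>i<n. V (c i) j) / real n - p j\<bar> < e"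
proof -
  have "\<exists>c\<in>S. (\<Sum>j\<in>J. s j * (V c j - p j)) \<le> 1" for s :: "'j \<Rightarrow> real"
  proof -
    obtain c where "c \<in> S" "(\<Sum>j\<in>J. - s j * p j) - 1 \<le> (\<Sum>j\<in>J. - s j * V c j)"
      using ex[of "\<lambda>j. - s j"] by blast
    then show ?thesis by (intro bexI[of _ c]) (simp_all add: right_diff_distrib sum_subtractf sum_negf)
  qed
  then obtain pick where pick: "\<And>s. pick s \<in> S" "\<And>s. (\<Sum>j\<in>J. s j * (V (pick s) j - p j)) \<le> 1" by metis
  define E where "E = rec_nat (\<lambda>_. 0) (\<lambda>_ s j. s j + (V (pick s) j - p j))"
  have E_0: "E 0 = (\<lambda>_. 0)" and E_Suc: "E (Suc n) = (\<lambda>j. E n j + (V (pick (E n)) j - p j))" for n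
    by (simp_all add: E_def)
  define c where "c n = pick (E n)" for n
  have cS: "c i \<in> S" for i by (simp add: c_def pick)
  have E_sum: "E n j = (\<Sum>i<n. V (c i) j) - real n * p j" for n j
    by (induction n) (simp_all add: E_0 E_Suc c_def algebra_simps)
  define B where "B = 2 + real (card J) * R\<^sup>2"
  have B: "0 < B" unfolding B_def by (intro add_pos_nonneg) auto
  have sq: "(\<Sum>j\<in>J. (E n j)\<^sup>2) \<le> real n * B" for n
  proof (induction n)
    case (Suc n)
    have "(\<Sum>j\<in>J. (E (Suc n) j)\<^sup>2) = (\<Sum>j\<in>J. (E n j)\<^sup>2 + 2 * (E n j * (V (c n) j - p j)) + (V (c n) j - p j)\<^sup>2)"
      by (intro sum.cong) (auto simp: E_Suc c_def power2_eq_square algebra_simps)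
    also have "\<dots> = (\<Sum>j\<in>J. (E n j)\<^sup>2) + 2 * (\<Sum>j\<in>J. E n j * (V (c n) j - p j)) + (\<Sum>j\<in>J. (V (c n) j - p j)\<^sup>2)"
      by (simp add: sum.distrib sum_distrib_left)
    also have "(\<Sum>j\<in>J. E n j * (V (c n) j - p j)) \<le> 1" unfolding c_def by (rule pick(2))
    also have "(\<Sum>j\<in>J. (V (c n) j - p j)\<^sup>2) \<le> real (card J) * R\<^sup>2"
    proof (rule sum_bounded_above)
      fix j assume "j \<in> J"
      then have "\<bar>V (c n) j - p j\<bar>\<^sup>2 \<le> R\<^sup>2" using R[OF cS] by (intro power_mono) auto
      then show "(V (c n) j - p j)\<^sup>2 \<le> R\<^sup>2" by simp
    qed
    finally show ?case using Suc.IH by (simp add: B_def algebra_simps)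
  qed (simp add: E_0)
  have "\<forall>\<^sub>F n in sequentially. \<forall>j\<in>J. \<bar>(\<Sum>i<n. V (c i) j) / real n - p j\<bar> < e" if e: "0 < e" for e
  proof -
    obtain m :: nat where m: "B / e\<^sup>2 < real m" using reals_Archimedean2 by blast
    show ?thesis
    proof (rule eventually_sequentiallyI[of m], rule ballI)
      fix n j assume n: "m \<le> n" and j: "j \<in> J"
      have "0 < B / e\<^sup>2" using B e by simp
      moreover have Bn': "B / e\<^sup>2 < real n" using m n by linarith
      ultimately have n0: "0 < real n" by linarith
      have Bn: "B < e\<^sup>2 * real n" using Bn' e by (simp add: pos_divide_less_eq mult.commute)
      have "(E n j)\<^sup>2 \<le> (\<Sum>j\<in>J. (E n j)\<^sup>2)" using j J by (intro member_le_sum) auto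
      also have "\<dots> \<le> real n * B" by (rule sq)
      also have "\<dots> < real n * (e\<^sup>2 * real n)" using n0 Bn by (intro mult_strict_left_mono)
      also have "\<dots> = (e * real n)\<^sup>2" by (simp add: power2_eq_square)
      finally have "\<bar>E n j\<bar> < e * real n"
        using e n0 by (intro power2_less_imp_less[of "\<bar>E n j\<bar>"]) auto
      moreover have "(\<Sum>i<n. V (c i) j) / real n - p j = E n j / real n"
        using n0 by (simp add: E_sum diff_divide_distrib)
      ultimately show "\<bar>(\<Sum>i<n. V (c i) j) / real n - p j\<bar> < e"
        using n0 by (simp add: pos_divide_less_eq)
    qed
  qed
  then show thesis by (rule that[OF cS])
qed

section \<open>Convergence from countably many tests\<close>

lemma tendsto_from_approximations:
  fixes u :: "nat \<Rightarrow> real"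
  assumes le: "\<And>n j. \<bar>u n - L\<bar> \<le> E n j" and E: "\<And>j. (\<lambda>n. E n j) \<longlonglongrightarrow> D j" and D: "D \<longlonglongrightarrow> 0"
  shows "u \<longlonglongrightarrow> L"
proof (rule LIMSEQ_I)
  fix e :: real assume "0 < e"
  then have "\<forall>\<^sub>F j in sequentially. D j < e" by (rule order_tendstoD(2)[OF D])
  then obtain j where "D j < e" by (auto simp: eventually_sequentially)
  then have "\<forall>\<^sub>F n in sequentially. E n j < e" by (rule order_tendstoD(2)[OF E])
  then obtain N where "\<And>n. N \<le> n \<Longrightarrow> E n j < e" by (auto simp: eventually_sequentially)
  then show "\<exists>N. \<forall>n\<ge>N. norm (u n - L) < e"
    using le by (intro exI[of _ N]) (auto intro: le_less_trans)
qed

locale curve_averages = finite_borel_measure \<mu>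
  for \<mu> :: "'a::polish_space measure" +
  fixes T :: "'a form \<Rightarrow> real" and w :: "nat \<Rightarrow> real" and m :: "nat \<Rightarrow> nat"
    and \<gamma> :: "nat \<Rightarrow> nat \<Rightarrow> 'a curve"
  assumes bilinear: "bilinear_on_D1 T" and continuous: "current_continuous T"
    and local: "current_local T" and bound: "mass_bound T \<mu>"
    and curves: "\<And>n i. i \<in> {1..m n} \<Longrightarrow> lipschitz_curve (\<gamma> i n)"
    and closed: "\<And>n i. i \<in> {1..m n} \<Longrightarrow> closed_curve (\<gamma> i n)"
    and weight: "\<And>n. 0 \<le> w n"
    and test1: "\<And>k. (\<lambda>n. w n * (\<Sum>i=1..m n. arc_integral (\<gamma> i n) (test_fun k))) \<longlonglongrightarrow> (LINT x|\<mu>. test_fun k x)"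
    and test2: "\<And>k k'. (\<lambda>n. w n * (\<Sum>i=1..m n. curve_current (\<gamma> i n) (test_fun k, test_fun k')))
      \<longlonglongrightarrow> T (test_fun k, test_fun k')"
begin

definition S :: "nat \<Rightarrow> 'a form \<Rightarrow> real" where
  "S n \<omega> = w n * (\<Sum>i=1..m n. curve_current (\<gamma> i n) \<omega>)"

definition \<sigma> :: "nat \<Rightarrow> ('a \<Rightarrow> real) \<Rightarrow> real" where
  "\<sigma> n h = w n * (\<Sum>i=1..m n. arc_integral (\<gamma> i n) h)"

lemma \<sigma>_mono: "f \<in> Lip_funs \<Longrightarrow> g \<in> Lip_funs \<Longrightarrow> (\<And>x. f x \<le> g x) \<Longrightarrow> \<sigma> n f \<le> \<sigma> n g"
  unfolding \<sigma>_def by (intro mult_left_mono weight sum_mono arc_integral_mono curves) auto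

lemma \<sigma>_minus: "\<sigma> n (\<lambda>x. - f x) = - \<sigma> n f"
  using arc_integral_cmult[where k = "- 1" and f = f] by (simp add: \<sigma>_def sum_negf)

lemma S_bound:
  assumes "f \<in> Lip_funs" "\<pi> \<in> Lip_funs"
  shows "\<bar>S n (f, \<pi>)\<bar> \<le> lip_const \<pi> * \<sigma> n (\<lambda>x. \<bar>f x\<bar>)"
proof -
  have "\<bar>S n (f, \<pi>)\<bar> = w n * \<bar>\<Sum>i=1..m n. curve_current (\<gamma> i n) (f, \<pi>)\<bar>"
    using weight[of n] by (simp add: S_def abs_mult)
  also have "\<dots> \<le> w n * (\<Sum>i=1..m n. \<bar>curve_current (\<gamma> i n) (f, \<pi>)\<bar>)"
    by (intro mult_left_mono sum_abs weight)
  also have "\<dots> \<le> w n * (\<Sum>i=1..m n. lip_const \<pi> * arc_integral (\<gamma> i n) (\<lambda>x. \<bar>f x\<bar>))"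
    by (intro mult_left_mono sum_mono weight curve_current_bound curves assms)
  also have "\<dots> = lip_const \<pi> * \<sigma> n (\<lambda>x. \<bar>f x\<bar>)"
    by (simp add: \<sigma>_def sum_distrib_left mult_ac)
  finally show ?thesis .
qed

lemma S_diff_left:
  "f \<in> Lip_funs \<Longrightarrow> g \<in> Lip_funs \<Longrightarrow> \<pi> \<in> Lip_funs \<Longrightarrow>
    S n (\<lambda>x. f x - g x, \<pi>) = S n (f, \<pi>) - S n (g, \<pi>)"
  using curve_current_linear_left[OF curves, where a = 1 and b = "- 1"]
  by (simp add: S_def sum_subtractf right_diff_distrib)

lemma S_diff_right:
  "f \<in> Lip_funs \<Longrightarrow> \<pi> \<in> Lip_funs \<Longrightarrow> \<rho> \<in> Lip_funs \<Longrightarrow>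
    S n (f, \<lambda>x. \<pi> x - \<rho> x) = S n (f, \<pi>) - S n (f, \<rho>)"
  using curve_current_linear_right[OF curves, where a = 1 and b = "- 1"]
  by (simp add: S_def sum_subtractf right_diff_distrib)

lemma S_by_parts:
  assumes "f \<in> Lip_funs" "\<pi> \<in> Lip_funs"
  shows "S n (f, \<pi>) = - S n (\<pi>, f)"
proof -
  have "(\<Sum>i=1..m n. curve_current (\<gamma> i n) (f, \<pi>)) = (\<Sum>i=1..m n. - curve_current (\<gamma> i n) (\<pi>, f))"
    by (rule sum.cong[OF refl]) (rule curve_current_by_parts[OF curves closed assms(2,1)])
  then show ?thesis by (simp add: S_def sum_negf)
qed

lemma test_integral_limit:
  assumes k: "\<And>x. (\<lambda>n. test_fun (k n) x) \<longlonglongrightarrow> f x" and B: "\<And>n x. \<bar>test_fun (k n) (x::'a)\<bar> \<le> B"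
    and f: "f \<in> Lipb_funs"
  shows "(\<lambda>n. LINT x|\<mu>. test_fun (k n) x) \<longlonglongrightarrow> (LINT x|\<mu>. f x)"
    and "(\<lambda>n. LINT x|\<mu>. \<bar>f x - test_fun (k n) x\<bar>) \<longlonglongrightarrow> 0"
proof -
  have [measurable]: "f \<in> borel_measurable borel" "(test_fun (k n) :: 'a \<Rightarrow> real) \<in> borel_measurable borel" for n
    using f test_fun_Lipb by (auto intro: Lipb_measurable)
  show "(\<lambda>n. LINT x|\<mu>. test_fun (k n) x) \<longlonglongrightarrow> (LINT x|\<mu>. f x)"
    by (rule integral_dominated_convergence[where w = "\<lambda>_. B"]) (use k B in auto)
  obtain A where A: "\<And>x. \<bar>f x\<bar> \<le> A" using Lipb_bound[OF f] by blast
  have "(\<lambda>n. LINT x|\<mu>. \<bar>f x - test_fun (k n) x\<bar>) \<longlonglongrightarrow> (LINT x|\<mu>. \<bar>f x - f x\<bar>)"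
  proof (rule integral_dominated_convergence[where w = "\<lambda>_. A + B"])
    show "AE x in \<mu>. (\<lambda>n. \<bar>f x - test_fun (k n) x\<bar>) \<longlonglongrightarrow> \<bar>f x - f x\<bar>"
      by (intro AE_I2 tendsto_rabs tendsto_diff tendsto_const k)
    show "AE x in \<mu>. norm \<bar>f x - test_fun (k n) x\<bar> \<le> A + B" for n
    proof (rule AE_I2)
      fix x
      show "norm \<bar>f x - test_fun (k n) x\<bar> \<le> A + B" using A[of x] B[of n x] by simp
    qed
  qed simp_all
  then show "(\<lambda>n. LINT x|\<mu>. \<bar>f x - test_fun (k n) x\<bar>) \<longlonglongrightarrow> 0" by simp
qed

text \<open>
  Every bounded Lipschitz function is approached from below by tests, which gives the lower half of the
  convergence; the other half is the same statement for the negated function.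
\<close>

lemma \<sigma>_lower:
  assumes f: "f \<in> Lipb_funs" and e: "0 < e"
  shows "\<forall>\<^sub>F n in sequentially. (LINT x|\<mu>. f x) - e < \<sigma> n f"
proof -
  obtain k L B where k: "\<And>n x. test_fun (k n) x \<le> f x" "\<And>x. (\<lambda>n. test_fun (k n) x) \<longlonglongrightarrow> f x"
    "\<And>n x. \<bar>test_fun (k n) (x::'a)\<bar> \<le> B" using test_fun_approx[OF f] by metis
  have "\<forall>\<^sub>F j in sequentially. (LINT x|\<mu>. f x) - e < (LINT x|\<mu>. test_fun (k j) x)"
    by (rule order_tendstoD(1)[OF test_integral_limit(1)[OF k(2,3) f]]) (use e in simp)
  then obtain j where j: "(LINT x|\<mu>. f x) - e < (LINT x|\<mu>. test_fun (k j) x)"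
    by (auto simp: eventually_sequentially)
  have "\<forall>\<^sub>F n in sequentially. (LINT x|\<mu>. f x) - e < \<sigma> n (test_fun (k j))"
    unfolding \<sigma>_def by (rule order_tendstoD(1)[OF test1 j])
  then show ?thesis
  proof eventually_elim
    case (elim n)
    also have "\<sigma> n (test_fun (k j)) \<le> \<sigma> n f"
      by (rule \<sigma>_mono[OF Lipb_Lip[OF test_fun_Lipb] Lipb_Lip[OF f] k(1)])
    finally show ?case .
  qed
qed

lemma \<sigma>_tendsto:
  assumes f: "f \<in> Lipb_funs"
  shows "(\<lambda>n. \<sigma> n f) \<longlonglongrightarrow> (LINT x|\<mu>. f x)"
proof (rule order_tendstoI)
  fix a assume "a < (LINT x|\<mu>. f x)"
  then show "\<forall>\<^sub>F n in sequentially. a < \<sigma> n f"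
    using \<sigma>_lower[OF f, of "(LINT x|\<mu>. f x) - a"] by simp
next
  fix a assume "(LINT x|\<mu>. f x) < a"
  then show "\<forall>\<^sub>F n in sequentially. \<sigma> n f < a"
    using \<sigma>_lower[OF Lipb_minus[OF f], of "a - (LINT x|\<mu>. f x)"] by (simp add: \<sigma>_minus)
qed

text \<open>
  For a closed curve the integral of \<open>f d\<pi>\<close> is minus that of \<open>\<pi> df\<close>, so replacing \<open>\<pi>\<close> by a test costs at
  most a multiple of the mean difference along the curves, just as for \<open>f\<close>.
\<close>

lemma S_tendsto_bounded:
  assumes f: "f \<in> Lipb_funs" and \<pi>: "\<pi> \<in> Lipb_funs"
  shows "(\<lambda>n. S n (f, \<pi>)) \<longlonglongrightarrow> T (f, \<pi>)"
proof -
  obtain k L B where k: "\<And>x. (\<lambda>n. test_fun (k n) x) \<longlonglongrightarrow> f x" "0 \<le> L"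
    "\<And>n x y. \<bar>test_fun (k n) x - test_fun (k n) (y::'a)\<bar> \<le> L * dist x y"
    "\<And>n x. \<bar>test_fun (k n) (x::'a)\<bar> \<le> B" using test_fun_approx[OF f] by metis
  obtain k' L' B' where k': "\<And>x. (\<lambda>n. test_fun (k' n) x) \<longlonglongrightarrow> \<pi> x" "0 \<le> L'"
    "\<And>n x y. \<bar>test_fun (k' n) x - test_fun (k' n) (y::'a)\<bar> \<le> L' * dist x y"
    "\<And>n x. \<bar>test_fun (k' n) (x::'a)\<bar> \<le> B'" using test_fun_approx[OF \<pi>] by metis
  define F :: "nat \<Rightarrow> 'a \<Rightarrow> real" where "F j = test_fun (k j)" for j
  define P :: "nat \<Rightarrow> 'a \<Rightarrow> real" where "P j = test_fun (k' j)" for j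
  have FL: "F j \<in> Lipb_funs" and PL: "P j \<in> Lipb_funs" for j by (simp_all add: F_def P_def test_fun_Lipb)
  have lF: "lip_const (F j) \<le> L" for j unfolding F_def by (rule lip_const_leI[OF k(2,3)])
  have lP: "lip_const (P j) \<le> L'" for j unfolding P_def by (rule lip_const_leI[OF k'(2,3)])
  have iF: "(\<lambda>j. LINT x|\<mu>. \<bar>f x - F j x\<bar>) \<longlonglongrightarrow> 0"
    unfolding F_def by (rule test_integral_limit(2)[OF k(1,4) f])
  have iP: "(\<lambda>j. LINT x|\<mu>. \<bar>\<pi> x - P j x\<bar>) \<longlonglongrightarrow> 0"
    unfolding P_def by (rule test_integral_limit(2)[OF k'(1,4) \<pi>])
  define E where "E n j = lip_const \<pi> * \<sigma> n (\<lambda>x. \<bar>f x - F j x\<bar>) + L * \<sigma> n (\<lambda>x. \<bar>\<pi> x - P j x\<bar>)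
      + \<bar>S n (F j, P j) - T (F j, P j)\<bar> + \<bar>T (F j, P j) - T (f, \<pi>)\<bar>" for n j
  define D where "D j = lip_const \<pi> * (LINT x|\<mu>. \<bar>f x - F j x\<bar>) + L * (LINT x|\<mu>. \<bar>\<pi> x - P j x\<bar>)
      + 0 + \<bar>T (F j, P j) - T (f, \<pi>)\<bar>" for j
  show ?thesis
  proof (rule tendsto_from_approximations[where E = E and D = D])
    fix n j
    have 1: "\<bar>S n (f, \<pi>) - S n (F j, \<pi>)\<bar> \<le> lip_const \<pi> * \<sigma> n (\<lambda>x. \<bar>f x - F j x\<bar>)"
      using S_bound[of "\<lambda>x. f x - F j x" \<pi> n] S_diff_left[of f "F j" \<pi> n] f \<pi> FL by (simp add: Lip_diff)
    have "S n (F j, \<pi>) - S n (F j, P j) = S n (F j, \<lambda>x. \<pi> x - P j x)"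
      using S_diff_right[of "F j" \<pi> "P j" n] FL PL \<pi> by simp
    also have "\<dots> = - S n (\<lambda>x. \<pi> x - P j x, F j)"
      by (rule S_by_parts) (use FL PL \<pi> in \<open>auto intro: Lip_diff\<close>)
    finally have "\<bar>S n (F j, \<pi>) - S n (F j, P j)\<bar> \<le> lip_const (F j) * \<sigma> n (\<lambda>x. \<bar>\<pi> x - P j x\<bar>)"
      using S_bound[of "\<lambda>x. \<pi> x - P j x" "F j" n] FL PL \<pi> by (simp add: Lip_diff)
    also have "\<dots> \<le> L * \<sigma> n (\<lambda>x. \<bar>\<pi> x - P j x\<bar>)"
    proof (rule mult_right_mono[OF lF])
      have "\<sigma> n (\<lambda>_. 0) \<le> \<sigma> n (\<lambda>x. \<bar>\<pi> x - P j x\<bar>)"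
        by (rule \<sigma>_mono[OF Lip_const Lip_abs[OF Lip_diff[OF Lipb_Lip[OF \<pi>] Lipb_Lip[OF PL]]]]) simp
      moreover have "\<sigma> n (\<lambda>_. 0) = 0" using arc_integral_const[OF curves, where k = 0] by (simp add: \<sigma>_def)
      ultimately show "0 \<le> \<sigma> n (\<lambda>x. \<bar>\<pi> x - P j x\<bar>)" by simp
    qed
    finally show "\<bar>S n (f, \<pi>) - T (f, \<pi>)\<bar> \<le> E n j" using 1 unfolding E_def by linarith
  next
    fix j
    have "(\<lambda>n. S n (F j, P j) - T (F j, P j)) \<longlonglongrightarrow> 0"
      unfolding S_def F_def P_def by (rule LIM_zero[OF test2])
    then have "(\<lambda>n. \<bar>S n (F j, P j) - T (F j, P j)\<bar>) \<longlonglongrightarrow> 0" by (rule tendsto_rabs_zero)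
    then show "(\<lambda>n. E n j) \<longlonglongrightarrow> D j"
      unfolding E_def D_def
      by (intro tendsto_add tendsto_mult tendsto_const \<sigma>_tendsto Lipb_abs Lipb_diff f \<pi> FL PL)
  next
    have "(\<lambda>j. T (f, P j)) \<longlonglongrightarrow> T (f, \<pi>)"
    proof -
      have bdd: "bdd_above (range (\<lambda>j. lip_const (P j)))" by (rule bdd_aboveI2[of _ _ L']) (rule lP)
      have "\<forall>x. (\<lambda>j. P j x) \<longlonglongrightarrow> \<pi> x" using k'(1) by (simp add: P_def)
      then have "(\<forall>j. P j \<in> Lip_funs) \<and> bdd_above (range (\<lambda>j. lip_const (P j))) \<and> (\<forall>x. (\<lambda>j. P j x) \<longlonglongrightarrow> \<pi> x)"
        using bdd Lipb_Lip[OF PL] by simp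
      then show ?thesis
        by (rule continuous[unfolded current_continuous_def, rule_format, OF f Lipb_Lip[OF \<pi>]])
    qed
    moreover have "(\<lambda>j. T (F j, P j) - T (f, P j)) \<longlonglongrightarrow> 0"
    proof (rule Lim_null_comparison)
      have "\<bar>T (F j, P j) - T (f, P j)\<bar> \<le> L' * (LINT x|\<mu>. \<bar>f x - F j x\<bar>)" for j
      proof -
        have "T (F j, P j) - T (f, P j) = - T (\<lambda>x. f x - F j x, P j)"
          using bilinear_simps(7)[OF bilinear f Lipb_Lip[OF PL] FL, of j j] by simp
        then have "\<bar>T (F j, P j) - T (f, P j)\<bar> \<le> lip_const (P j) * (LINT x|\<mu>. \<bar>f x - F j x\<bar>)"
          using mass_boundD[OF bound Lipb_diff[OF f FL] Lipb_Lip[OF PL], of j j] by simp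
        also have "\<dots> \<le> L' * (LINT x|\<mu>. \<bar>f x - F j x\<bar>)"
          by (intro mult_right_mono lP Bochner_Integration.integral_nonneg) simp
        finally show ?thesis .
      qed
      then show "\<forall>\<^sub>F j in sequentially. norm (T (F j, P j) - T (f, P j)) \<le> L' * (LINT x|\<mu>. \<bar>f x - F j x\<bar>)"
        by simp
      show "(\<lambda>j. L' * (LINT x|\<mu>. \<bar>f x - F j x\<bar>)) \<longlonglongrightarrow> 0"
        using tendsto_mult[OF tendsto_const iF, of L'] by simp
    qed
    ultimately have "(\<lambda>j. T (f, P j) + (T (F j, P j) - T (f, P j))) \<longlonglongrightarrow> T (f, \<pi>) + 0"
      by (rule tendsto_add)
    then have "(\<lambda>j. T (F j, P j)) \<longlonglongrightarrow> T (f, \<pi>)" by simp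
    then have "(\<lambda>j. \<bar>T (F j, P j) - T (f, \<pi>)\<bar>) \<longlonglongrightarrow> 0" by (intro tendsto_rabs_zero LIM_zero)
    then have "D \<longlonglongrightarrow> lip_const \<pi> * 0 + L * 0 + 0 + 0"
      unfolding D_def[abs_def] by (intro tendsto_add tendsto_mult tendsto_const iF iP)
    then show "D \<longlonglongrightarrow> 0" by simp
  qed
qed

text \<open>
  An unbounded \<open>\<pi>\<close> may be truncated once \<open>f\<close> is cut off outside a ball, because both sides are local; the
  cutoff is harmless in the limit since little of \<open>\<mu>\<close> lies outside a large ball.
\<close>

theorem S_tendsto:
  assumes f: "f \<in> Lipb_funs" and \<pi>: "\<pi> \<in> Lip_funs"
  shows "(\<lambda>n. S n (f, \<pi>)) \<longlonglongrightarrow> T (f, \<pi>)"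
proof -
  define a :: 'a where "a = undefined"
  define F where "F j x = f x * bump a (real (Suc j)) x" for j x
  have FL: "F j \<in> Lipb_funs" for j
    using Lipb_mult[OF f bump_Lipb[of a "real (Suc j)"]] by (simp add: F_def[abs_def])
  have F_supp: "dist x a < real (Suc j)" if "F j x \<noteq> 0" for j x
    using that bump_support[of "real (Suc j)" a x] by (simp add: F_def)
  have conv: "(\<lambda>n. S n (F j, \<pi>)) \<longlonglongrightarrow> T (F j, \<pi>)" for j
  proof -
    define c where "c = \<bar>\<pi> a\<bar> + lip_const \<pi> * (real (Suc j) + 1)"
    define \<rho> where "\<rho> = (\<lambda>x. max (- c) (min c (\<pi> x)))"
    have \<rho>L: "\<rho> \<in> Lip_funs" unfolding \<rho>_def by (intro Lip_max Lip_min \<pi>) auto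
    have c: "0 \<le> c" unfolding c_def using lip_const_nonneg[OF \<pi>] by simp
    have \<rho>: "\<rho> \<in> Lipb_funs" by (rule LipbI[OF \<rho>L, of c]) (use c in \<open>auto simp: \<rho>_def\<close>)
    have eq: "\<pi> y = \<rho> y" if "dist y a \<le> real (Suc j) + 1" for y
    proof -
      have "lip_const \<pi> * dist y a \<le> lip_const \<pi> * (real (Suc j) + 1)"
        by (intro mult_left_mono that lip_const_nonneg \<pi>)
      then have "\<bar>\<pi> y\<bar> \<le> c" using lip_constD[OF \<pi>, of y a] unfolding c_def by linarith
      then show ?thesis by (simp add: \<rho>_def)
    qed
    have "curve_current (\<gamma> i n) (F j, \<pi>) = curve_current (\<gamma> i n) (F j, \<rho>)" if "i \<in> {1..m n}" for i n
    proof (rule curve_current_local[OF curves[OF that] FL \<pi> \<rho>L, of 1])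
      fix x y assume xy: "F j x \<noteq> 0" "dist x y \<le> 1"
      have "dist y a \<le> dist x y + dist x a" by (metis dist_commute dist_triangle)
      then show "\<pi> y = \<rho> y" using F_supp[OF xy(1)] xy(2) by (intro eq) linarith
    qed simp
    then have "S n (F j, \<pi>) = S n (F j, \<rho>)" for n by (simp add: S_def)
    moreover have "T (F j, \<pi>) = T (F j, \<rho>)"
    proof (rule current_eq_if_eq_on_open[OF bilinear local FL \<pi> \<rho>L])
      show "open (ball a (real (Suc j)))" by simp
      show "{x. F j x \<noteq> 0} \<subseteq> ball a (real (Suc j))" using F_supp by (auto simp: dist_commute)
      show "\<pi> x = \<rho> x" if "x \<in> ball a (real (Suc j))" for x
        using that by (intro eq) (simp add: dist_commute)
    qed
    ultimately show ?thesis using S_tendsto_bounded[OF FL \<rho>] by simp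
  qed
  have iF: "(\<lambda>j. LINT x|\<mu>. \<bar>f x - F j x\<bar>) \<longlonglongrightarrow> 0"
  proof -
    have [measurable]: "f \<in> borel_measurable borel" "F j \<in> borel_measurable borel" for j
      using f FL by (auto intro: Lipb_measurable)
    have "(\<lambda>j. LINT x|\<mu>. \<bar>f x - F j x\<bar>) \<longlonglongrightarrow> (LINT x|\<mu>. 0)"
    proof (rule integral_dominated_convergence[where w = "\<lambda>x. \<bar>f x\<bar>"])
      show "AE x in \<mu>. (\<lambda>j. \<bar>f x - F j x\<bar>) \<longlonglongrightarrow> 0"
      proof (rule AE_I2)
        fix x
        obtain N :: nat where N: "2 * dist x a \<le> real N" using real_arch_simple by blast
        have "\<bar>f x - F j x\<bar> = 0" if "N \<le> j" for j
        proof -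
          have "dist x a \<le> real (Suc j) / 2" using N that by simp
          then show ?thesis using bump_eq_1[of "real (Suc j)" x a] by (simp add: F_def)
        qed
        then show "(\<lambda>j. \<bar>f x - F j x\<bar>) \<longlonglongrightarrow> 0" by (intro tendsto_eventually eventually_sequentiallyI)
      qed
      show "AE x in \<mu>. norm \<bar>f x - F j x\<bar> \<le> \<bar>f x\<bar>" for j
      proof (rule AE_I2)
        fix x
        have "f x - F j x = f x * (1 - bump a (real (Suc j)) x)" by (simp add: F_def right_diff_distrib)
        then show "norm \<bar>f x - F j x\<bar> \<le> \<bar>f x\<bar>"
          using bump_range[of a "real (Suc j)" x] by (simp add: abs_mult mult_left_le)
      qed
      show "integrable \<mu> (\<lambda>x. \<bar>f x\<bar>)" by (intro integrable_Lipb Lipb_abs f)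
    qed simp_all
    then show ?thesis by simp
  qed
  define E where "E n j = lip_const \<pi> * \<sigma> n (\<lambda>x. \<bar>f x - F j x\<bar>) + \<bar>S n (F j, \<pi>) - T (F j, \<pi>)\<bar>
      + lip_const \<pi> * (LINT x|\<mu>. \<bar>f x - F j x\<bar>)" for n j
  define D where "D j = lip_const \<pi> * (LINT x|\<mu>. \<bar>f x - F j x\<bar>) + 0
      + lip_const \<pi> * (LINT x|\<mu>. \<bar>f x - F j x\<bar>)" for j
  show ?thesis
  proof (rule tendsto_from_approximations[where E = E and D = D])
    fix n j
    have "\<bar>S n (f, \<pi>) - S n (F j, \<pi>)\<bar> \<le> lip_const \<pi> * \<sigma> n (\<lambda>x. \<bar>f x - F j x\<bar>)"
      using S_bound[of "\<lambda>x. f x - F j x" \<pi> n] S_diff_left[of f "F j" \<pi> n] f \<pi> FL by (simp add: Lip_diff)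
    moreover have "\<bar>T (f, \<pi>) - T (F j, \<pi>)\<bar> \<le> lip_const \<pi> * (LINT x|\<mu>. \<bar>f x - F j x\<bar>)"
      using mass_boundD[OF bound Lipb_diff[OF f FL] \<pi>, of j] bilinear_simps(7)[OF bilinear f \<pi> FL, of j] by simp
    ultimately show "\<bar>S n (f, \<pi>) - T (f, \<pi>)\<bar> \<le> E n j" unfolding E_def by linarith
  next
    fix j
    have "(\<lambda>n. \<bar>S n (F j, \<pi>) - T (F j, \<pi>)\<bar>) \<longlonglongrightarrow> 0" by (intro tendsto_rabs_zero LIM_zero conv)
    then show "(\<lambda>n. E n j) \<longlonglongrightarrow> D j"
      unfolding E_def D_def
      by (intro tendsto_add tendsto_mult tendsto_const \<sigma>_tendsto Lipb_abs Lipb_diff f FL)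
  next
    have "D \<longlonglongrightarrow> lip_const \<pi> * 0 + 0 + lip_const \<pi> * 0"
      unfolding D_def[abs_def] by (intro tendsto_add tendsto_mult tendsto_const iF)
    then show "D \<longlonglongrightarrow> 0" by simp
  qed
qed

end

text \<open>At scale \<open>l\<close> the largest stage up to \<open>l\<close> that is available is used.\<close>

lemma diagonal_choice:
  assumes anti: "\<And>N N' l w. P N l w \<Longrightarrow> N' \<le> N \<Longrightarrow> P N' l w" and base: "\<And>l. \<exists>w. P (0::nat) l w"
    and ev: "\<And>N. \<exists>l0. \<forall>l\<ge>l0. \<exists>w. P N l w"
  obtains w where "\<And>l. P 0 l (w l)" "\<And>N. \<forall>\<^sub>F l in sequentially. P N l (w (l::nat))"
proof -
  define A where "A l = {N. N \<le> l \<and> (\<exists>w. P N l w)}" for l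
  have fin: "finite (A l)" for l by (rule finite_subset[of _ "{..l}"]) (auto simp: A_def)
  have ne: "A l \<noteq> {}" for l using base[of l] by (auto simp: A_def)
  have "\<forall>l. \<exists>w. P (Max (A l)) l w" using Max_in[OF fin ne] by (auto simp: A_def)
  then obtain w where w: "\<And>l. P (Max (A l)) l (w l)" by metis
  have "\<forall>\<^sub>F l in sequentially. P N l (w l)" for N
  proof -
    obtain l0 where l0: "\<forall>l\<ge>l0. \<exists>w. P N l w" using ev by blast
    show ?thesis
    proof (rule eventually_sequentiallyI[of "max l0 N"])
      fix l assume "max l0 N \<le> l"
      then have "N \<in> A l" using l0 by (auto simp: A_def)
      then show "P N l (w l)" by (intro anti[OF w] Max_ge fin)
    qed
  qed
  moreover have "P 0 l (w l)" for l by (rule anti[OF w]) simp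
  ultimately show thesis by (intro that)
qed

section \<open>Approximation at a fixed length scale\<close>

text \<open>After \<open>\<lfloor>l / clen c\<rfloor>\<close> turns less than one turn is missing from the length \<open>l\<close>.\<close>

lemma wind_to_length:
  assumes c: "piecewise_geodesic c" "closed_curve c" and L: "0 < clen c" "clen c \<le> l"
  obtains k where "clen (wind c k) \<le> l" "l - clen c \<le> clen (wind c k)"
proof -
  define q where "q = nat \<lfloor>l / clen c\<rfloor>"
  have "1 \<le> l / clen c" using L by (simp add: le_divide_eq)
  then have q1: "1 \<le> q" unfolding q_def by linarith
  have "real q \<le> l / clen c" "l / clen c < real q + 1"
    unfolding q_def using \<open>1 \<le> l / clen c\<close> by linarith+
  then have q: "real q * clen c \<le> l" "l < (real q + 1) * clen c"
    using L(1) by (simp_all add: le_divide_eq divide_less_eq)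
  have "clen (wind c (q - 1)) = real q * clen c" using wind[OF c, of "q - 1"] q1 by (simp add: of_nat_diff)
  then show thesis using q that[of "q - 1"] by (simp add: algebra_simps)
qed

definition form_seq :: "nat \<Rightarrow> 'a::{metric_space, second_countable_topology} form" where
  "form_seq j = (test_fun (fst (prod_decode j)), test_fun (snd (prod_decode j)))"

text \<open>
  Two kinds of quantities are tested: values on forms (\<open>Inl\<close>), and integrals of functions with respect
  to arc length (\<open>Inr\<close>). The latter force the arc length measures to approach the mass measure.
\<close>

fun observe :: "nat + nat \<Rightarrow> 'a::{metric_space, second_countable_topology} curve \<Rightarrow> real" where
  "observe (Inl j) c = curve_current c (form_seq j)"
| "observe (Inr k) c = arc_integral c (test_fun k)"

fun observe_current :: "('a::{metric_space, second_countable_topology} form \<Rightarrow> real) \<Rightarrow> 'a measure \<Rightarrow> nat + nat \<Rightarrow> real" where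
  "observe_current T \<mu> (Inl j) = T (form_seq j)"
| "observe_current T \<mu> (Inr k) = (LINT x|\<mu>. test_fun k x)"

definition stage :: "nat \<Rightarrow> (nat + nat) set" where
  "stage N = {..<N} <+> {..<N}"

lemma observe_wind:
  assumes "piecewise_geodesic c" "closed_curve c"
  shows "observe v (wind c k) = real (Suc k) * observe v c"
  by (cases v) (simp_all add: form_seq_def curve_current_wind[OF assms] arc_integral_wind[OF assms] test_fun_Lipb)

lemma arc_integral_le:
  assumes c: "lipschitz_curve c" and f: "f \<in> Lip_funs" and B: "\<And>x. \<bar>f x\<bar> \<le> B"
  shows "\<bar>arc_integral c f\<bar> \<le> B * clen c" "arc_integral c (\<lambda>x. \<bar>f x\<bar>) \<le> B * clen c"
proof -
  have 1: "arc_integral c f \<le> B * clen c" if "f \<in> Lip_funs" "\<And>x. f x \<le> B" for f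
    unfolding arc_integral_const[OF c, symmetric] by (intro arc_integral_mono c that Lip_const)
  show "arc_integral c (\<lambda>x. \<bar>f x\<bar>) \<le> B * clen c" by (intro 1 Lip_abs f B)
  have "f x \<le> B" "- f x \<le> B" for x using B[of x] by auto
  then have "arc_integral c f \<le> B * clen c" "arc_integral c (\<lambda>x. - f x) \<le> B * clen c"
    by (intro 1 f Lip_minus; simp)+
  then show "\<bar>arc_integral c f\<bar> \<le> B * clen c"
    using arc_integral_cmult[of c "- 1" f] by simp
qed

lemma observe_bounded:
  "\<exists>B\<ge>0. \<forall>c :: 'a::{metric_space, second_countable_topology} curve. lipschitz_curve c \<longrightarrow> \<bar>observe v c\<bar> \<le> B * clen c"
proof (cases v)
  case (Inl j)
  let ?f = "test_fun (fst (prod_decode j)) :: 'a \<Rightarrow> real" and ?\<pi> = "test_fun (snd (prod_decode j)) :: 'a \<Rightarrow> real"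
  obtain B where B: "0 \<le> B" "\<And>x. \<bar>?f x\<bar> \<le> B" using Lipb_bound[OF test_fun_Lipb] by metis
  have \<pi>: "?\<pi> \<in> Lip_funs" and f: "?f \<in> Lip_funs" using test_fun_Lipb by (metis Lipb_Lip)+
  have "\<bar>observe v c\<bar> \<le> lip_const ?\<pi> * B * clen c" if c: "lipschitz_curve c" for c :: "'a curve"
  proof -
    have "\<bar>observe v c\<bar> \<le> lip_const ?\<pi> * arc_integral c (\<lambda>x. \<bar>?f x\<bar>)"
      using curve_current_bound[OF c f \<pi>] by (simp add: Inl form_seq_def)
    also have "\<dots> \<le> lip_const ?\<pi> * (B * clen c)"
      by (intro mult_left_mono arc_integral_le(2) c f B lip_const_nonneg \<pi>)
    finally show ?thesis by (simp add: mult.assoc)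
  qed
  then show ?thesis using B(1) lip_const_nonneg[OF \<pi>] by (intro exI[of _ "lip_const ?\<pi> * B"]) simp
next
  case (Inr k)
  obtain B where B: "0 \<le> B" "\<And>x. \<bar>test_fun k (x::'a)\<bar> \<le> B" using Lipb_bound[OF test_fun_Lipb] by metis
  then show ?thesis
    using arc_integral_le(1)[OF _ Lipb_Lip[OF test_fun_Lipb] B(2)] by (intro exI[of _ B]) (simp add: Inr)
qed

text \<open>
  \<open>n\<close> closed curves of length about \<open>l\<close> represent the normalized current at stage \<open>N\<close>. Nothing is tested
  at stage \<open>0\<close>, so constant curves qualify there.
\<close>

definition represents ::
  "('a::{metric_space, second_countable_topology} form \<Rightarrow> real) \<Rightarrow> 'a measure \<Rightarrow> nat \<Rightarrow> nat \<Rightarrow> nat \<times> (nat \<Rightarrow> 'a curve) \<Rightarrow> bool"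
  where
  "represents T \<mu> N l = (\<lambda>(n, \<gamma>). 0 < n \<and> N \<le> n \<and>
     (\<forall>i\<in>{1..n}. piecewise_geodesic (\<gamma> i) \<and> closed_curve (\<gamma> i) \<and> clen (\<gamma> i) \<le> real l \<and>
        real l - real l / real (Suc N) \<le> clen (\<gamma> i)) \<and>
     (\<forall>v\<in>stage N. \<bar>1 / (real n * real l) * (\<Sum>i=1..n. observe v (\<gamma> i)) - observe_current T \<mu> v / measure \<mu> UNIV\<bar>
        \<le> 2 / real (Suc N)))"

lemma represents_antimono:
  assumes "represents T \<mu> N l w" "N' \<le> N"
  shows "represents T \<mu> N' l w"
proof -
  obtain n \<gamma> where w: "w = (n, \<gamma>)" by (cases w)
  have "stage N' \<subseteq> stage N" using assms(2) by (auto simp: stage_def)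
  moreover have "real l / real (Suc N) \<le> real l / real (Suc N')" "2 / real (Suc N) \<le> 2 / real (Suc N')"
    using assms(2) by (auto intro!: divide_left_mono)
  ultimately show ?thesis
    using assms unfolding represents_def w by (auto intro: order_trans)
qed

lemma represents_0: "\<exists>w. represents T \<mu> 0 l w"
proof -
  let ?c = "Curve 0 (\<lambda>_. undefined)"
  have "geodesic ?c" by (simp add: geodesic_def)
  then have "piecewise_geodesic ?c" by (rule piecewise_geodesic.single)
  moreover have "stage 0 = {}" by (auto simp: stage_def)
  ultimately have "represents T \<mu> 0 l (1, \<lambda>_. ?c)"
    by (simp add: represents_def closed_curve_def cstart_def cend_def)
  then show ?thesis by blast
qed

text \<open>
  Nearly optimal closed curves, normalized by their lengths, have averages that approach the
  normalized current. Their lengths differ, but finitely many of them can all be wound up to length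
  almost \<open>l\<close> once \<open>l\<close> is large; winding does not change the normalized values.
\<close>

lemma represents_eventually:
  fixes T :: "'a::polish_space form \<Rightarrow> real"
  assumes geo: "geodesic_space TYPE('a)" and ab: "(a::'a) \<noteq> b"
    and T: "bilinear_on_D1 T" "current_local T" "current_continuous T" and mb: "mass_bound T \<mu>"
    and bd: "\<forall>f\<in>Lipb_funs. boundary T f = 0" and M: "0 < measure \<mu> UNIV"
  shows "\<exists>l0. \<forall>l\<ge>l0. \<exists>w. represents T \<mu> N l w"
proof -
  interpret finite_borel_measure \<mu> by (rule mass_bound_fbm[OF mb])
  define C where "C = {c :: 'a curve. piecewise_geodesic c \<and> closed_curve c \<and> 0 < clen c}"
  have Clip: "c \<in> C \<Longrightarrow> lipschitz_curve c" for c by (simp add: C_def piecewise_geodesic_lipschitz)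
  define p where "p v = observe_current T \<mu> v / measure \<mu> UNIV" for v
  define V where "V c v = observe v c / clen c" for v and c :: "'a curve"
  have fin: "finite (stage N)" by (simp add: stage_def)
  obtain B where B: "\<And>v. 0 \<le> B v" "\<And>v (c :: 'a curve). lipschitz_curve c \<Longrightarrow> \<bar>observe v c\<bar> \<le> B v * clen c"
    using observe_bounded by metis
  have V_le: "\<bar>V c v\<bar> \<le> B v" if "c \<in> C" for c v
    using B(2)[OF Clip[OF that], of v] that by (simp add: V_def C_def divide_le_eq)
  define R where "R = (\<Sum>v\<in>stage N. B v + \<bar>p v\<bar>)"
  have BR: "B v + \<bar>p v\<bar> \<le> R" if "v \<in> stage N" for v
    unfolding R_def using that B(1) fin by (intro member_le_sum) auto
  have R: "\<bar>V c v - p v\<bar> \<le> R" "\<bar>V c v\<bar> \<le> R" if "c \<in> C" "v \<in> stage N" for c v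
    using V_le[OF that(1), of v] BR[OF that(2)] by linarith+
  have R0: "0 \<le> R" unfolding R_def using B(1) by (intro sum_nonneg) auto
  have near_opt: "\<exists>c\<in>C. (\<Sum>v\<in>stage N. \<alpha> v * p v) - 1 \<le> (\<Sum>v\<in>stage N. \<alpha> v * V c v)" for \<alpha>
  proof -
    define f where "f j x = \<alpha> (Inl j) * test_fun (fst (prod_decode j)) x" for j and x :: 'a
    define \<pi> where "\<pi> j = (test_fun (snd (prod_decode j)) :: 'a \<Rightarrow> real)" for j
    define h where "h x = (\<Sum>k<N. \<alpha> (Inr k) * test_fun k x)" for x :: 'a
    have fL: "f j \<in> Lipb_funs" for j
      using Lipb_cmult[OF test_fun_Lipb] by (simp add: f_def[abs_def])
    have \<pi>L: "\<pi> j \<in> Lip_funs" for j by (simp add: \<pi>_def test_fun_Lipb)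
    have hL: "h \<in> Lipb_funs"
      unfolding h_def[abs_def] by (intro Lipb_sum Lipb_cmult test_fun_Lipb)
    obtain c :: "'a curve" where c: "piecewise_geodesic c" "closed_curve c" "0 < clen c"
      "((\<Sum>j<N. T (f j, \<pi> j)) + (LINT x|\<mu>. h x)) / measure \<mu> UNIV - 1
        \<le> ((\<Sum>j<N. curve_current c (f j, \<pi> j)) + arc_integral c h) / clen c"
      by (rule closed_curve_exists[OF geo ab T mb bd fL \<pi>L hL M zero_less_one, where N = N])
    have cl: "lipschitz_curve c" by (rule piecewise_geodesic_lipschitz[OF c(1)])
    have Tf: "T (f j, \<pi> j) = \<alpha> (Inl j) * T (form_seq j)" for j
      using bilinear_simps(1)[OF T(1) test_fun_Lipb \<pi>L] by (simp add: f_def[abs_def] form_seq_def \<pi>_def)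
    have cf: "curve_current c (f j, \<pi> j) = \<alpha> (Inl j) * curve_current c (form_seq j)" for j
      using bilinear_simps(1)[OF curve_current_bilinear[OF cl] test_fun_Lipb \<pi>L]
      by (simp add: f_def[abs_def] form_seq_def \<pi>_def)
    have ih: "(LINT x|\<mu>. h x) = (\<Sum>k<N. \<alpha> (Inr k) * (LINT x|\<mu>. test_fun k x))"
      unfolding h_def
      by (subst Bochner_Integration.integral_sum) (auto intro!: integrable_Lipb Lipb_cmult test_fun_Lipb)
    have ah: "arc_integral c h = (\<Sum>k<N. \<alpha> (Inr k) * arc_integral c (test_fun k))"
      unfolding h_def
      by (subst arc_integral_sum[OF cl]) (simp_all add: arc_integral_cmult Lip_cmult test_fun_Lipb)
    have "(\<Sum>v\<in>stage N. \<alpha> v * p v) = ((\<Sum>j<N. T (f j, \<pi> j)) + (LINT x|\<mu>. h x)) / measure \<mu> UNIV"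
      by (simp add: stage_def sum.Plus comp_def p_def Tf ih sum_divide_distrib add_divide_distrib)
    moreover have "(\<Sum>v\<in>stage N. \<alpha> v * V c v) = ((\<Sum>j<N. curve_current c (f j, \<pi> j)) + arc_integral c h) / clen c"
      by (simp add: stage_def sum.Plus comp_def V_def cf ah sum_divide_distrib add_divide_distrib)
    ultimately show ?thesis using c by (intro bexI[of _ c]) (simp_all add: C_def)
  qed
  have "\<exists>c. (\<forall>i. c i \<in> C) \<and>
      (\<forall>\<^sub>F n in sequentially. \<forall>v\<in>stage N. \<bar>(\<Sum>i<n. V (c i) v) / real n - p v\<bar> < 1 / real (Suc N))"
  proof (rule averages_approach[OF fin R(1) near_opt])
    fix c assume c: "\<And>i. c i \<in> C"
      "\<And>e. 0 < e \<Longrightarrow> \<forall>\<^sub>F n in sequentially. \<forall>v\<in>stage N. \<bar>(\<Sum>i<n. V (c i) v) / real n - p v\<bar> < e"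
    show ?thesis by (intro exI[of _ c] conjI allI c) simp
  qed
  then obtain c n0 where cC: "\<And>i. c i \<in> C"
    and n0: "\<And>n. n0 \<le> n \<Longrightarrow> \<forall>v\<in>stage N. \<bar>(\<Sum>i<n. V (c i) v) / real n - p v\<bar> < 1 / real (Suc N)"
    unfolding eventually_sequentially by metis
  define n where "n = max n0 (Suc N)"
  have n: "0 < n" "N \<le> n" "n0 \<le> n" by (auto simp: n_def)
  define L where "L = (\<Sum>i<n. clen (c i))"
  have cpos: "0 < clen (c i)" for i using cC by (simp add: C_def)
  have cL: "clen (c i) \<le> L" if "i < n" for i
    unfolding L_def using that cpos by (intro member_le_sum) (auto intro: less_imp_le)
  have L0: "0 < L" using cL[of 0] cpos[of 0] n(1) by linarith
  (* The factor bounds both the relative defect L / l of the lengths and its effect on the values by 1 / (N + 1). *)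
  obtain l0 :: nat where l0: "L * (R + 1) * real (Suc N) \<le> real l0" using real_arch_simple by blast
  show ?thesis
  proof (intro exI[of _ l0] allI impI)
    fix l assume "l0 \<le> l"
    then have l: "L * (R + 1) * real (Suc N) \<le> real l" using l0 by linarith
    have "L * 1 * 1 \<le> L * (R + 1) * real (Suc N)"
      using R0 L0 by (intro mult_mono) auto
    then have Ll: "L \<le> real l" and lpos: "0 < real l" using l L0 by linarith+
    have LN: "L \<le> real l / real (Suc N)"
    proof -
      have "L * real (Suc N) \<le> L * (R + 1) * real (Suc N)"
        using R0 L0 by (intro mult_right_mono) auto
      then show ?thesis using l by (simp add: le_divide_eq)
    qed
    have LR: "L / real l * R \<le> 1 / real (Suc N)"
    proof -
      have "L * R * real (Suc N) \<le> L * (R + 1) * real (Suc N)"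
        using R0 L0 by (intro mult_right_mono mult_left_mono) auto
      then have "L * R * real (Suc N) \<le> real l" using l by linarith
      then show ?thesis using lpos by (simp add: field_simps)
    qed
    have "\<forall>i. \<exists>k. i < n \<longrightarrow> clen (wind (c i) k) \<le> real l \<and> real l - clen (c i) \<le> clen (wind (c i) k)"
    proof
      fix i
      show "\<exists>k. i < n \<longrightarrow> clen (wind (c i) k) \<le> real l \<and> real l - clen (c i) \<le> clen (wind (c i) k)"
      proof (cases "i < n")
        case True
        then have "clen (c i) \<le> real l" using cL[OF True] Ll by linarith
        then show ?thesis using wind_to_length[of "c i" "real l"] cC[of i] by (auto simp: C_def)
      qed auto
    qed
    then obtain k where k: "\<And>i. i < n \<Longrightarrow> clen (wind (c i) (k i)) \<le> real l"
      "\<And>i. i < n \<Longrightarrow> real l - clen (c i) \<le> clen (wind (c i) (k i))" by metis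
    define \<gamma> where "\<gamma> i = wind (c (i - 1)) (k (i - 1))" for i
    have wnd: "piecewise_geodesic (wind (c i) (k i))" "closed_curve (wind (c i) (k i))"
      "clen (wind (c i) (k i)) = real (Suc (k i)) * clen (c i)" for i
      using wind[of "c i" "k i"] cC[of i] by (auto simp: C_def closed_curve_def)
    have obs: "observe v (wind (c i) (k i)) = clen (wind (c i) (k i)) * V (c i) v" for i v
      using observe_wind[of "c i" v "k i"] cC[of i] cpos[of i] wnd(3)[of i] by (simp add: C_def V_def)
    have shift: "(\<Sum>i=1..n. g (\<gamma> i)) = (\<Sum>i<n. g (wind (c i) (k i)))" for g :: "'a curve \<Rightarrow> real"
      by (simp add: \<gamma>_def sum.atLeast1_atMost_eq)
    have "\<bar>1 / (real n * real l) * (\<Sum>i=1..n. observe v (\<gamma> i)) - p v\<bar> \<le> 2 / real (Suc N)"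
      if v: "v \<in> stage N" for v
    proof -
      have eq: "1 / (real n * real l) * (\<Sum>i=1..n. observe v (\<gamma> i)) - (\<Sum>i<n. V (c i) v) / real n
          = (\<Sum>i<n. (clen (wind (c i) (k i)) / real l - 1) * V (c i) v) / real n"
      proof -
        have "(\<Sum>i<n. (clen (wind (c i) (k i)) / real l - 1) * V (c i) v)
            = (\<Sum>i<n. clen (wind (c i) (k i)) * V (c i) v) / real l - (\<Sum>i<n. V (c i) v)"
          by (simp add: left_diff_distrib sum_subtractf sum_divide_distrib)
        then show ?thesis unfolding shift obs by (simp add: diff_divide_distrib mult.commute)
      qed
      have "\<bar>\<Sum>i<n. (clen (wind (c i) (k i)) / real l - 1) * V (c i) v\<bar> \<le> (\<Sum>i<n. L / real l * R)"
      proof (rule order_trans[OF sum_abs], rule sum_mono)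
        fix i assume "i \<in> {..<n}"
        then have i: "i < n" by simp
        have "\<bar>clen (wind (c i) (k i)) / real l - 1\<bar> \<le> L / real l"
        proof -
          have "clen (wind (c i) (k i)) / real l - 1 = (clen (wind (c i) (k i)) - real l) / real l"
            using lpos by (simp add: diff_divide_distrib)
          then have "\<bar>clen (wind (c i) (k i)) / real l - 1\<bar> = \<bar>clen (wind (c i) (k i)) - real l\<bar> / real l"
            using lpos by simp
          also have "\<dots> \<le> L / real l" using k[OF i] cL[OF i] lpos by (intro divide_right_mono) auto
          finally show ?thesis .
        qed
        then show "\<bar>(clen (wind (c i) (k i)) / real l - 1) * V (c i) v\<bar> \<le> L / real l * R"
          unfolding abs_mult using R(2)[OF cC v, of i] L0 lpos by (intro mult_mono) auto
      qed
      also have "\<dots> = real n * (L / real l * R)" by simp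
      also have "\<dots> \<le> real n * (1 / real (Suc N))" by (intro mult_left_mono LR) simp
      finally have "\<bar>1 / (real n * real l) * (\<Sum>i=1..n. observe v (\<gamma> i)) - (\<Sum>i<n. V (c i) v) / real n\<bar> \<le> 1 / real (Suc N)"
        unfolding eq using n(1) by (simp add: pos_divide_le_eq mult.commute)
      moreover have "\<bar>(\<Sum>i<n. V (c i) v) / real n - p v\<bar> < 1 / real (Suc N)" using n0[OF n(3)] v by blast
      ultimately show ?thesis by (simp add: abs_le_iff abs_less_iff)
    qed
    moreover have "piecewise_geodesic (\<gamma> i) \<and> closed_curve (\<gamma> i) \<and> clen (\<gamma> i) \<le> real l \<and>
        real l - real l / real (Suc N) \<le> clen (\<gamma> i)" if "i \<in> {1..n}" for i
    proof -
      have i: "i - 1 < n" using that by auto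
      have "real l - real l / real (Suc N) \<le> clen (\<gamma> i)"
        using k(2)[OF i] cL[OF i] LN unfolding \<gamma>_def by linarith
      then show ?thesis using wnd k(1)[OF i] by (simp add: \<gamma>_def)
    qed
    ultimately have "represents T \<mu> N l (n, \<gamma>)"
      using n by (simp add: represents_def p_def)
    then show "\<exists>w. represents T \<mu> N l w" by blast
  qed
qed

section \<open>The approximating curves\<close>

theorem theorem4p2:
  fixes T :: "'a::polish_space form \<Rightarrow> real"
  assumes "geodesic_space TYPE('a)"
    and "T \<in> metric_currents1"
    and "\<exists>\<omega>\<in>D1. T \<omega> \<noteq> 0"
    and "\<forall>f\<in>Lipb_funs. boundary T f = 0"
  shows "\<exists>(n :: nat \<Rightarrow> nat) (\<gamma> :: nat \<Rightarrow> nat \<Rightarrow> 'a curve).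
    (\<forall>l\<ge>1. 0 < n l) \<and>
    filterlim n at_top sequentially \<and>
    (\<forall>l\<ge>1. \<forall>i\<in>{1..n l}.
       arclength_curve (\<gamma> i l) \<and> piecewise_geodesic (\<gamma> i l) \<and> closed_curve (\<gamma> i l) \<and>
       mass (curve_current (\<gamma> i l)) \<le> clen (\<gamma> i l) \<and> clen (\<gamma> i l) \<le> 2 * real l) \<and>
    (\<forall>\<omega>\<in>D1.
       (\<lambda>l. mass T / (real (n l) * real l) * (\<Sum>i=1..n l. curve_current (\<gamma> i l) \<omega>))
         \<longlonglongrightarrow> T \<omega>) \<and>
    (\<lambda>l. 1 / (real (n l) * real l) * (\<Sum>i=1..n l. mass (curve_current (\<gamma> i l)))) \<longlonglongrightarrow> 1 \<and>
    (\<lambda>l. 1 / (real (n l) * real l) * (\<Sum>i=1..n l. clen (\<gamma> i l))) \<longlonglongrightarrow> 1"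
proof -
  obtain \<mu>0 where T: "bilinear_on_D1 T" "current_local T" "current_continuous T" and \<mu>0: "mass_bound T \<mu>0"
    using assms(2) by (auto simp: metric_currents1_def)
  interpret B: mass_bounded \<mu>0 T
    using T(1) \<mu>0 mass_bound_fbm by (simp add: mass_bounded_def mass_bounded_axioms_def)
  define \<mu> where "\<mu> = mass_measure T"
  have mb: "mass_bound T \<mu>" unfolding \<mu>_def by (rule B.mass_measure_props(1))
  interpret finite_borel_measure \<mu> by (rule mass_bound_fbm[OF mb])
  define M where "M = mass T"
  have M_eq: "M = measure \<mu> UNIV" by (simp add: M_def mass_def \<mu>_def)
  obtain f0 \<pi>0 where f0: "f0 \<in> Lipb_funs" and \<pi>0: "\<pi>0 \<in> Lip_funs" and T0: "T (f0, \<pi>0) \<noteq> 0"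
    using assms(3) by (auto simp: D1_def)
  have M: "0 < M"
  proof (rule ccontr)
    assume "\<not> 0 < M"
    then have 0: "measure \<mu> UNIV = 0" using M_eq by (simp add: zero_less_measure_iff)
    obtain A where A: "0 \<le> A" "\<And>x. \<bar>f0 x\<bar> \<le> A" using Lipb_bound[OF f0] by blast
    have "(LINT x|\<mu>. \<bar>f0 x\<bar>) \<le> (LINT x|\<mu>. A)"
      by (intro integral_mono integrable_Lipb Lipb_abs f0 Lipb_const) (rule A(2))
    then have "(LINT x|\<mu>. \<bar>f0 x\<bar>) \<le> 0" using 0 by simp
    then have "lip_const \<pi>0 * (LINT x|\<mu>. \<bar>f0 x\<bar>) \<le> 0"
      using lip_const_nonneg[OF \<pi>0] by (simp add: mult_nonneg_nonpos)
    then show False using mass_boundD[OF mb f0 \<pi>0] T0 by simp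
  qed
  obtain a b :: 'a where ab: "a \<noteq> b"
  proof (rule ccontr)
    assume "\<not> thesis"
    then have "\<pi>0 constant_on UNIV" using that unfolding constant_on_def by metis
    then show False using T(2) f0 \<pi>0 T0 unfolding current_local_def by blast
  qed
  have M': "0 < measure \<mu> UNIV" using M M_eq by simp
  have "\<exists>W. (\<forall>l. represents T \<mu> 0 l (W l)) \<and> (\<forall>N. \<forall>\<^sub>F l in sequentially. represents T \<mu> N l (W l))"
  proof (rule diagonal_choice[of "represents T \<mu>", OF represents_antimono represents_0
        represents_eventually[OF assms(1) ab T mb assms(4) M']])
    fix w assume w: "\<And>l. represents T \<mu> 0 l (w l)" "\<And>N. \<forall>\<^sub>F l in sequentially. represents T \<mu> N l (w l)"
    show ?thesis by (intro exI[of _ w] conjI allI w)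
  qed
  then obtain W where W_all: "\<forall>l. represents T \<mu> 0 l (W l)"
      "\<forall>N. \<forall>\<^sub>F l in sequentially. represents T \<mu> N l (W l)"
    by (elim exE conjE)
  note W0 = W_all(1)[rule_format] and W = W_all(2)[rule_format]
  define n where "n l = fst (W l)" for l
  define \<gamma> where "\<gamma> i l = snd (W l) i" for i l
  have W_eq: "W l = (n l, (\<lambda>i. \<gamma> i l))" for l by (simp add: n_def \<gamma>_def)
  have npos: "0 < n l" for l using W0[of l] by (simp add: W_eq represents_def)
  have pg: "piecewise_geodesic (\<gamma> i l)" and cl: "closed_curve (\<gamma> i l)" and len: "clen (\<gamma> i l) \<le> real l"
    if "i \<in> {1..n l}" for i l
    using W0[of l] that by (auto simp: W_eq represents_def)
  have lip: "lipschitz_curve (\<gamma> i l)" if "i \<in> {1..n l}" for i l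
    by (rule piecewise_geodesic_lipschitz[OF pg[OF that]])
  have n_ge: "\<forall>\<^sub>F l in sequentially. N \<le> n l" for N
    using W[of N] by eventually_elim (simp add: W_eq represents_def)
  have obs: "(\<lambda>l. 1 / (real (n l) * real l) * (\<Sum>i=1..n l. observe v (\<gamma> i l))) \<longlonglongrightarrow> observe_current T \<mu> v / M" for v
  proof (rule LIMSEQ_I)
    fix e :: real assume "0 < e"
    obtain N0 where N0: "v \<in> stage N0" 
      by (cases v) (auto simp: stage_def)
    obtain N1 where N1: "1 / real (Suc N1) < e / 2" using \<open>0 < e\<close> nat_approx_posE[of "e / 2"] by auto
    define N where "N = max N0 N1"
    have v: "v \<in> stage N" using N0 by (auto simp: stage_def N_def)
    have "2 / real (Suc N) \<le> 2 / real (Suc N1)" by (intro divide_left_mono) (auto simp: N_def)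
    then have Ne: "2 / real (Suc N) < e" using N1 by simp
    have "\<forall>\<^sub>F l in sequentially. norm (1 / (real (n l) * real l) * (\<Sum>i=1..n l. observe v (\<gamma> i l)) - observe_current T \<mu> v / M) < e"
      using W[of N]
    proof eventually_elim
      case (elim l)
      then have "\<bar>1 / (real (n l) * real l) * (\<Sum>i=1..n l. observe v (\<gamma> i l)) - observe_current T \<mu> v / M\<bar> \<le> 2 / real (Suc N)"
        using v unfolding W_eq represents_def M_eq by blast
      then show ?case using Ne unfolding real_norm_def by linarith
    qed
    then show "\<exists>l0. \<forall>l\<ge>l0. norm (1 / (real (n l) * real l) * (\<Sum>i=1..n l. observe v (\<gamma> i l)) - observe_current T \<mu> v / M) < e"
      by (simp only: eventually_sequentially)
  qed
  have obs': "(\<lambda>l. M / (real (n l) * real l) * (\<Sum>i=1..n l. observe v (\<gamma> i l))) \<longlonglongrightarrow> observe_current T \<mu> v" for v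
    using tendsto_mult[OF tendsto_const obs, of M v] M by (simp add: mult.assoc)
  interpret A: curve_averages \<mu> T "\<lambda>l. M / (real (n l) * real l)" n \<gamma>
  proof
    show "(\<lambda>l. M / (real (n l) * real l) * (\<Sum>i=1..n l. arc_integral (\<gamma> i l) (test_fun k))) \<longlonglongrightarrow> (LINT x|\<mu>. test_fun k x)" for k
      using obs'[of "Inr k"] by simp
    show "(\<lambda>l. M / (real (n l) * real l) * (\<Sum>i=1..n l. curve_current (\<gamma> i l) (test_fun k, test_fun k'))) \<longlonglongrightarrow> T (test_fun k, test_fun k')" for k k'
      using obs'[of "Inl (prod_encode (k, k'))"] by (simp add: form_seq_def)
  qed (use T mb lip cl M in auto)
  have conv: "(\<lambda>l. M / (real (n l) * real l) * (\<Sum>i=1..n l. curve_current (\<gamma> i l) (f, \<pi>))) \<longlonglongrightarrow> T (f, \<pi>)"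
    if "f \<in> Lipb_funs" "\<pi> \<in> Lip_funs" for f \<pi>
    using A.S_tendsto[OF that] by (simp add: A.S_def)
  let ?len = "\<lambda>l. 1 / (real (n l) * real l) * (\<Sum>i=1..n l. clen (\<gamma> i l))"
  let ?mass = "\<lambda>l. 1 / (real (n l) * real l) * (\<Sum>i=1..n l. mass (curve_current (\<gamma> i l)))"
  have mass_len: "mass (curve_current (\<gamma> i l)) \<le> clen (\<gamma> i l)" if "i \<in> {1..n l}" for i l
    by (rule curve_mass_le_length[OF lip[OF that]])
  have len_le: "?len l \<le> 1" if "0 < l" for l
  proof -
    have "(\<Sum>i=1..n l. clen (\<gamma> i l)) \<le> (\<Sum>i=1..n l. real l)" by (intro sum_mono len)
    then show ?thesis using npos[of l] that by (simp add: divide_le_eq)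
  qed
  have mass_le: "?mass l \<le> ?len l" for l
    by (intro mult_left_mono sum_mono mass_len) auto
  (* Almost all of the mass of T is seen by finitely many forms, hence also by the curves. *)
  have mass_ge: "\<forall>\<^sub>F l in sequentially. 1 - e < ?mass l" if e: "0 < e" for e
  proof -
    have "0 < M * e" using e M by simp
    then have "\<exists>R f. finite R \<and> R \<subseteq> Lip1 \<and> (\<forall>\<pi>\<in>R. f \<pi> \<in> Lipb_funs) \<and>
      (\<forall>x. (\<Sum>\<pi>\<in>R. \<bar>f \<pi> x\<bar>) \<le> 1) \<and> mass T - M * e < (\<Sum>\<pi>\<in>R. T (f \<pi>, \<pi>))"
    proof (rule B.mass_formula)
      fix R f assume "finite R" "R \<subseteq> Lip1" "\<And>\<pi>. \<pi> \<in> R \<Longrightarrow> f \<pi> \<in> Lipb_funs"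
        "\<And>x. (\<Sum>\<pi>\<in>R. \<bar>f \<pi> x\<bar>) \<le> 1" "mass T - M * e < (\<Sum>\<pi>\<in>R. T (f \<pi>, \<pi>))"
      then show ?thesis by (intro exI[of _ R] exI[of _ f] conjI ballI allI)
    qed
    then obtain R f where R: "finite R" "R \<subseteq> Lip1" "\<forall>\<pi>\<in>R. f \<pi> \<in> Lipb_funs"
      "\<forall>x. (\<Sum>\<pi>\<in>R. \<bar>f \<pi> x\<bar>) \<le> 1" "mass T - M * e < (\<Sum>\<pi>\<in>R. T (f \<pi>, \<pi>))"
      by (elim exE conjE)
    have "(\<lambda>l. \<Sum>\<pi>\<in>R. M / (real (n l) * real l) * (\<Sum>i=1..n l. curve_current (\<gamma> i l) (f \<pi>, \<pi>))) \<longlonglongrightarrow> (\<Sum>\<pi>\<in>R. T (f \<pi>, \<pi>))"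
      using R(2,3) by (intro tendsto_sum conv) (auto simp: Lip1_def)
    then have "\<forall>\<^sub>F l in sequentially. M - M * e < (\<Sum>\<pi>\<in>R. M / (real (n l) * real l) * (\<Sum>i=1..n l. curve_current (\<gamma> i l) (f \<pi>, \<pi>)))"
      by (rule order_tendstoD(1)) (use R(5) in \<open>simp add: M_def\<close>)
    then show ?thesis
    proof eventually_elim
      case (elim l)
      have "(\<Sum>\<pi>\<in>R. M / (real (n l) * real l) * (\<Sum>i=1..n l. curve_current (\<gamma> i l) (f \<pi>, \<pi>)))
          = M / (real (n l) * real l) * (\<Sum>i=1..n l. \<Sum>\<pi>\<in>R. curve_current (\<gamma> i l) (f \<pi>, \<pi>))"
        unfolding sum_distrib_left[symmetric] by (subst sum.swap) simp
      also have "\<dots> \<le> M / (real (n l) * real l) * (\<Sum>i=1..n l. mass (curve_current (\<gamma> i l)))"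
        using M R by (intro mult_left_mono sum_mono curve_mass_ge lip) auto
      also have "\<dots> = M * ?mass l" by simp
      finally have "M * (1 - e) < M * ?mass l" using elim by (simp add: right_diff_distrib)
      then show ?case using M by (simp only: mult_less_cancel_left_pos)
    qed
  qed
  have lpos: "\<forall>\<^sub>F l in sequentially. (0::nat) < l" by (rule eventually_gt_at_top)
  have mass_lim: "?mass \<longlonglongrightarrow> 1"
  proof (rule order_tendstoI)
    fix x :: real assume "x < 1"
    then show "\<forall>\<^sub>F l in sequentially. x < ?mass l" using mass_ge[of "1 - x"] by simp
  next
    fix x :: real assume x: "1 < x"
    show "\<forall>\<^sub>F l in sequentially. ?mass l < x"
      using lpos by eventually_elim (use mass_le len_le x in \<open>meson le_less_trans order_trans\<close>)
  qed
  have len_lim: "?len \<longlonglongrightarrow> 1"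
  proof (rule tendsto_sandwich[OF _ _ mass_lim tendsto_const])
    show "\<forall>\<^sub>F l in sequentially. ?mass l \<le> ?len l" by (intro always_eventually allI mass_le)
    show "\<forall>\<^sub>F l in sequentially. ?len l \<le> 1" using lpos by eventually_elim (rule len_le)
  qed
  have "\<forall>l\<ge>1. \<forall>i\<in>{1..n l}. arclength_curve (\<gamma> i l) \<and> piecewise_geodesic (\<gamma> i l) \<and> closed_curve (\<gamma> i l) \<and>
       mass (curve_current (\<gamma> i l)) \<le> clen (\<gamma> i l) \<and> clen (\<gamma> i l) \<le> 2 * real l"
  proof (intro allI impI ballI conjI)
    fix l i assume i: "i \<in> {1..n l}"
    show "arclength_curve (\<gamma> i l)" by (rule piecewise_geodesic_arclength[OF pg[OF i]])
    show "clen (\<gamma> i l) \<le> 2 * real l" using len[OF i] by simp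
  qed (use pg cl mass_len in auto)
  moreover have "filterlim n at_top sequentially"
    unfolding filterlim_at_top using n_ge by blast
  moreover have "\<forall>\<omega>\<in>D1. (\<lambda>l. mass T / (real (n l) * real l) * (\<Sum>i=1..n l. curve_current (\<gamma> i l) \<omega>)) \<longlonglongrightarrow> T \<omega>"
    using conv unfolding M_def by (auto simp: D1_def)
  ultimately show ?thesis using npos mass_lim len_lim by blast
qed

end
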